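(* Let $q\in(0,1)$, $s\in[-\sqrt q,0)$, $\xi_y,\theta_x\in[-s,-s^{-1}]$ for $x,y\in\mathbb{Z}_{\ge1}$, and $\alpha,\beta\in[0,-s^{-1}]$, such that $\xi_y\theta_x<1$, $\alpha\theta_x<1$, $\beta\xi_y<1$, $\alpha\beta<1$ for all $x,y$. Let $\boldsymbol\lambda=\{\lambda^{(x,y)}\}_{x,y\ge0}$ be the sqW/sqW Yang-Baxter field with $(\alpha,\beta)$-scaled geometric boundary conditions. Let $\mathbb{H}^{\phi}$ be the height function of the ${}_4\phi_3$ stochastic vertex model with $(\alpha,\beta)$-stationary boundary conditions, and let $\mathcal{M}$ be a $q$-Poisson random variable with parameter $\alpha\beta$, i.e. $\mathrm{Prob}(\mathcal{M}=k)=\frac{(\alpha\beta)^k}{(q;q)_k}(\alpha\beta;q)_\infty$, $k\ge0$, independent of the vertex model. Then the two random fields $\{\ell(\lambda^{(x,y)}):x,y\in\mathbb{Z}_{\ge0}\}$ and $\{\mathbb{H}^{\phi}(x,y)+\mathcal{M}:x,y\in\mathbb{Z}_{\ge0}\}$ have the same distribution.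
   Context: **Notation.** $(a;q)_n=\prod_{i=1}^{n}(1-aq^{i-1})$ for $n\ge0$, $(a;q)_n=\prod_{i=n}^{-1}(1-aq^i)^{-1}$ for $n<0$, $(a;q)_\infty=\prod_{i\ge1}(1-aq^{i-1})$; ${}_{4}\overline\phi_3\bigl(q^{-n};a_1,a_2,a_3;\,b_1,b_2,b_3\,|\,q,z\bigr)=\sum_{j=0}^nz^j\frac{(q^{-n};q)_j}{(q;q)_j}\prod_{i=1}^3(a_i;q)_j(q^jb_i;q)_{n-j}$. A Young diagram $\lambda=1^{l_1}2^{l_2}\cdots$ has $l_i$ parts equal to $i$; $\ell(\lambda)=\sum_il_i$. **Fused weights** (rational in $q^J,q^I$, which are treated as independent parameters): $$w^{(J)}_{u}(i_1,j_1;i_2,j_2)=\mathbf{1}_{i_1+j_1=i_2+j_2}\frac{(-1)^{i_1+j_2}q^{\frac12i_1(i_1-1+2j_1)}s^{j_2-i_1}u^{i_1}(u/s;q)_{j_1-i_2}(q;q)_{j_1}}{(q;q)_{i_1}(q;q)_{j_2}(su;q)_{j_1+i_1}}\,{}_4\overline\phi_3\bigl(q^{-i_1};q^{-i_2},suq^J,qs/u;\,s^2,q^{1+j_2-i_1},q^{1-i_2-j_2+J}\,|\,q,q\bigr),$$ $$w^{*,(I)}_{v}(i_1,j_1;i_2,j_2)=\frac{(s^2;q)_{i_1}(q;q)_{i_2}}{(q;q)_{i_1}(s^2;q)_{i_2}}w^{(I)}_{v}(i_2,j_1;i_1,j_2),\qquad b^{(J)}_u(k)=(-uq^J)^k\frac{(q^{-J};q)_k}{(q;q)_k},$$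 $$R^{(I,J)}_z(i_1,j_1;i_2,j_2)=\mathbf{1}_{i_2+j_1=i_1+j_2}\frac{q^{i_1i_2+\frac12j_2(j_2-1)+j_2J}(-z)^{j_2}(q;q)_{j_1}}{(z;q)_{j_1+i_2}(q;q)_{j_2}(q;q)_{i_2}(q^{1-J}/z;q)_{i_1-j_1}}\,{}_4\overline\phi_3\bigl(q^{-i_2};q^{-i_1},zq^I,q^{1-J}/z;\,q^{-J},q^{1+j_2-i_2},q^{1-i_1-j_2+I}\,|\,q,q\bigr),$$ $$\Pi=\frac{(uvq^I;q)_\infty(uvq^J;q)_\infty}{(uv;q)_\infty(uvq^{I+J};q)_\infty}.$$ **Specializations.** A row specialization $\rho$ means a choice of $(u,q^J)$, and a column specialization $\rho^*$ a choice of $(v,q^I)$. $\mathrm{sqW}(\xi)$ is $(s,-\xi/s)$; $\mathrm{sg}(\alpha)$ is $(-\epsilon\alpha,1/\epsilon)$ with the limit $\epsilon\to0$ taken in all formulas; the same for columns with $\theta,\beta$ in place of $\xi,\alpha$. Denote the specialized weights by $w^\rho$, $w^{*,\rho^*}$, $b_\rho$, $b_{\rho^*}$ (the latter is $b^{(I)}_v$), $R^{\rho,\rho^*}$ (which is $R^{(I,J)}_{uv}$) and $\Pi_{\rho,\rho^*}$ (values at special parameter points are understood by continuity). Horizontal occupation numbers are in $\mathbb{Z}_{\ge0}$. In the stated parameter range all these weights are nonnegative and satisfy, for all boundary data $c=(a,a',m;b,b',l)$, the Yang-Baxter equation $$\sum_{k,p,p'}R(a,a';p',p)w^*(m,p;k,b)w(k,p';l,b')=\sum_{n,t,t'}w^*(n,a';l,t')w(m,a;n,t)R(t,t';b',b).\quad(\mathrm{YB}_c)$$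 **Bijectivization.** For each pair $(\rho,\rho^* )$ and each $c$ with positive sums, fix a coupling of the two probability measures on triples $(k,p,p')$ and $(n,t,t')$ proportional to the summands on the two sides of $(\mathrm{YB}_c)$, and let $\mathbf{p}_c((k,p,p')\to(n,t,t'))$ be the conditional probability of $(n,t,t')$ given $(k,p,p')$. **Forward transition $\varkappa\to\nu$ given $\lambda,\mu$ with specializations $\rho,\rho^*$.** Let $\varkappa=1^{k_1}2^{k_2}\cdots$, $\mu=1^{m_1}2^{m_2}\cdots$, $\lambda=1^{l_1}2^{l_2}\cdots$, $i_h=\sum_{r>h}(m_r-k_r)$, $i'_h=\sum_{r>h}(l_r-k_r)$. Choose $(j_0,j_0')$ with probability $$\frac{b_{\rho^*}(j_0')\,b_\rho(j_0)\,R^{\rho,\rho^*}(j_0,j_0';i_0',i_0)}{\Pi_{\rho,\rho^*}\,b_{\rho^*}(i_0)\,b_\rho(i_0')}.$$ Then for $h=1,2,\dots$ choose $(n_h,j_h,j_h')$ with probability $\mathbf{p}_c((k_h,i_{h-1},i'_{h-1})\to(n_h,j_h,j'_h))$, $c=(j_{h-1},j'_{h-1},m_h;i_h,i'_h,l_h)$. Output $\nu=1^{n_1}2^{n_2}\cdots$. Couplings are chosen so that almost surely $j_h=j_h'=0$ for large $h$ (such couplings exist). **The field.** Put $\rho_0=\mathrm{sg}(\alpha)$, $\rho_y=\mathrm{sqW}(\xi_y)$ for $y\ge1$; $\rho^*_0=\mathrm{sg}(\beta)$, $\rho^*_x=\mathrm{sqW}(\theta_x)$ for $x\ge1$. Define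 $\eta^{(x,y)}$ for $x,y\ge-1$ by $\eta^{(x,-1)}=\eta^{(-1,y)}=\varnothing$ and, inductively in $x+y$ with independent randomness, $\eta^{(x,y)}$ ($x,y\ge0$) is the output of the forward transition with $\varkappa=\eta^{(x-1,y-1)}$, $\mu=\eta^{(x,y-1)}$, $\lambda=\eta^{(x-1,y)}$ and specializations $\rho_y,\rho^*_x$. Then $\boldsymbol\lambda$ is the restriction of $\boldsymbol\eta$ to $x,y\ge0$. "The" Yang-Baxter field means any field so obtained, for any choice (for each pair $(\rho,\rho^* )$ and each $c$ with positive sums) of couplings of the two probability measures proportional to the summands on the two sides of $(\mathrm{YB}_c)$ such that almost surely $j_h=j_h'=0$ for large $h$. **The ${}_4\phi_3$ stochastic vertex model.** A random configuration of up-left directed paths on $\mathbb{Z}_{\ge0}^2$ with arbitrarily many paths per edge. Vertex $(x,y)$, $x,y\ge1$, has configuration $(i_1,j_1;i_2,j_2)$: the numbers of paths on the bottom, left, top, right adjacent edges, respectively, with $i_1+j_2=i_2+j_1$. Sequentially in $x+y$ and independently given $(i_1,j_1)$, the pair $(i_2,j_2)$ is chosen with probability $$\mathbb{L}_{\xi,\theta}(i_1,j_1;i_2,j_2)=\mathbf{1}_{i_1+j_2=i_2+j_1}\frac{\xi^{i_2}s^{i_1}\theta^{i_2-i_1}q^{j_1j_2+\frac12i_1(i_1-1)}(-s/\theta;q)_{i_2}(-s/\xi;q)_{j_2}}{(-s/\theta;q)_{i_1}(-s/\xi;q)_{j_1}(q;q)_{j_2}(-q/(s\xi);q)_{j_2-i_2}}\cdot\frac{(s^2q^{i_1+j_2};q)_\infty(\theta\xi;q)_\infty}{(-s\xi;q)_\infty(-s\theta;q)_\infty}\,{}_4\overline\phi_3\bigl(q^{-j_1};q^{-j_2},-s\theta,-q/(s\xi);\,-s/\xi,q^{1+i_1-j_1},-\theta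 q^{1-j_2-i_1}/s\,|\,q,q\bigr)$$ with $\xi=\xi_y$, $\theta=\theta_x$ (removable singularities understood by continuity). The $(\alpha,\beta)$-stationary boundary conditions: independent random variables $b^{\mathrm h}_x$ (number of paths entering $(x,1)$ from below, i.e. its $i_1$) and $b^{\mathrm v}_y$ (number of paths exiting the quadrant through the left edge of $(1,y)$, i.e. its $j_1$) with $$\mathrm{Prob}(b^{\mathrm h}_x=k)=(\alpha\theta_x)^k\frac{(-s/\theta_x;q)_k}{(q;q)_k}\frac{(\alpha\theta_x;q)_\infty}{(-s\alpha;q)_\infty},\qquad \mathrm{Prob}(b^{\mathrm v}_y=k)=(\beta\xi_y)^k\frac{(-s/\xi_y;q)_k}{(q;q)_k}\frac{(\beta\xi_y;q)_\infty}{(-s\beta;q)_\infty}.$$ The height function $\mathbb{H}^\phi(x,y)$ counts the paths between $(0,0)$ and $(x,y)$, including those through $(x,y)$: $\mathbb{H}^\phi(0,0)=0$, $\mathbb{H}^\phi(x,0)-\mathbb{H}^\phi(x-1,0)=b^{\mathrm h}_x$, $\mathbb{H}^\phi(0,y)-\mathbb{H}^\phi(0,y-1)=b^{\mathrm v}_y$, and for $x,y\ge1$, $\mathbb{H}^\phi(x,y)-\mathbb{H}^\phi(x-1,y)=i_2$ and $\mathbb{H}^\phi(x,y)-\mathbb{H}^\phi(x,y-1)=j_2$ at the vertex $(x,y)$. *)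

theory Defs
  imports "HOL-Probability.Probability" "HOL-Library.Multiset"
begin

section \<open>q-series\<close>

definition qpoch :: "real \<Rightarrow> real \<Rightarrow> int \<Rightarrow> real" where
  "qpoch a q n =
     (if n \<ge> 0 then (\<Prod>i=1..nat n. 1 - a * q ^ (i - 1))
      else (\<Prod>i\<in>{n..-1}. inverse (1 - a * q powi i)))"

definition qpoch_inf :: "real \<Rightarrow> real \<Rightarrow> real" where
  "qpoch_inf a q = prodinf (\<lambda>i. 1 - a * q ^ i)"

text \<open>The regularized terminating series; its first upper argument \<open>q\<close> to the power \<open>-n\<close> is
  represented by \<open>n\<close>.\<close>
definition phi43 ::
  "nat \<Rightarrow> real \<Rightarrow> real \<Rightarrow> real \<Rightarrow> real \<Rightarrow> real \<Rightarrow> real \<Rightarrow> real \<Rightarrow> real \<Rightarrow> real" where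
  "phi43 n a1 a2 a3 b1 b2 b3 q z =
     (\<Sum>j=0..n. z ^ j * (qpoch (q powi (- int n)) q (int j) / qpoch q q (int j))
        * (qpoch a1 q (int j) * qpoch (q ^ j * b1) q (int n - int j))
        * (qpoch a2 q (int j) * qpoch (q ^ j * b2) q (int n - int j))
        * (qpoch a3 q (int j) * qpoch (q ^ j * b3) q (int n - int j)))"


section \<open>Fused weights\<close>

text \<open>Throughout, \<open>Q\<close> stands for \<open>q\<close> to the power \<open>J\<close> and \<open>P\<close> for \<open>q\<close> to the power \<open>I\<close>; both are
  independent parameters. At points where a denominator vanishes, or where one divides by
  \<open>u = 0\<close> or \<open>z = 0\<close>, the values of these functions are meaningless; only the limits taken in
  \<open>spec_lim\<close> are used.\<close>

definition w_fused ::
  "real \<Rightarrow> real \<Rightarrow> real \<Rightarrow> real \<Rightarrow> nat \<Rightarrow> nat \<Rightarrow> nat \<Rightarrow> nat \<Rightarrow> real" where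
  "w_fused q s u Q i1 j1 i2 j2 =
     (if i1 + j1 = i2 + j2 then
        (-1) ^ (i1 + j2) * q ^ (i1 * (i1 - 1 + 2 * j1) div 2) * s powi (int j2 - int i1) * u ^ i1
        * qpoch (u / s) q (int j1 - int i2) * qpoch q q (int j1)
        / (qpoch q q (int i1) * qpoch q q (int j2) * qpoch (s * u) q (int (j1 + i1)))
        * phi43 i1 (q powi (- int i2)) (s * u * Q) (q * s / u)
            (s\<^sup>2) (q powi (1 + int j2 - int i1)) (q powi (1 - int i2 - int j2) * Q) q q
      else 0)"

definition wstar_fused ::
  "real \<Rightarrow> real \<Rightarrow> real \<Rightarrow> real \<Rightarrow> nat \<Rightarrow> nat \<Rightarrow> nat \<Rightarrow> nat \<Rightarrow> real" where
  "wstar_fused q s v P i1 j1 i2 j2 =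
     qpoch (s\<^sup>2) q (int i1) * qpoch q q (int i2) / (qpoch q q (int i1) * qpoch (s\<^sup>2) q (int i2))
     * w_fused q s v P i2 j1 i1 j2"

definition b_fused :: "real \<Rightarrow> real \<Rightarrow> real \<Rightarrow> nat \<Rightarrow> real" where
  "b_fused q u Q k = (- u * Q) ^ k * (qpoch (inverse Q) q (int k) / qpoch q q (int k))"

definition R_fused ::
  "real \<Rightarrow> real \<Rightarrow> real \<Rightarrow> real \<Rightarrow> nat \<Rightarrow> nat \<Rightarrow> nat \<Rightarrow> nat \<Rightarrow> real" where
  "R_fused q z P Q i1 j1 i2 j2 =
     (if i2 + j1 = i1 + j2 then
        q ^ (i1 * i2 + j2 * (j2 - 1) div 2) * Q ^ j2 * (- z) ^ j2 * qpoch q q (int j1)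
        / (qpoch z q (int (j1 + i2)) * qpoch q q (int j2) * qpoch q q (int i2)
           * qpoch (q / Q / z) q (int i1 - int j1))
        * phi43 i2 (q powi (- int i1)) (z * P) (q / Q / z)
            (inverse Q) (q powi (1 + int j2 - int i2)) (q powi (1 - int i1 - int j2) * P) q q
      else 0)"

definition Pi_fused :: "real \<Rightarrow> real \<Rightarrow> real \<Rightarrow> real \<Rightarrow> real" where
  "Pi_fused q z P Q =
     qpoch_inf (z * P) q * qpoch_inf (z * Q) q / (qpoch_inf z q * qpoch_inf (z * P * Q) q)"


section \<open>Specializations\<close>

datatype spec = sqW real | sg real

text \<open>Evaluation of a function of \<open>(u, Q)\<close> (respectively \<open>(v, P)\<close>) at a specialization. The outer
  limit over the parameter implements evaluation by continuity at removable singularities: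
  \<open>R_fused\<close> has such singularities for \<open>sqW\<close>, and the scaled geometric specialization with
  parameter \<open>0\<close> corresponds to \<open>u = 0\<close>, where the displayed formulas divide by \<open>u\<close>.\<close>
fun spec_lim :: "real \<Rightarrow> spec \<Rightarrow> (real \<Rightarrow> real \<Rightarrow> real) \<Rightarrow> real" where
  "spec_lim s (sqW x) f = Lim (at x) (\<lambda>x'. f s (- x' / s))"
| "spec_lim s (sg a) f = Lim (at a) (\<lambda>a'. Lim (at_right 0) (\<lambda>\<epsilon>. f (- \<epsilon> * a') (1 / \<epsilon>)))"

definition w_spec :: "real \<Rightarrow> real \<Rightarrow> spec \<Rightarrow> nat \<Rightarrow> nat \<Rightarrow> nat \<Rightarrow> nat \<Rightarrow> real" where
  "w_spec q s \<rho> i1 j1 i2 j2 = spec_lim s \<rho> (\<lambda>u Q. w_fused q s u Q i1 j1 i2 j2)"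

definition wstar_spec :: "real \<Rightarrow> real \<Rightarrow> spec \<Rightarrow> nat \<Rightarrow> nat \<Rightarrow> nat \<Rightarrow> nat \<Rightarrow> real" where
  "wstar_spec q s \<rho>' i1 j1 i2 j2 = spec_lim s \<rho>' (\<lambda>v P. wstar_fused q s v P i1 j1 i2 j2)"

definition b_spec :: "real \<Rightarrow> real \<Rightarrow> spec \<Rightarrow> nat \<Rightarrow> real" where
  "b_spec q s \<rho> k = spec_lim s \<rho> (\<lambda>u Q. b_fused q u Q k)"

definition R_spec :: "real \<Rightarrow> real \<Rightarrow> spec \<Rightarrow> spec \<Rightarrow> nat \<Rightarrow> nat \<Rightarrow> nat \<Rightarrow> nat \<Rightarrow> real" where
  "R_spec q s \<rho> \<rho>' i1 j1 i2 j2 =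
     spec_lim s \<rho> (\<lambda>u Q. spec_lim s \<rho>' (\<lambda>v P. R_fused q (u * v) P Q i1 j1 i2 j2))"

definition Pi_spec :: "real \<Rightarrow> real \<Rightarrow> spec \<Rightarrow> spec \<Rightarrow> real" where
  "Pi_spec q s \<rho> \<rho>' = spec_lim s \<rho> (\<lambda>u Q. spec_lim s \<rho>' (\<lambda>v P. Pi_fused q (u * v) P Q))"


section \<open>Yang-Baxter equation and bijectivization\<close>

type_synonym triple = "nat \<times> nat \<times> nat"

text \<open>Boundary data \<open>(a, a', m, b, b', l)\<close>.\<close>
type_synonym bdata = "nat \<times> nat \<times> nat \<times> nat \<times> nat \<times> nat"

fun YB_lhs :: "real \<Rightarrow> real \<Rightarrow> spec \<Rightarrow> spec \<Rightarrow> bdata \<Rightarrow> triple \<Rightarrow> real" where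
  "YB_lhs q s \<rho> \<rho>' (a, a', m, b, b', l) (k, p, p') =
     R_spec q s \<rho> \<rho>' a a' p' p * wstar_spec q s \<rho>' m p k b * w_spec q s \<rho> k p' l b'"

fun YB_rhs :: "real \<Rightarrow> real \<Rightarrow> spec \<Rightarrow> spec \<Rightarrow> bdata \<Rightarrow> triple \<Rightarrow> real" where
  "YB_rhs q s \<rho> \<rho>' (a, a', m, b, b', l) (n, t, t') =
     wstar_spec q s \<rho>' n a' l t' * w_spec q s \<rho> m a n t * R_spec q s \<rho> \<rho>' t t' b' b"

definition YB_positive :: "real \<Rightarrow> real \<Rightarrow> spec \<Rightarrow> spec \<Rightarrow> bdata \<Rightarrow> bool" where
  "YB_positive q s \<rho> \<rho>' c \<longleftrightarrow>
     0 < infsum (YB_lhs q s \<rho> \<rho>' c) UNIV \<and> 0 < infsum (YB_rhs q s \<rho> \<rho>' c) UNIV"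

text \<open>The sums in the Yang-Baxter equation have finitely many nonzero terms because of the
  conservation laws in the weights.\<close>
definition bijectivization ::
  "real \<Rightarrow> real \<Rightarrow> spec \<Rightarrow> spec \<Rightarrow> (bdata \<Rightarrow> (triple \<times> triple) pmf) \<Rightarrow> bool" where
  "bijectivization q s \<rho> \<rho>' K \<longleftrightarrow>
     (\<forall>c. YB_positive q s \<rho> \<rho>' c \<longrightarrow>
        (\<forall>\<tau>. pmf (map_pmf fst (K c)) \<tau> =
               YB_lhs q s \<rho> \<rho>' c \<tau> / infsum (YB_lhs q s \<rho> \<rho>' c) UNIV) \<and>
        (\<forall>\<tau>. pmf (map_pmf snd (K c)) \<tau> =
               YB_rhs q s \<rho> \<rho>' c \<tau> / infsum (YB_rhs q s \<rho> \<rho>' c) UNIV))"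

text \<open>The conditional probability of \<open>\<tau>'\<close> given \<open>\<tau>\<close>. It is only defined for boundary data with
  positive sums; elsewhere no transition is possible, which is expressed by the value \<open>0\<close>.\<close>
definition step_prob ::
  "real \<Rightarrow> real \<Rightarrow> spec \<Rightarrow> spec \<Rightarrow> (bdata \<Rightarrow> (triple \<times> triple) pmf) \<Rightarrow>
   bdata \<Rightarrow> triple \<Rightarrow> triple \<Rightarrow> real" where
  "step_prob q s \<rho> \<rho>' K c \<tau> \<tau>' =
     (if YB_positive q s \<rho> \<rho>' c
      then cond_prob (measure_pmf (K c)) (\<lambda>\<pi>. snd \<pi> = \<tau>') (\<lambda>\<pi>. fst \<pi> = \<tau>)
      else 0)"


section \<open>Forward transitions\<close>

text \<open>A Young diagram is the multiset of its parts: a multiset of positive natural numbers. The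
  number of parts equal to \<open>r\<close> is \<open>count \<lambda> r\<close>, and the length of \<open>\<lambda>\<close> is \<open>size \<lambda>\<close>.\<close>
type_synonym diagram = "nat multiset"

text \<open>The sum of \<open>m\<^sub>r - k\<^sub>r\<close> over \<open>r > h\<close>. It is nonnegative for all pairs of neighbouring diagrams
  that occur in the field with positive probability, so \<open>nat\<close> truncates nothing there.\<close>
definition occ :: "diagram \<Rightarrow> diagram \<Rightarrow> nat \<Rightarrow> nat" where
  "occ \<mu> \<kappa> h =
     nat (\<Sum>r\<in>{r \<in> set_mset \<mu> \<union> set_mset \<kappa>. h < r}. int (count \<mu> r) - int (count \<kappa> r))"

definition init_prob ::
  "real \<Rightarrow> real \<Rightarrow> spec \<Rightarrow> spec \<Rightarrow> nat \<Rightarrow> nat \<Rightarrow> nat \<Rightarrow> nat \<Rightarrow> real" where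
  "init_prob q s \<rho> \<rho>' i0 i0' j0 j0' =
     b_spec q s \<rho>' j0' * b_spec q s \<rho> j0 * R_spec q s \<rho> \<rho>' j0 j0' i0' i0
     / (Pi_spec q s \<rho> \<rho>' * b_spec q s \<rho>' i0 * b_spec q s \<rho> i0')"

text \<open>Probability that the forward transition given \<open>\<kappa>\<close>, \<open>\<lambda>\<close>, \<open>\<mu>\<close> samples \<open>(j 0, j' 0)\<close> and then
  \<open>(n h, j h, j' h)\<close> for \<open>h = 1, \<dots>, H\<close>.\<close>
definition forward_prob ::
  "real \<Rightarrow> real \<Rightarrow> spec \<Rightarrow> spec \<Rightarrow> (bdata \<Rightarrow> (triple \<times> triple) pmf) \<Rightarrow>
   diagram \<Rightarrow> diagram \<Rightarrow> diagram \<Rightarrow> nat \<Rightarrow> (nat \<Rightarrow> nat) \<Rightarrow> (nat \<Rightarrow> nat) \<Rightarrow> (nat \<Rightarrow> nat) \<Rightarrow> real" where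
  "forward_prob q s \<rho> \<rho>' K \<kappa> lam \<mu> H n j j' =
     init_prob q s \<rho> \<rho>' (occ \<mu> \<kappa> 0) (occ lam \<kappa> 0) (j 0) (j' 0) *
     (\<Prod>h=1..H. step_prob q s \<rho> \<rho>' K
        (j (h - 1), j' (h - 1), count \<mu> h, occ \<mu> \<kappa> h, occ lam \<kappa> h, count lam h)
        (count \<kappa> h, occ \<mu> \<kappa> (h - 1), occ lam \<kappa> (h - 1))
        (n h, j h, j' h))"


section \<open>The Yang-Baxter field\<close>

definition row_spec :: "(nat \<Rightarrow> real) \<Rightarrow> real \<Rightarrow> nat \<Rightarrow> spec" where
  "row_spec \<xi> \<alpha> y = (if y = 0 then sg \<alpha> else sqW (\<xi> y))"

definition col_spec :: "(nat \<Rightarrow> real) \<Rightarrow> real \<Rightarrow> nat \<Rightarrow> spec" where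
  "col_spec \<theta> \<beta> x = (if x = 0 then sg \<beta> else sqW (\<theta> x))"

text \<open>Extension of an array of diagrams by empty diagrams to the coordinates \<open>-1\<close>.\<close>
definition with_empty_boundary :: "(nat \<Rightarrow> nat \<Rightarrow> diagram) \<Rightarrow> int \<Rightarrow> int \<Rightarrow> diagram" where
  "with_empty_boundary \<zeta> x y = (if x < 0 \<or> y < 0 then {#} else \<zeta> (nat x) (nat y))"

text \<open>The diagrams are sampled antidiagonal by antidiagonal. Given those with \<open>x + y < d\<close>, the
  forward transitions at the points of the antidiagonal \<open>x + y = d\<close> are independent; \<open>j x y h\<close> and
  \<open>j' x y h\<close> are the auxiliary variables of the transition at \<open>(x, y)\<close>, and its output \<open>F x y\<close> has
  multiplicities \<open>n\<^sub>h = count (F x y) h\<close>.\<close>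
definition YB_field ::
  "'w measure \<Rightarrow> real \<Rightarrow> real \<Rightarrow> (nat \<Rightarrow> real) \<Rightarrow> (nat \<Rightarrow> real) \<Rightarrow> real \<Rightarrow> real \<Rightarrow>
   (spec \<Rightarrow> spec \<Rightarrow> bdata \<Rightarrow> (triple \<times> triple) pmf) \<Rightarrow> (nat \<Rightarrow> nat \<Rightarrow> 'w \<Rightarrow> diagram) \<Rightarrow> bool" where
  "YB_field M q s \<xi> \<theta> \<alpha> \<beta> K F \<longleftrightarrow>
     (\<forall>x y. bijectivization q s (row_spec \<xi> \<alpha> y) (col_spec \<theta> \<beta> x)
              (K (row_spec \<xi> \<alpha> y) (col_spec \<theta> \<beta> x))) \<and>
     (\<forall>x y. F x y \<in> measurable M (count_space UNIV)) \<and>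
     (\<forall>x y. \<forall>\<omega>\<in>space M. 0 \<notin># F x y \<omega>) \<and>
     (\<exists>j j' :: nat \<Rightarrow> nat \<Rightarrow> nat \<Rightarrow> 'w \<Rightarrow> nat.
        (\<forall>x y h. j x y h \<in> measurable M (count_space UNIV)) \<and>
        (\<forall>x y h. j' x y h \<in> measurable M (count_space UNIV)) \<and>
        (AE \<omega> in M. \<forall>x y. \<forall>\<^sub>F h in sequentially. j x y h \<omega> = 0 \<and> j' x y h \<omega> = 0) \<and>
        (\<forall>d H (\<zeta> :: nat \<Rightarrow> nat \<Rightarrow> diagram) (n :: nat \<Rightarrow> nat \<Rightarrow> nat \<Rightarrow> nat) a a'.
           let \<eta> = with_empty_boundary \<zeta> in
           measure M {\<omega> \<in> space M. (\<forall>x y. x + y < d \<longrightarrow> F x y \<omega> = \<zeta> x y) \<and>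
              (\<forall>x y. x + y = d \<longrightarrow>
                 j x y 0 \<omega> = a x y 0 \<and> j' x y 0 \<omega> = a' x y 0 \<and>
                 (\<forall>h\<in>{1..H}. count (F x y \<omega>) h = n x y h \<and>
                    j x y h \<omega> = a x y h \<and> j' x y h \<omega> = a' x y h))}
           = measure M {\<omega> \<in> space M. \<forall>x y. x + y < d \<longrightarrow> F x y \<omega> = \<zeta> x y} *
             (\<Prod>(x, y)\<in>{(x, y). x + y = d}.
                forward_prob q s (row_spec \<xi> \<alpha> y) (col_spec \<theta> \<beta> x)
                  (K (row_spec \<xi> \<alpha> y) (col_spec \<theta> \<beta> x))
                  (\<eta> (int x - 1) (int y - 1)) (\<eta> (int x - 1) (int y)) (\<eta> (int x) (int y - 1))
                  H (n x y) (a x y) (a' x y))))"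


section \<open>The stochastic vertex model\<close>

definition L_weight :: "real \<Rightarrow> real \<Rightarrow> real \<Rightarrow> real \<Rightarrow> nat \<Rightarrow> nat \<Rightarrow> nat \<Rightarrow> nat \<Rightarrow> real" where
  "L_weight q s \<xi> \<theta> i1 j1 i2 j2 =
     (if i1 + j2 = i2 + j1 then
        \<xi> ^ i2 * s ^ i1 * \<theta> powi (int i2 - int i1) * q ^ (j1 * j2 + i1 * (i1 - 1) div 2)
        * qpoch (- s / \<theta>) q (int i2) * qpoch (- s / \<xi>) q (int j2)
        / (qpoch (- s / \<theta>) q (int i1) * qpoch (- s / \<xi>) q (int j1) * qpoch q q (int j2)
           * qpoch (- q / (s * \<xi>)) q (int j2 - int i2))
        * (qpoch_inf (s\<^sup>2 * q ^ (i1 + j2)) q * qpoch_inf (\<theta> * \<xi>) q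
           / (qpoch_inf (- s * \<xi>) q * qpoch_inf (- s * \<theta>) q))
        * phi43 j1 (q powi (- int j2)) (- s * \<theta>) (- q / (s * \<xi>))
            (- s / \<xi>) (q powi (1 + int i1 - int j1)) (- \<theta> * q powi (1 - int j2 - int i1) / s) q q
      else 0)"

text \<open>Removable singularities by continuity. If \<open>\<theta> = -s\<close> (or \<open>\<xi> = -s\<close>) the limit need not exist when
  \<open>i1 > 0\<close> (or \<open>j1 > 0\<close>), but then such \<open>i1\<close> (\<open>j1\<close>) have probability zero in the model.\<close>
definition L_cont :: "real \<Rightarrow> real \<Rightarrow> real \<Rightarrow> real \<Rightarrow> nat \<Rightarrow> nat \<Rightarrow> nat \<Rightarrow> nat \<Rightarrow> real" where
  "L_cont q s \<xi> \<theta> i1 j1 i2 j2 =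
     Lim (at \<xi>) (\<lambda>\<xi>'. Lim (at \<theta>) (\<lambda>\<theta>'. L_weight q s \<xi>' \<theta>' i1 j1 i2 j2))"

definition boundary_prob :: "real \<Rightarrow> real \<Rightarrow> real \<Rightarrow> real \<Rightarrow> nat \<Rightarrow> real" where
  "boundary_prob q s a x k =
     (a * x) ^ k * (qpoch (- s / x) q (int k) / qpoch q q (int k))
     * (qpoch_inf (a * x) q / qpoch_inf (- s * a) q)"

text \<open>\<open>V x y\<close> (for \<open>x \<ge> 1\<close>) is the number of paths on the edge from \<open>(x, y)\<close> up to \<open>(x, y + 1)\<close>, and
  \<open>E x y\<close> (for \<open>y \<ge> 1\<close>) the number on the edge between \<open>(x, y)\<close> and \<open>(x + 1, y)\<close>. So the
  configuration at \<open>(x, y)\<close> is \<open>(V x (y - 1), E (x - 1) y; V x y, E x y)\<close>, and the boundary values are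
  \<open>V x 0\<close> and \<open>E 0 y\<close>.\<close>
definition vertex_model ::
  "'w measure \<Rightarrow> real \<Rightarrow> real \<Rightarrow> (nat \<Rightarrow> real) \<Rightarrow> (nat \<Rightarrow> real) \<Rightarrow> real \<Rightarrow> real \<Rightarrow>
   (nat \<Rightarrow> nat \<Rightarrow> 'w \<Rightarrow> nat) \<Rightarrow> (nat \<Rightarrow> nat \<Rightarrow> 'w \<Rightarrow> nat) \<Rightarrow> bool" where
  "vertex_model M q s \<xi> \<theta> \<alpha> \<beta> V E \<longleftrightarrow>
     (\<forall>x y. 1 \<le> x \<longrightarrow> V x y \<in> measurable M (count_space UNIV)) \<and>
     (\<forall>x y. 1 \<le> y \<longrightarrow> E x y \<in> measurable M (count_space UNIV)) \<and>
     prob_space.indep_vars M (\<lambda>_. count_space UNIV)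
       (case_sum (\<lambda>x. V x 0) (\<lambda>y. E 0 y)) ({1..} <+> {1..}) \<and>
     (\<forall>x k. 1 \<le> x \<longrightarrow> measure M {\<omega> \<in> space M. V x 0 \<omega> = k} = boundary_prob q s \<alpha> (\<theta> x) k) \<and>
     (\<forall>y k. 1 \<le> y \<longrightarrow> measure M {\<omega> \<in> space M. E 0 y \<omega> = k} = boundary_prob q s \<beta> (\<xi> y) k) \<and>
     (\<forall>d N v e. d \<le> N \<longrightarrow>
        (let past = (\<lambda>\<omega>. (\<forall>x\<in>{1..N}. V x 0 \<omega> = v x 0) \<and> (\<forall>y\<in>{1..N}. E 0 y \<omega> = e 0 y) \<and>
               (\<forall>x\<ge>1. \<forall>y\<ge>1. x + y < d \<longrightarrow> V x y \<omega> = v x y \<and> E x y \<omega> = e x y))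
         in measure M {\<omega> \<in> space M. past \<omega> \<and>
              (\<forall>x\<ge>1. \<forall>y\<ge>1. x + y = d \<longrightarrow> V x y \<omega> = v x y \<and> E x y \<omega> = e x y)}
            = measure M {\<omega> \<in> space M. past \<omega>} *
              (\<Prod>(x, y)\<in>{(x, y). 1 \<le> x \<and> 1 \<le> y \<and> x + y = d}.
                 L_cont q s (\<xi> y) (\<theta> x) (v x (y - 1)) (e (x - 1) y) (v x y) (e x y))))"

text \<open>Moving right along the bottom boundary the height increases by \<open>V x 0\<close>, and moving up it
  increases by \<open>E x y\<close>. By conservation of paths at the vertices, moving right from \<open>(x - 1, y)\<close> to
  \<open>(x, y)\<close> then increases it by \<open>V x y\<close>.\<close>
fun height :: "(nat \<Rightarrow> nat \<Rightarrow> nat) \<Rightarrow> (nat \<Rightarrow> nat \<Rightarrow> nat) \<Rightarrow> nat \<Rightarrow> nat \<Rightarrow> nat" where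
  "height V E 0 0 = 0"
| "height V E (Suc x) 0 = height V E x 0 + V (Suc x) 0"
| "height V E x (Suc y) = height V E x y + E x (Suc y)"

lemma height_right:
  assumes "\<And>x y. 1 \<le> x \<Longrightarrow> 1 \<le> y \<Longrightarrow> V x (y - 1) + E x y = V x y + E (x - 1) y"
  shows "height V E (Suc x) y = height V E x y + V (Suc x) y"
proof (induction y)
  case (Suc y)
  then show ?case using assms[of "Suc x" "Suc y"] by simp
qed simp

text \<open>The library's \<open>indep_var\<close> for random variables with different value types.\<close>
definition indep_rvs ::
  "'w measure \<Rightarrow> 'a measure \<Rightarrow> ('w \<Rightarrow> 'a) \<Rightarrow> 'b measure \<Rightarrow> ('w \<Rightarrow> 'b) \<Rightarrow> bool" where
  "indep_rvs M S X T Y \<longleftrightarrow>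
     X \<in> measurable M S \<and> Y \<in> measurable M T \<and>
     prob_space.indep_set M (sets (vimage_algebra (space M) X S))
       (sets (vimage_algebra (space M) Y T))"

definition q_Poisson_prob :: "real \<Rightarrow> real \<Rightarrow> nat \<Rightarrow> real" where
  "q_Poisson_prob q a k = a ^ k / qpoch q q (int k) * qpoch_inf a q"

end

(*
The number of parts of the field only sees the first step of each forward transition. The
Yang-Baxter equation conserves occupation numbers at every column, so telescoping over the columns
gives j_0 = l(nu) - l(mu) and j'_0 = l(nu) - l(lambda) almost surely; hence l(lambda^(x,y)) is itself a
Markov field, whose transition probability is that of (j_0, j'_0). As explicit functions, the weights
b_rho' b_rho R / (Pi b_rho' b_rho) are q-Poisson at the origin, the boundary distributions of the vertex
model on the two axes, and the weight L in the interior. At degenerate parameters (such as theta = -s or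
alpha = 0) the last identification fails only for incoming configurations of probability zero, which is why
it is made for the product over a whole triangle x + y < d rather than factor by factor.
*)
theory Submission
  imports Defs
begin

text \<open>Explicit weights are needed only where the series degenerates. At the origin and on the
  axes one of the last two arguments of R is 0, and the regularized 4phi3 collapses to one term. In
  the interior nothing is evaluated: u = v = s, P = -\<theta>/s, Q = -\<xi>/s turn the series of R
  into that of L, argument by argument, and only prefactors have to be compared. The obstacle is
  that the specialized weights are iterated limits, and \<open>Lim\<close> says something only once
  convergence is known. Limits are therefore computed from the inside out, on punctured
  neighbourhoods that avoid zeros of denominators. For two sqW specializations the limit of R is
  never evaluated; it is enough that it exists, since it enters both sides in the same way. Incoming
  configurations at which a transition divides by a vanishing b-weight have probability zero because
  the same weight is a factor of the numerator at the site that produced them.\<close>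

section \<open>q-Pochhammer symbols\<close>

lemma qpoch_nat: "qpoch a q (int n) = (\<Prod>i<n. 1 - a * q ^ i)"
proof -
  have "qpoch a q (int n) = (\<Prod>i=Suc 0..n. 1 - a * q ^ (i - 1))"
    by (simp add: qpoch_def)
  then show ?thesis by (simp add: prod.atLeast1_atMost_eq)
qed

lemma qpoch_0 [simp]: "qpoch a q 0 = 1"
  using qpoch_nat[of a q 0] by simp

text \<open>A symbol of negative index is the reciprocal of a polynomial in a, so dividing by it
  means multiplying by that polynomial.\<close>

lemma qpoch_minus_nat:
  "qpoch a q (- int n) = inverse (\<Prod>i<n. 1 - a * q powi (- int (Suc i)))"
proof -
  have "(\<Prod>i\<in>{- int n..-1}. inverse (1 - a * q powi i))
      = (\<Prod>i<n. inverse (1 - a * q powi (- int (Suc i))))"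
    by (rule prod.reindex_bij_witness[of _ "\<lambda>i. - int (Suc i)" "\<lambda>i. nat (- i - 1)"]) auto
  then show ?thesis
    by (cases "n = 0") (auto simp: qpoch_def prod_inversef[unfolded comp_def])
qed

lemma qpoch_add:
  "qpoch a q (int (m + n)) = qpoch a q (int m) * qpoch (a * q ^ m) q (int n)"
  unfolding qpoch_nat by (induction n) (simp_all add: power_add mult_ac)

lemma tendsto_qpoch [tendsto_intros]:
  assumes "(f \<longlongrightarrow> a) F"
  shows "((\<lambda>x. qpoch (f x) q (int n)) \<longlongrightarrow> qpoch a q (int n)) F"
  unfolding qpoch_nat by (intro tendsto_intros assms)

lemma qpoch_pos:
  assumes "0 < q" "q < 1" "a < 1"
  shows "0 < qpoch a q (int n)"
  unfolding qpoch_nat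
proof (rule prod_pos, safe)
  fix i
  have q1: "0 < q ^ i" "q ^ i \<le> 1" using assms by (simp_all add: power_le_one)
  show "0 < 1 - a * q ^ i"
  proof (cases "a \<le> 0")
    case True
    then show ?thesis using q1 by (smt (verit) mult_nonpos_nonneg)
  next
    case False
    then have "a * q ^ i \<le> a" using q1 by (simp add: mult_le_cancel_left1)
    then show ?thesis using assms by simp
  qed
qed

text \<open>The factor \<open>1 - 1\<close> occurs in the product.\<close>
lemma qpoch_eq_0:
  assumes "q \<noteq> 0" "j + k < n"
  shows "qpoch (q ^ j * q powi (1 + int k - int n)) q (int n - int j) = 0"
proof -
  have "int n - int j = int (n - j)" using assms by simp
  moreover have "q ^ j * q powi (1 + int k - int n) * q ^ (n - k - 1 - j) = 1"
  proof -
    have "q ^ j * q powi (1 + int k - int n) * q ^ (n - k - 1 - j)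
        = q powi (int j + (1 + int k - int n) + int (n - k - 1 - j))"
      using assms(1) by (simp add: power_int_add power_int_of_nat)
    also have "int j + (1 + int k - int n) + int (n - k - 1 - j) = 0"
      using assms by simp
    finally show ?thesis by simp
  qed
  moreover have "n - k - 1 - j < n - j" using assms by simp
  ultimately have "\<exists>i\<in>{..<n - j}. 1 - q ^ j * q powi (1 + int k - int n) * q ^ i = 0"
    by (intro bexI[of _ "n - k - 1 - j"]) simp_all
  then show ?thesis
    unfolding \<open>int n - int j = int (n - j)\<close> qpoch_nat by (rule prod_zero[rotated]) simp
qed

section \<open>The infinite q-Pochhammer symbol: convergence, zeros, continuity\<close>

lemma summable_qpoch_inf:
  fixes a q :: real
  assumes "0 < q" "q < 1"
  shows "summable (\<lambda>i. norm ((1 - a * q ^ i) - 1))"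
  using assms by (simp add: abs_mult power_abs summable_mult)

lemma convergent_prod_qpoch_inf:
  assumes "0 < q" "q < (1::real)"
  shows "convergent_prod (\<lambda>i. 1 - a * q ^ i)"
  using summable_qpoch_inf[OF assms]
  by (intro abs_convergent_prod_imp_convergent_prod summable_imp_abs_convergent_prod)

lemma qpoch_inf_0 [simp]: "qpoch_inf 0 q = 1"
  by (simp add: qpoch_inf_def)

lemma qpoch_inf_split:
  assumes "0 < q" "q < 1"
  shows "qpoch_inf a q = qpoch a q (int n) * qpoch_inf (a * q ^ n) q"
  using has_prod_unique[OF has_prod_ignore_initial_segment'[OF convergent_prod_qpoch_inf[OF assms, of a], of n]]
  unfolding qpoch_inf_def qpoch_nat by (simp add: power_add mult.assoc mult.commute[of "q ^ n"])

lemma qpoch_inf_nonzero: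
  assumes "0 < q" "q < 1" "a < 1"
  shows "qpoch_inf a q \<noteq> 0"
  unfolding qpoch_inf_def
proof (rule prodinf_nonzero)
  fix i
  have "0 < qpoch a q (int (Suc i))" by (rule qpoch_pos) fact+
  then show "1 - a * q ^ i \<noteq> 0" unfolding qpoch_nat by auto
qed (use convergent_prod_qpoch_inf assms in auto)

text \<open>Specializations are limits, so the infinite products must be continuous in a. On the
  closed unit ball about a the nth factor differs from 1 by at most
  \<open>(\<bar>a\<bar> + 1) * q ^ n\<close>; hence the partial products converge uniformly there
  and their limit is continuous.\<close>

lemma isCont_qpoch_inf:
  assumes "0 < q" "q < 1"
  shows "isCont (\<lambda>a. qpoch_inf a q) a"
proof -
  define A where "A = cball a 1"
  have lim: "uniformly_convergent_on A (\<lambda>N x. \<Prod>n<N. 1 - x * q ^ n)"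
  proof (rule uniformly_convergent_on_prod')
    show "compact A" by (simp add: A_def)
    show "uniformly_convergent_on A (\<lambda>N x. \<Sum>n<N. norm ((1 - x * q ^ n) - 1))"
    proof (rule Weierstrass_m_test')
      fix n x assume "x \<in> A"
      then have "\<bar>x\<bar> \<le> \<bar>a\<bar> + 1" by (auto simp: A_def dist_real_def)
      then show "norm (norm ((1 - x * q ^ n) - 1)) \<le> (\<bar>a\<bar> + 1) * q ^ n"
        using assms by (simp add: abs_mult power_abs mult_right_mono)
    next
      show "summable (\<lambda>n. (\<bar>a\<bar> + 1) * q ^ n)" using assms by (simp add: summable_mult)
    qed
  qed (auto intro!: continuous_intros)
  then obtain l where l: "uniform_limit A (\<lambda>N x. \<Prod>n<N. 1 - x * q ^ n) l sequentially"
    by (auto simp: uniformly_convergent_on_def)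
  have "continuous_on A l"
    by (rule uniform_limit_theorem[OF _ l]) (auto intro!: continuous_intros always_eventually)
  moreover have "l x = qpoch_inf x q" if "x \<in> A" for x
  proof -
    have "(\<lambda>N. \<Prod>n<N. 1 - x * q ^ n) \<longlonglongrightarrow> l x"
      using l that by (rule tendsto_uniform_limitI)
    \<comment> \<open>\<open>convergent_prod_LIMSEQ\<close> speaks of products up to N inclusive; a
      shift of the index gives the partial products of the uniform limit.\<close>
    moreover have "(\<lambda>N. \<Prod>n\<le>N. 1 - x * q ^ n) \<longlonglongrightarrow> qpoch_inf x q"
      unfolding qpoch_inf_def by (rule convergent_prod_LIMSEQ[OF convergent_prod_qpoch_inf]) fact+
    then have "(\<lambda>N. \<Prod>n<N. 1 - x * q ^ n) \<longlonglongrightarrow> qpoch_inf x q"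
      unfolding lessThan_Suc_atMost[symmetric]
      by (simp only: filterlim_sequentially_Suc[of "\<lambda>N. \<Prod>n<N. 1 - x * q ^ n"])
    ultimately show ?thesis by (rule LIMSEQ_unique)
  qed
  ultimately have "continuous_on A (\<lambda>a. qpoch_inf a q)"
    by (metis (no_types, lifting) continuous_on_cong)
  then show ?thesis
    by (rule continuous_on_interior) (simp add: A_def)
qed

lemma tendsto_qpoch_inf:
  assumes "0 < q" "q < 1" "(f \<longlongrightarrow> a) F"
  shows "((\<lambda>x. qpoch_inf (f x) q) \<longlongrightarrow> qpoch_inf a q) F"
  by (rule isCont_tendsto_compose[OF isCont_qpoch_inf]) fact+

section \<open>Symbols whose argument is a negative power of q\<close>

lemma qpoch_q_pos:
  assumes "0 < q" "q < 1"
  shows "0 < qpoch q q (int n)"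
  using qpoch_pos assms by auto

text \<open>Each factor is turned around, 1 - q^(i-n) = -q^(i-n) (1 - q^(n-i)), and the factors 1 -
  q^(n-i) make up (q;q)_n / (q;q)_(n-k). Leaving the powers of q as a product avoids triangular
  numbers in exponents.\<close>

lemma qpoch_powi_minus:
  assumes "0 < q" "q < 1" "k \<le> n"
  shows "qpoch (q powi (- int n)) q (int k) * (\<Prod>i<k. q ^ (n - i)) * qpoch q q (int (n - k))
       = (-1) ^ k * qpoch q q (int n)"
  using assms(3)
proof (induction k)
  case (Suc k)
  have [simp]: "q \<noteq> 0" using assms by simp
  have e: "(1 - q powi (- int n) * q ^ k) * q ^ (n - k) = - (1 - q * q ^ (n - Suc k))"
  proof -
    have "q powi (- int n) * q ^ k * q ^ (n - k) = q powi (- int n) * q ^ (k + (n - k))"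
      by (simp only: power_add mult.assoc)
    also have "\<dots> = 1" using Suc.prems by (simp add: power_int_minus)
    finally have "q powi (- int n) * q ^ k * q ^ (n - k) = 1" .
    moreover have "q * q ^ (n - Suc k) = q ^ (n - k)"
      using Suc.prems by (metis Suc_diff_Suc Suc_le_lessD power_Suc)
    ultimately show ?thesis by (simp only: left_diff_distrib mult_1_left minus_diff_eq)
  qed
  have f: "qpoch q q (int (n - k)) = qpoch q q (int (n - Suc k)) * (1 - q * q ^ (n - Suc k))"
    using Suc.prems by (simp only: qpoch_nat Suc_diff_Suc[OF Suc_le_lessD, symmetric] prod.lessThan_Suc)
  have "qpoch (q powi (- int n)) q (int (Suc k)) * (\<Prod>i<Suc k. q ^ (n - i)) * qpoch q q (int (n - Suc k))
     = qpoch (q powi (- int n)) q (int k) * (\<Prod>i<k. q ^ (n - i)) * qpoch q q (int (n - Suc k))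
       * ((1 - q powi (- int n) * q ^ k) * q ^ (n - k))"
    unfolding qpoch_nat prod.lessThan_Suc by (simp only: mult_ac)
  also have "\<dots> = - (qpoch (q powi (- int n)) q (int k) * (\<Prod>i<k. q ^ (n - i)) * qpoch q q (int (n - k)))"
    unfolding e f by (simp only: mult_minus_right mult.assoc)
  also have "\<dots> = (-1) ^ Suc k * qpoch q q (int n)"
    by (simp only: Suc.IH[OF Suc_leD[OF Suc.prems]] power_Suc mult_minus1 mult_minus_left)
  finally show ?case .
qed simp

lemma qpoch_powi_minus_mult:
  assumes "0 < q" "q < 1" "k \<le> n"
  shows "q ^ (n * k + k) * qpoch (q powi (- int k)) q (int k) * qpoch (q powi (- int n)) q (int k)
       = qpoch q q (int k) * qpoch q q (int n) / qpoch q q (int (n - k))"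
proof -
  \<comment> \<open>Reversing one of the two products of powers makes exponents with the same index
    add up to n + 1, whence the exponent \<open>n * k + k\<close>.\<close>
  have "(\<Prod>i<k. q ^ (k - i)) = (\<Prod>i<k. q ^ Suc i)"
    by (rule prod.reindex_bij_witness[of _ "\<lambda>i. k - Suc i" "\<lambda>i. k - Suc i"])
       (auto simp del: power_Suc simp: Suc_diff_Suc)
  then have "(\<Prod>i<k. q ^ (k - i)) * (\<Prod>i<k. q ^ (n - i)) = (\<Prod>i<k. q ^ Suc i * q ^ (n - i))"
    by (simp only: prod.distrib)
  also have "\<dots> = (\<Prod>i<k. q ^ Suc n)"
    using assms by (intro prod.cong refl) (simp only: power_add[symmetric] lessThan_iff, simp)
  also have "\<dots> = q ^ (n * k + k)"
    by (simp only: prod_constant card_lessThan power_mult[symmetric] mult_Suc add.commute)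
  finally have "q ^ (n * k + k) * qpoch (q powi (- int k)) q (int k) * qpoch (q powi (- int n)) q (int k)
      * qpoch q q (int (n - k)) =
      (qpoch (q powi (- int k)) q (int k) * (\<Prod>i<k. q ^ (k - i)) * qpoch q q (int (k - k))) *
      (qpoch (q powi (- int n)) q (int k) * (\<Prod>i<k. q ^ (n - i)) * qpoch q q (int (n - k)))"
    by simp
  also have "\<dots> = ((-1) ^ k * qpoch q q (int k)) * ((-1) ^ k * qpoch q q (int n))"
    using assms by (simp only: qpoch_powi_minus order_refl)
  also have "\<dots> = qpoch q q (int k) * qpoch q q (int n)"
    by (simp flip: power_mult_distrib)
  finally show ?thesis
    using qpoch_q_pos[OF assms(1,2), of "n - k"] by (subst nonzero_eq_divide_eq) auto
qed

section \<open>The R-matrix as a function of its parameters\<close>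

text \<open>With j2 = 0 the symbol of q^l q^(1-i) vanishes in every summand but the last, so the
  series collapses to l = i. There the symbol of q/Q/z cancels the one in the prefactor, which is
  why it must be nonzero, and \<open>qpoch_powi_minus_mult\<close> removes the two symbols of
  negative powers of q.\<close>

lemma R_fused_right_0:
  assumes q: "0 < q" "q < 1" and nz: "qpoch (q / Q / z) q (int i) \<noteq> 0"
  shows "R_fused q z P Q (i + j) j i 0
       = qpoch q q (int (i + j)) * qpoch (z * P) q (int i) / (qpoch q q (int i) * qpoch z q (int (i + j)))"
proof -
  define f where "f l = q ^ l * (qpoch (q powi (- int i)) q (int l) / qpoch q q (int l))
        * (qpoch (q powi (- int (i + j))) q (int l) * qpoch (q ^ l * inverse Q) q (int i - int l))
        * (qpoch (z * P) q (int l) * qpoch (q ^ l * q powi (1 + int 0 - int i)) q (int i - int l))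
        * (qpoch (q / Q / z) q (int l)
           * qpoch (q ^ l * (q powi (1 - int (i + j) - int 0) * P)) q (int i - int l))" for l
  have "f l = 0" if "l < i" for l
    using qpoch_eq_0[of q l 0 i] q that by (simp add: f_def)
  then have "(\<Sum>l=0..i. f l) = f i"
    by (simp add: sum.last_plus)
  then have phi: "phi43 i (q powi - int (i + j)) (z * P) (q / Q / z) (inverse Q)
        (q powi (1 + int 0 - int i)) (q powi (1 - int (i + j) - int 0) * P) q q = f i"
    by (simp add: phi43_def f_def)
  have pq: "qpoch q q (int l) \<noteq> 0" for l using qpoch_q_pos[OF q, of l] by simp
  define a b c d e w where "a = qpoch q q (int i)" and "b = qpoch q q (int (i + j))"
    and "c = qpoch q q (int j)" and "d = qpoch (q / Q / z) q (int i)" and "e = qpoch z q (int (i + j))"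
    and "w = qpoch (z * P) q (int i)"
  have nz': "a \<noteq> 0" "c \<noteq> 0" "d \<noteq> 0" using pq nz by (auto simp: a_def c_def d_def)
  have "R_fused q z P Q (i + j) j i 0
      = q ^ ((i + j) * i) * c / (e * a * d) *
        (q ^ i * (qpoch (q powi (- int i)) q (int i) / a) * qpoch (q powi (- int (i + j))) q (int i) * w * d)"
    unfolding R_fused_def phi
    by (simp add: f_def a_def c_def d_def e_def w_def add.commute)
  also have "\<dots> = (q ^ ((i + j) * i + i) * qpoch (q powi (- int i)) q (int i) * qpoch (q powi (- int (i + j))) q (int i))
       * c * w / (e * a * a)"
    using nz' by (simp add: power_add)
  also have "\<dots> = (a * b / c) * c * w / (e * a * a)"
    by (subst qpoch_powi_minus_mult[OF q]) (simp_all add: a_def b_def c_def)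
  also have "\<dots> = b * w / (a * e)"
    using nz' by simp
  finally show ?thesis unfolding a_def b_def e_def w_def .
qed

text \<open>With i2 = 0 the series is 1. The denominator symbol of q/Q/z has index -j, so it moves
  to the numerator as a product of j factors; giving each of them its share of
  \<open>q ^ (j * (j - 1) div 2) * Q ^ j * (- z) ^ j\<close> turns it into 1 - z Q q^l. No P
  remains.\<close>

lemma R_fused_left_0:
  assumes q: "q \<noteq> 0" and z: "z \<noteq> 0" and Q: "Q \<noteq> 0"
  shows "R_fused q z P Q i (i + j) 0 j
       = qpoch q q (int (i + j)) * qpoch (z * Q) q (int j) / (qpoch z q (int (i + j)) * qpoch q q (int j))"
proof -
  have 1: "inverse (qpoch (q / Q / z) q (int i - int (i + j))) = (\<Prod>l<j. 1 - (q / Q / z) * q powi (- int (Suc l)))"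
    using qpoch_minus_nat[of "q / Q / z" q j] by simp
  have 2: "q ^ (j * (j - 1) div 2) = (\<Prod>l<j. q ^ l)"
    by (simp add: power_sum[symmetric] Sum_Ico_nat lessThan_atLeast0)
  have "q ^ (j * (j - 1) div 2) * Q ^ j * (- z) ^ j * inverse (qpoch (q / Q / z) q (int i - int (i + j)))
      = (\<Prod>l<j. q ^ l * Q * (- z) * (1 - (q / Q / z) * q powi (- int (Suc l))))"
    unfolding 1 2 by (simp only: prod.distrib prod_constant card_lessThan)
  also have "\<dots> = (\<Prod>l<j. 1 - z * Q * q ^ l)"
  proof (rule prod.cong)
    fix l
    have "(q / Q / z) * q powi (- int (Suc l)) = 1 / (q ^ l * Q * z)"
      using q by (simp only: power_int_minus power_int_of_nat) (simp add: field_simps)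
    then have "q ^ l * Q * (- z) * (1 - (q / Q / z) * q powi (- int (Suc l)))
        = q ^ l * Q * (- z) * (1 - 1 / (q ^ l * Q * z))" by (simp only:)
    also have "\<dots> = 1 - z * Q * q ^ l"
      using q z Q by (simp add: right_diff_distrib)
    finally show "q ^ l * Q * (- z) * (1 - (q / Q / z) * q powi (- int (Suc l))) = 1 - z * Q * q ^ l" .
  qed simp
  also have "\<dots> = qpoch (z * Q) q (int j)"
    by (simp add: qpoch_nat)
  finally have 3: "q ^ (j * (j - 1) div 2) * Q ^ j * (- z) ^ j * inverse (qpoch (q / Q / z) q (int i - int (i + j)))
     = qpoch (z * Q) q (int j)" .
  have "R_fused q z P Q i (i + j) 0 j =
    (q ^ (j * (j - 1) div 2) * Q ^ j * (- z) ^ j * inverse (qpoch (q / Q / z) q (int i - int (i + j))))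
    * qpoch q q (int (i + j)) / (qpoch z q (int (i + j)) * qpoch q q (int j))"
    by (simp add: R_fused_def phi43_def divide_inverse mult_ac)
  then show ?thesis unfolding 3 by (simp add: mult.commute)
qed

lemma R_fused_eq_0: "i2 + j1 \<noteq> i1 + j2 \<Longrightarrow> R_fused q z P Q i1 j1 i2 j2 = 0"
  by (simp add: R_fused_def)

text \<open>Here the index n - j is the cast of a natural number, the form that
  \<open>tendsto_qpoch\<close> can handle.\<close>

lemma phi43_nat:
  "phi43 n a1 a2 a3 b1 b2 b3 q z =
     (\<Sum>j=0..n. z ^ j * (qpoch (q powi (- int n)) q (int j) / qpoch q q (int j))
        * (qpoch a1 q (int j) * qpoch (q ^ j * b1) q (int (n - j)))
        * (qpoch a2 q (int j) * qpoch (q ^ j * b2) q (int (n - j)))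
        * (qpoch a3 q (int j) * qpoch (q ^ j * b3) q (int (n - j))))"
  unfolding phi43_def by (intro sum.cong refl) (simp add: of_nat_diff)

text \<open>P occurs only in numerators, through z P and q^(1-i1-j2) P, so R is a polynomial in P,
  even where a denominator is 0 and division returns 0.\<close>

lemma isCont_R_fused_P: "isCont (\<lambda>P. R_fused q z P Q i1 j1 i2 j2) P"
proof (cases "i2 + j1 = i1 + j2")
  case True
  define C where "C = q ^ (i1 * i2 + j2 * (j2 - 1) div 2) * Q ^ j2 * (- z) ^ j2 * qpoch q q (int j1)
        / (qpoch z q (int (j1 + i2)) * qpoch q q (int j2) * qpoch q q (int i2)
           * qpoch (q / Q / z) q (int i1 - int j1))"
  have "R_fused q z P Q i1 j1 i2 j2 = C * phi43 i2 (q powi (- int i1)) (z * P) (q / Q / z)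
            (inverse Q) (q powi (1 + int j2 - int i2)) (q powi (1 - int i1 - int j2) * P) q q" for P
    using True by (simp only: R_fused_def C_def simp_thms if_True)
  then show ?thesis
    unfolding isCont_def phi43_nat
    by (simp only:) (intro tendsto_sum tendsto_mult tendsto_qpoch tendsto_const tendsto_ident_at)
qed (simp add: R_fused_eq_0)

section \<open>Existence of the limit of R in the row parameter\<close>

lemma ex_tendsto_const: "\<exists>l. ((\<lambda>x. c :: real) \<longlongrightarrow> l) F"
  by (rule exI, rule tendsto_const)

text \<open>Only the existence of the limit of R will be used, so convergence is carried through
  products and sums without naming the limits.\<close>

lemma ex_tendsto_mult:
  fixes f g :: "'a \<Rightarrow> real"
  assumes "\<exists>l. (f \<longlongrightarrow> l) F" "\<exists>l. (g \<longlongrightarrow> l) F"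
  shows "\<exists>l. ((\<lambda>x. f x * g x) \<longlongrightarrow> l) F"
  using assms by (elim exE) (rule exI, rule tendsto_mult)

lemma ex_tendsto_sum:
  fixes f :: "'b \<Rightarrow> 'a \<Rightarrow> real"
  assumes "\<And>i. i \<in> I \<Longrightarrow> \<exists>l. (f i \<longlongrightarrow> l) F"
  shows "\<exists>l. ((\<lambda>x. \<Sum>i\<in>I. f i x) \<longlongrightarrow> l) F"
proof -
  have "\<forall>i\<in>I. \<exists>l. (f i \<longlongrightarrow> l) F" using assms by simp
  then obtain l where "\<forall>i\<in>I. (f i \<longlongrightarrow> l i) F" by (auto simp only: bchoice_iff)
  then show ?thesis by (intro exI[of _ "\<Sum>i\<in>I. l i"] tendsto_sum) simp
qed

text \<open>A zero of the symbol forces a x to be one of the finitely many numbers q^(-i), i <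
  d.\<close>

lemma eventually_qpoch_nonzero:
  assumes "\<And>c. eventually (\<lambda>x. a x \<noteq> c) F"
  shows "eventually (\<lambda>x. qpoch (a x) q (int d) \<noteq> 0) F"
proof -
  have "eventually (\<lambda>x. \<forall>i\<in>{..<d}. a x \<noteq> inverse (q ^ i)) F"
    using assms by (subst eventually_ball_finite_distrib) auto
  then show ?thesis
  proof eventually_elim
    case (elim x)
    have "1 - a x * q ^ i \<noteq> 0" if "i < d" for i
    proof
      assume "1 - a x * q ^ i = 0"
      then have "a x * q ^ i = 1" by simp
      then have "a x = inverse (q ^ i)" by (metis inverse_unique mult.commute inverse_inverse_eq)
      with elim that show False by auto
    qed
    then show ?case by (simp add: qpoch_nat)
  qed
qed

text \<open>The zeros of the denominator cancel against \<open>(a; q)\<^sub>j\<close> when \<open>j\<close> is large, and against the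
  vanishing middle factor when \<open>j\<close> is small.\<close>
lemma ex_tendsto_removable:
  assumes q: "0 < q" "q < 1"
    and a: "(a \<longlongrightarrow> a0) F" "\<And>c. eventually (\<lambda>x. a x \<noteq> c) F"
    and j: "j \<le> i2" and eq: "int i1 - int j1 = int i2 - int j2"
  shows "\<exists>l. ((\<lambda>x. qpoch (a x) q (int j) * qpoch (q ^ j * q powi (1 + int j2 - int i2)) q (int i2 - int j)
              / qpoch (a x) q (int i1 - int j1)) \<longlongrightarrow> l) F"
proof -
  define c where "c = qpoch (q ^ j * q powi (1 + int j2 - int i2)) q (int i2 - int j)"
  \<comment> \<open>The index of the denominator is i2 - j2. In the first case the constant c is 0,
    in the second the denominator is an initial segment of (a;q)_j, in the third the index is not
    positive and the reciprocal is a polynomial.\<close>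
  consider (a) "j + j2 < i2" | (b) "i2 \<le> j + j2" "j2 \<le> i2" | (c) "i2 \<le> j2" by linarith
  then have "\<exists>l. ((\<lambda>x. qpoch (a x) q (int j) * c / qpoch (a x) q (int i1 - int j1)) \<longlongrightarrow> l) F"
  proof cases
    case a
    then have "c = 0" using qpoch_eq_0[of q j j2 i2] q by (simp add: c_def)
    then show ?thesis by (simp add: ex_tendsto_const)
  next
    case b
    define d where "d = i2 - j2"
    have d: "int i1 - int j1 = int d" "j = d + (j - d)" using b eq by (auto simp: d_def)
    have ev: "eventually (\<lambda>x. qpoch (a x) q (int d) \<noteq> 0) F"
      by (rule eventually_qpoch_nonzero) (rule a(2))
    have "((\<lambda>x. qpoch (a x * q ^ d) q (int (j - d)) * c) \<longlongrightarrow> qpoch (a0 * q ^ d) q (int (j - d)) * c) F"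
      by (intro tendsto_intros a)
    moreover have "eventually (\<lambda>x. qpoch (a x * q ^ d) q (int (j - d)) * c
        = qpoch (a x) q (int j) * c / qpoch (a x) q (int i1 - int j1)) F"
      using ev
    proof eventually_elim
      case (elim x)
      have "qpoch (a x) q (int j) = qpoch (a x) q (int d) * qpoch (a x * q ^ d) q (int (j - d))"
        using qpoch_add[of "a x" q d "j - d"] by (simp only: d(2)[symmetric])
      with elim show ?case by (simp add: d(1))
    qed
    ultimately show ?thesis by (intro exI) (rule Lim_transform_eventually)
  next
    case c
    define d where "d = j2 - i2"
    have d: "int i1 - int j1 = - int d" using c eq by (auto simp: d_def)
    have "((\<lambda>x. qpoch (a x) q (int j) * c * (\<Prod>l<d. 1 - a x * q powi (- int (Suc l))))
       \<longlongrightarrow> qpoch a0 q (int j) * c * (\<Prod>l<d. 1 - a0 * q powi (- int (Suc l)))) F"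
      by (intro tendsto_intros a)
    then show ?thesis unfolding d qpoch_minus_nat by (intro exI) (simp only: divide_inverse inverse_inverse_eq)
  qed
  then show ?thesis unfolding c_def .
qed

lemma eventually_divide_neq:
  fixes x :: real
  assumes "k \<noteq> 0"
  shows "eventually (\<lambda>y. k / y \<noteq> c) (at x)"
proof -
  have "eventually (\<lambda>y. y \<noteq> 0) (at x)" "eventually (\<lambda>y. y \<noteq> k / c) (at x)"
    using assms by (simp_all add: eventually_neq_at_within)
  then show ?thesis by eventually_elim (use assms in \<open>auto simp: field_simps\<close>)
qed

text \<open>The denominator that can produce a singularity in y is the symbol of q/Q/z with Q =
  -y/s. Distributed over the sum, it gives every summand the shape treated by
  \<open>ex_tendsto_removable\<close>.\<close>

lemma ex_tendsto_R_fused: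
  assumes q: "0 < q" "q < 1" and x: "x \<noteq> 0" and s: "s \<noteq> 0" and z: "z \<noteq> 0"
  shows "\<exists>l. ((\<lambda>y. R_fused q z P (- y / s) i1 j1 i2 j2) \<longlongrightarrow> l) (at x)"
proof (cases "i2 + j1 = i1 + j2")
  case True
  define a where "a y = (- q * s / z) / y" for y
  \<comment> \<open>The companions of the second and third upper arguments are exchanged, so that
    (a;q)_j, the factor that vanishes for small j, and the denominator stand together.\<close>
  define f where "f y j = q ^ j * (qpoch (q powi (- int i2)) q (int j) / qpoch q q (int j))
        * (qpoch (q powi (- int i1)) q (int j) * qpoch (q ^ j * (- s / y)) q (int i2 - int j))
        * (qpoch (z * P) q (int j)
        * qpoch (q ^ j * (q powi (1 - int i1 - int j2) * P)) q (int i2 - int j))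
        * (qpoch (a y) q (int j) * qpoch (q ^ j * q powi (1 + int j2 - int i2)) q (int i2 - int j)
              / qpoch (a y) q (int i1 - int j1))" for y j
  have a_eq: "q / (- y / s) / z = a y" for y by (simp add: a_def field_simps)
  define C where "C = q ^ (i1 * i2 + j2 * (j2 - 1) div 2)"
  define D where "D = qpoch z q (int (j1 + i2)) * qpoch q q (int j2) * qpoch q q (int i2)"
  have R: "R_fused q z P (- y / s) i1 j1 i2 j2
      = C * (- y / s) ^ j2 * (- z) ^ j2 * qpoch q q (int j1) * inverse D * (\<Sum>j=0..i2. f y j)" for y
  proof -
    define g where "g j = q ^ j * (qpoch (q powi (- int i2)) q (int j) / qpoch q q (int j))
        * (qpoch (q powi (- int i1)) q (int j) * qpoch (q ^ j * (- s / y)) q (int i2 - int j))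
        * (qpoch (z * P) q (int j) * qpoch (q ^ j * q powi (1 + int j2 - int i2)) q (int i2 - int j))
        * (qpoch (a y) q (int j) * qpoch (q ^ j * (q powi (1 - int i1 - int j2) * P)) q (int i2 - int j))" for j
    have f: "f y j = g j / qpoch (a y) q (int i1 - int j1)" for j
      unfolding f_def g_def by (simp only: divide_inverse mult_ac)
    have i: "inverse (- y / s) = - s / y" by simp
    have phi: "phi43 i2 (q powi - int i1) (z * P) (q / (- y / s) / z) (inverse (- y / s))
        (q powi (1 + int j2 - int i2)) (q powi (1 - int i1 - int j2) * P) q q = (\<Sum>j=0..i2. g j)"
      unfolding phi43_def a_eq i g_def ..
    show ?thesis
      unfolding R_fused_def phi
      unfolding a_eq f sum_divide_distrib[symmetric] using True
      by (simp only: simp_thms if_True C_def D_def divide_inverse inverse_mult_distrib mult_ac)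
  qed
  have "\<exists>l. ((\<lambda>y. f y j) \<longlongrightarrow> l) (at x)" if "j \<in> {0..i2}" for j
    unfolding f_def
  proof (intro ex_tendsto_mult)
    have e: "int i2 - int j = int (i2 - j)" using that by simp
    have "((\<lambda>y. qpoch (q ^ j * (- s / y)) q (int i2 - int j)) \<longlongrightarrow> qpoch (q ^ j * (- s / x)) q (int i2 - int j)) (at x)"
      unfolding e using x by (intro tendsto_intros) auto
    then show "\<exists>l. ((\<lambda>y. qpoch (q ^ j * (- s / y)) q (int i2 - int j)) \<longlongrightarrow> l) (at x)" ..
    have "(a \<longlongrightarrow> a x) (at x)" unfolding a_def using x by (intro tendsto_intros)
    moreover have "eventually (\<lambda>y. a y \<noteq> c) (at x)" for c
      unfolding a_def using q s z x by (intro eventually_divide_neq) auto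
    ultimately show "\<exists>l. ((\<lambda>y. qpoch (a y) q (int j) * qpoch (q ^ j * q powi (1 + int j2 - int i2)) q (int i2 - int j)
              / qpoch (a y) q (int i1 - int j1)) \<longlongrightarrow> l) (at x)"
      using that True by (intro ex_tendsto_removable[OF q]) auto
  qed (rule ex_tendsto_const)+
  then have "\<exists>l. ((\<lambda>y. \<Sum>j=0..i2. f y j) \<longlongrightarrow> l) (at x)"
    by (rule ex_tendsto_sum)
  moreover have "\<exists>l. ((\<lambda>y. C * (- y / s) ^ j2 * (- z) ^ j2 * qpoch q q (int j1) * inverse D) \<longlongrightarrow> l) (at x)"
    by (rule exI[of _ "C * (- x / s) ^ j2 * (- z) ^ j2 * qpoch q q (int j1) * inverse D"])
       (intro tendsto_mult tendsto_power tendsto_divide tendsto_minus tendsto_const tendsto_ident_at s)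
  ultimately show ?thesis unfolding R by (rule ex_tendsto_mult[rotated])
qed (simp add: R_fused_eq_0 ex_tendsto_const)

section \<open>Weights at the specializations\<close>

lemma spec_lim_sqW:
  assumes "((\<lambda>x'. f s (- x' / s)) \<longlongrightarrow> l) (at x)"
  shows "spec_lim s (sqW x) f = l"
  using assms by (simp add: tendsto_Lim)

text \<open>The inner limit is asked for only at a' near a and different from a. This admits a = 0,
  where u = 0 and the displayed formulas divide by u.\<close>

lemma spec_lim_sg:
  assumes "eventually (\<lambda>a'. ((\<lambda>\<epsilon>. f (- \<epsilon> * a') (1 / \<epsilon>)) \<longlongrightarrow> g a') (at_right 0)) (at a)"
    and "(g \<longlongrightarrow> l) (at a)"
  shows "spec_lim s (sg a) f = l"
proof -
  have "eventually (\<lambda>a'. g a' = Lim (at_right 0) (\<lambda>\<epsilon>. f (- \<epsilon> * a') (1 / \<epsilon>))) (at a)"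
    using assms(1) by eventually_elim (simp add: tendsto_Lim)
  then have "((\<lambda>a'. Lim (at_right 0) (\<lambda>\<epsilon>. f (- \<epsilon> * a') (1 / \<epsilon>))) \<longlongrightarrow> l) (at a)"
    using assms(2) by (rule Lim_transform_eventually[rotated])
  then show ?thesis by (simp add: tendsto_Lim)
qed

text \<open>A weight that violates conservation is 0 for all parameters, hence 0 in the limit: this
  is how the conservation laws reach the specialized weights.\<close>

lemma spec_lim_0 [simp]: "spec_lim s \<rho> (\<lambda>u Q. 0) = 0"
  by (cases \<rho>) (simp_all add: tendsto_Lim[OF _ tendsto_const])

lemma w_spec_eq_0: "i1 + j1 \<noteq> i2 + j2 \<Longrightarrow> w_spec q s \<rho> i1 j1 i2 j2 = 0"
  by (simp add: w_spec_def w_fused_def)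

lemma wstar_spec_eq_0: "i2 + j1 \<noteq> i1 + j2 \<Longrightarrow> wstar_spec q s \<rho> i1 j1 i2 j2 = 0"
  by (simp add: wstar_spec_def wstar_fused_def w_fused_def)

lemma eventually_pos_at_right: "eventually (\<lambda>\<epsilon>. (0 :: real) < \<epsilon>) (at_right 0)"
  by (simp add: eventually_at_right_less)

lemma b_spec_sqW:
  assumes "s \<noteq> 0" "x \<noteq> 0"
  shows "b_spec q s (sqW x) k = x ^ k * (qpoch (- s / x) q (int k) / qpoch q q (int k))"
proof -
  have "((\<lambda>x'. x' ^ k * (qpoch (- s / x') q (int k) * inverse (qpoch q q (int k))))
     \<longlongrightarrow> x ^ k * (qpoch (- s / x) q (int k) * inverse (qpoch q q (int k)))) (at x)"
    by (intro tendsto_intros assms)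
  moreover have "b_fused q s (- x' / s) k = x' ^ k * (qpoch (- s / x') q (int k) * inverse (qpoch q q (int k)))" for x'
  proof -
    have "- s * (- x' / s) = x'" "inverse (- x' / s) = - s / x'" using assms by simp_all
    then show ?thesis by (simp only: b_fused_def divide_inverse[of "qpoch _ _ _"])
  qed
  ultimately show ?thesis
    unfolding b_spec_def divide_inverse[of "qpoch _ _ _"] by (intro spec_lim_sqW) (simp only:)
qed

lemma qpoch_at_0 [simp]: "qpoch 0 q (int n) = 1"
  by (simp add: qpoch_nat)

lemma tendsto_qpoch_1:
  assumes "(f \<longlongrightarrow> 0) F"
  shows "((\<lambda>x. qpoch (f x) q (int n)) \<longlongrightarrow> 1) F"
  using tendsto_qpoch[OF assms, of q n] by simp

text \<open>Before the limit -u Q = a' and 1/Q = \<epsilon>, so only (\<epsilon>;q)_k depends on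
  \<epsilon>, and it tends to 1.\<close>

lemma b_spec_sg: "b_spec q s (sg a) k = a ^ k / qpoch q q (int k)"
proof -
  have *: "((\<lambda>\<epsilon>. b_fused q (- \<epsilon> * a') (1 / \<epsilon>) k) \<longlongrightarrow> a' ^ k * inverse (qpoch q q (int k))) (at_right 0)" for a'
  proof (rule Lim_transform_eventually)
    have "((\<lambda>\<epsilon>. a' ^ k * (qpoch \<epsilon> q (int k) * inverse (qpoch q q (int k))))
       \<longlongrightarrow> a' ^ k * (1 * inverse (qpoch q q (int k)))) (at_right 0)"
      by (intro tendsto_mult tendsto_const tendsto_qpoch_1 tendsto_ident_at)
    then show "((\<lambda>\<epsilon>. a' ^ k * (qpoch \<epsilon> q (int k) * inverse (qpoch q q (int k))))
       \<longlongrightarrow> a' ^ k * inverse (qpoch q q (int k))) (at_right 0)" by simp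
    show "\<forall>\<^sub>F \<epsilon> in at_right 0. a' ^ k * (qpoch \<epsilon> q (int k) * inverse (qpoch q q (int k)))
        = b_fused q (- \<epsilon> * a') (1 / \<epsilon>) k"
      using eventually_pos_at_right
      by eventually_elim (simp add: b_fused_def divide_inverse[of "qpoch _ _ _"])
  qed
  have "((\<lambda>a'. a' ^ k * inverse (qpoch q q (int k))) \<longlongrightarrow> a ^ k * inverse (qpoch q q (int k))) (at a)"
    by (intro tendsto_intros)
  then show ?thesis
    unfolding b_spec_def divide_inverse[of "_ ^ _"]
    by (intro spec_lim_sg[OF always_eventually[OF allI]]) (rule *)
qed

lemma spec_lim_R_fused_sqW:
  assumes "s \<noteq> 0"
  shows "spec_lim s (sqW x) (\<lambda>v P. R_fused q (u * v) P Q i1 j1 i2 j2) = R_fused q (u * s) (- x / s) Q i1 j1 i2 j2"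
proof (rule spec_lim_sqW)
  show "((\<lambda>x'. R_fused q (u * s) (- x' / s) Q i1 j1 i2 j2) \<longlongrightarrow> R_fused q (u * s) (- x / s) Q i1 j1 i2 j2) (at x)"
    by (rule isCont_tendsto_compose[OF isCont_R_fused_P]) (intro tendsto_intros assms)
qed

text \<open>Here z = -\<epsilon> a' s and z P = \<epsilon> a' x tend to 0, so that their symbols in
  \<open>R_fused_right_0\<close> tend to 1, while q/Q/z = -q/(s a') is free of \<epsilon>: a' only
  has to avoid the values at which the symbol of the latter vanishes.\<close>

lemma R_spec_sg_sqW:
  assumes q: "0 < q" "q < 1" and s: "s \<noteq> 0"
  shows "R_spec q s (sg a) (sqW x) (i + j) j i 0 = qpoch q q (int (i + j)) / qpoch q q (int i)"
  unfolding R_spec_def spec_lim_R_fused_sqW[OF s]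
proof (rule spec_lim_sg)
  have "eventually (\<lambda>a'. qpoch (- (q / s) / a') q (int i) \<noteq> 0) (at a)"
    using q s by (intro eventually_qpoch_nonzero eventually_divide_neq) simp
  then show "\<forall>\<^sub>F a' in at a. ((\<lambda>\<epsilon>. R_fused q (- \<epsilon> * a' * s) (- x / s) (1 / \<epsilon>) (i + j) j i 0)
     \<longlongrightarrow> qpoch q q (int (i + j)) / qpoch q q (int i)) (at_right 0)"
  proof eventually_elim
    case (elim a')
    show ?case
    proof (rule Lim_transform_eventually)
      show "((\<lambda>\<epsilon>. qpoch q q (int (i + j)) * qpoch (- \<epsilon> * a' * s * (- x / s)) q (int i)
              / (qpoch q q (int i) * qpoch (- \<epsilon> * a' * s) q (int (i + j))))
           \<longlongrightarrow> qpoch q q (int (i + j)) / qpoch q q (int i)) (at_right 0)"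
      proof -
        have "((\<lambda>\<epsilon>. - \<epsilon> * a' * s * (- x / s)) \<longlongrightarrow> - 0 * a' * s * (- x / s)) (at_right 0)"
          and "((\<lambda>\<epsilon>. - \<epsilon> * a' * s) \<longlongrightarrow> - 0 * a' * s) (at_right 0)"
          by (intro tendsto_mult tendsto_minus tendsto_const tendsto_ident_at)+
        then have "((\<lambda>\<epsilon>. qpoch q q (int (i + j)) * qpoch (- \<epsilon> * a' * s * (- x / s)) q (int i)
              / (qpoch q q (int i) * qpoch (- \<epsilon> * a' * s) q (int (i + j))))
           \<longlongrightarrow> qpoch q q (int (i + j)) * 1 / (qpoch q q (int i) * 1)) (at_right 0)"
          using qpoch_q_pos[OF q, of i]
          by (intro tendsto_divide tendsto_mult tendsto_const tendsto_qpoch_1) simp_all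
        then show ?thesis by simp
      qed
      show "\<forall>\<^sub>F \<epsilon> in at_right 0. qpoch q q (int (i + j)) * qpoch (- \<epsilon> * a' * s * (- x / s)) q (int i)
              / (qpoch q q (int i) * qpoch (- \<epsilon> * a' * s) q (int (i + j)))
          = R_fused q (- \<epsilon> * a' * s) (- x / s) (1 / \<epsilon>) (i + j) j i 0"
        using eventually_pos_at_right
      proof eventually_elim
        case (elim \<epsilon>)
        have "q / (1 / \<epsilon>) / (- \<epsilon> * a' * s) = - (q / s) / a'"
          using elim by simp
        then show ?case
          by (subst R_fused_right_0[OF q]) (use \<open>qpoch (- (q / s) / a') q (int i) \<noteq> 0\<close> in simp_all)
      qed
    qed
  qed
qed (rule tendsto_const)

text \<open>P = 1/\<epsilon> is unbounded, but the formula of \<open>R_fused_left_0\<close> contains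
  no P, and z = -\<epsilon> u b' tends to 0.\<close>

lemma spec_lim_R_fused_sg:
  assumes q: "0 < q" "q < 1" and u: "u \<noteq> 0" and Q: "Q \<noteq> 0"
  shows "spec_lim s (sg b) (\<lambda>v P. R_fused q (u * v) P Q i (i + j) 0 j)
       = qpoch q q (int (i + j)) / qpoch q q (int j)"
proof (rule spec_lim_sg)
  have "eventually (\<lambda>b'. b' \<noteq> 0) (at b)" by (rule eventually_neq_at_within)
  then show "\<forall>\<^sub>F b' in at b. ((\<lambda>\<epsilon>. R_fused q (u * (- \<epsilon> * b')) (1 / \<epsilon>) Q i (i + j) 0 j)
     \<longlongrightarrow> qpoch q q (int (i + j)) / qpoch q q (int j)) (at_right 0)"
  proof eventually_elim
    case (elim b')
    show ?case
    proof (rule Lim_transform_eventually)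
      show "((\<lambda>\<epsilon>. qpoch q q (int (i + j)) * qpoch (u * (- \<epsilon> * b') * Q) q (int j)
              / (qpoch (u * (- \<epsilon> * b')) q (int (i + j)) * qpoch q q (int j)))
           \<longlongrightarrow> qpoch q q (int (i + j)) / qpoch q q (int j)) (at_right 0)"
      proof -
        have "((\<lambda>\<epsilon>. u * (- \<epsilon> * b') * Q) \<longlongrightarrow> u * (- 0 * b') * Q) (at_right 0)"
          and "((\<lambda>\<epsilon>. u * (- \<epsilon> * b')) \<longlongrightarrow> u * (- 0 * b')) (at_right 0)"
          by (intro tendsto_mult tendsto_minus tendsto_const tendsto_ident_at)+
        then have "((\<lambda>\<epsilon>. qpoch q q (int (i + j)) * qpoch (u * (- \<epsilon> * b') * Q) q (int j)
              / (qpoch (u * (- \<epsilon> * b')) q (int (i + j)) * qpoch q q (int j)))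
           \<longlongrightarrow> qpoch q q (int (i + j)) * 1 / (1 * qpoch q q (int j))) (at_right 0)"
          using qpoch_q_pos[OF q, of j]
          by (intro tendsto_divide tendsto_mult tendsto_const tendsto_qpoch_1) simp_all
        then show ?thesis by simp
      qed
      show "\<forall>\<^sub>F \<epsilon> in at_right 0. qpoch q q (int (i + j)) * qpoch (u * (- \<epsilon> * b') * Q) q (int j)
              / (qpoch (u * (- \<epsilon> * b')) q (int (i + j)) * qpoch q q (int j))
          = R_fused q (u * (- \<epsilon> * b')) (1 / \<epsilon>) Q i (i + j) 0 j"
        using eventually_pos_at_right
        by eventually_elim (subst R_fused_left_0, use q u Q elim in simp_all)
    qed
  qed
qed (rule tendsto_const)

lemma R_spec_sqW_sg:
  assumes q: "0 < q" "q < 1" and s: "s \<noteq> 0" and x: "x \<noteq> 0"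
  shows "R_spec q s (sqW x) (sg b) i (i + j) 0 j = qpoch q q (int (i + j)) / qpoch q q (int j)"
  unfolding R_spec_def
proof (rule spec_lim_sqW, rule Lim_transform_eventually[OF tendsto_const])
  have "eventually (\<lambda>x'. x' \<noteq> 0) (at x)" by (rule eventually_neq_at_within)
  then show "\<forall>\<^sub>F x' in at x. qpoch q q (int (i + j)) / qpoch q q (int j)
     = spec_lim s (sg b) (\<lambda>v P. R_fused q (s * v) P (- x' / s) i (i + j) 0 j)"
    by eventually_elim (subst spec_lim_R_fused_sg, use q s in simp_all)
qed

text \<open>For \<epsilon> > 0 and a' \<noteq> 0 the column limit already has the final value, by
  the case j = 0 of \<open>spec_lim_R_fused_sg\<close>; the row limits are then limits of
  constants.\<close>

lemma R_spec_sg_sg: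
  assumes q: "0 < q" "q < 1"
  shows "R_spec q s (sg a) (sg b) k k 0 0 = qpoch q q (int k)"
  unfolding R_spec_def
proof (rule spec_lim_sg)
  have "eventually (\<lambda>a'. a' \<noteq> 0) (at a)" by (rule eventually_neq_at_within)
  then show "\<forall>\<^sub>F a' in at a. ((\<lambda>\<epsilon>. spec_lim s (sg b)
       (\<lambda>v P. R_fused q (- \<epsilon> * a' * v) P (1 / \<epsilon>) k k 0 0)) \<longlongrightarrow> qpoch q q (int k)) (at_right 0)"
  proof eventually_elim
    case (elim a')
    show ?case
    proof (rule Lim_transform_eventually[OF tendsto_const])
      show "\<forall>\<^sub>F \<epsilon> in at_right 0. qpoch q q (int k)
          = spec_lim s (sg b) (\<lambda>v P. R_fused q (- \<epsilon> * a' * v) P (1 / \<epsilon>) k k 0 0)"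
        using eventually_pos_at_right
      proof eventually_elim
        case (elim \<epsilon>)
        then show ?case
          using spec_lim_R_fused_sg[OF q, of "- \<epsilon> * a'" "1 / \<epsilon>" s b k 0] \<open>a' \<noteq> 0\<close> by simp
      qed
    qed
  qed
qed (rule tendsto_const)

section \<open>The normalizing constant and the initial transition probability\<close>

lemma Pi_fused_special:
  assumes "s \<noteq> 0"
  shows "Pi_fused q (s * s) (- x / s) (- y / s)
       = qpoch_inf (- s * x) q * qpoch_inf (- s * y) q / (qpoch_inf (s\<^sup>2) q * qpoch_inf (x * y) q)"
proof -
  have "s * s * (- x / s) = - s * x" for x using assms by simp
  moreover have "s * s * (- x / s) * (- y / s) = x * y" using assms by simp
  ultimately show ?thesis by (simp only: Pi_fused_def power2_eq_square)
qed

lemma mult_less_1_eventually: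
  fixes x c :: real
  assumes "x * c < 1"
  shows "eventually (\<lambda>y. y * c < 1) (at x)"
proof (rule order_tendstoD)
  show "((\<lambda>y. y * c) \<longlongrightarrow> x * c) (at x)" by (intro tendsto_intros)
qed fact

lemma square_less_1:
  fixes s :: real
  assumes "-1 < s" "s < 0"
  shows "s\<^sup>2 < 1"
proof -
  have "\<bar>s\<bar> < 1" using assms by simp
  then show ?thesis by (simp add: abs_square_less_1)
qed

context
  fixes q s :: real
  assumes q: "0 < q" "q < 1" and s: "-1 < s" "s < 0"
begin

lemma s_nonzero: "s \<noteq> 0"
  using s by simp

lemma spec_lim_Pi_sqW:
  assumes "x * y < 1"
  shows "spec_lim s (sqW x) (\<lambda>v P. Pi_fused q (s * v) P (- y / s)) = Pi_fused q (s * s) (- x / s) (- y / s)"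
proof -
  have "((\<lambda>x. qpoch_inf (- s * x) q * qpoch_inf (- s * y) q / (qpoch_inf (s\<^sup>2) q * qpoch_inf (x * y) q))
      \<longlongrightarrow> qpoch_inf (- s * x) q * qpoch_inf (- s * y) q / (qpoch_inf (s\<^sup>2) q * qpoch_inf (x * y) q)) (at x)"
    using qpoch_inf_nonzero[OF q square_less_1[OF s]] qpoch_inf_nonzero[OF q assms]
    by (intro tendsto_mult tendsto_divide tendsto_const tendsto_qpoch_inf[OF q] tendsto_ident_at) simp_all
  then show ?thesis
    by (intro spec_lim_sqW) (simp only: Pi_fused_special[OF s_nonzero])
qed

lemma tendsto_Pi_fused:
  assumes "x * y < 1"
  shows "((\<lambda>y. Pi_fused q (s * s) (- x / s) (- y / s)) \<longlongrightarrow> Pi_fused q (s * s) (- x / s) (- y / s)) (at y)"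
proof -
  have "((\<lambda>y. qpoch_inf (- s * x) q * qpoch_inf (- s * y) q / (qpoch_inf (s\<^sup>2) q * qpoch_inf (x * y) q))
      \<longlongrightarrow> qpoch_inf (- s * x) q * qpoch_inf (- s * y) q / (qpoch_inf (s\<^sup>2) q * qpoch_inf (x * y) q)) (at y)"
    using qpoch_inf_nonzero[OF q square_less_1[OF s]] qpoch_inf_nonzero[OF q assms]
    by (intro tendsto_mult tendsto_divide tendsto_const tendsto_qpoch_inf[OF q] tendsto_ident_at) simp_all
  then show ?thesis
    by (simp only: Pi_fused_special[OF s_nonzero])
qed

lemma Pi_spec_sqW_sqW:
  assumes "y * x < 1"
  shows "Pi_spec q s (sqW y) (sqW x) = Pi_fused q (s * s) (- x / s) (- y / s)"
  unfolding Pi_spec_def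
proof (rule spec_lim_sqW, rule Lim_transform_eventually)
  show "((\<lambda>y. Pi_fused q (s * s) (- x / s) (- y / s)) \<longlongrightarrow> Pi_fused q (s * s) (- x / s) (- y / s)) (at y)"
    using assms by (intro tendsto_Pi_fused) (simp add: mult.commute)
  show "\<forall>\<^sub>F y' in at y. Pi_fused q (s * s) (- x / s) (- y' / s)
     = spec_lim s (sqW x) (\<lambda>v P. Pi_fused q (s * v) P (- y' / s))"
    using mult_less_1_eventually[OF assms]
    by eventually_elim (subst spec_lim_Pi_sqW, simp_all add: mult.commute)
qed

lemma tendsto_qpoch_inf_1:
  assumes "(f \<longlongrightarrow> 0) F"
  shows "((\<lambda>x. qpoch_inf (f x) q) \<longlongrightarrow> 1) F"
  using tendsto_qpoch_inf[OF q assms] by simp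

text \<open>Of the four products in Pi those at z and z P tend to 1, because these arguments tend to
  0, while z Q = -s a' and z P Q = a' x are free of \<epsilon>.\<close>

lemma Pi_spec_sg_sqW:
  assumes "a * x < 1"
  shows "Pi_spec q s (sg a) (sqW x) = qpoch_inf (- s * a) q / qpoch_inf (a * x) q"
  unfolding Pi_spec_def
proof (rule spec_lim_sg)
  have s0: "s \<noteq> 0" using s by simp
  show "((\<lambda>a. qpoch_inf (- s * a) q / qpoch_inf (a * x) q)
      \<longlongrightarrow> qpoch_inf (- s * a) q / qpoch_inf (a * x) q) (at a)"
    using qpoch_inf_nonzero[OF q assms]
    by (intro tendsto_mult tendsto_divide tendsto_const tendsto_qpoch_inf[OF q] tendsto_ident_at)
  show "\<forall>\<^sub>F a' in at a. ((\<lambda>\<epsilon>. spec_lim s (sqW x) (\<lambda>v P. Pi_fused q (- \<epsilon> * a' * v) P (1 / \<epsilon>)))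
      \<longlongrightarrow> qpoch_inf (- s * a') q / qpoch_inf (a' * x) q) (at_right 0)"
    using mult_less_1_eventually[OF assms]
  proof eventually_elim
    case (elim a')
    define g where "g \<epsilon> x = qpoch_inf (\<epsilon> * a' * x) q * qpoch_inf (- s * a') q
      / (qpoch_inf (- \<epsilon> * a' * s) q * qpoch_inf (a' * x) q)" for \<epsilon> x
    have l: "((\<lambda>\<epsilon>. - \<epsilon> * a' * s) \<longlongrightarrow> - 0 * a' * s) (at_right 0)"
            "((\<lambda>\<epsilon>. \<epsilon> * a' * x) \<longlongrightarrow> 0 * a' * x) (at_right 0)"
      by (intro tendsto_mult tendsto_minus tendsto_const tendsto_ident_at)+
    have "(( \<lambda>\<epsilon>. g \<epsilon> x) \<longlongrightarrow> 1 * qpoch_inf (- s * a') q / (1 * qpoch_inf (a' * x) q)) (at_right 0)"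
      unfolding g_def using l qpoch_inf_nonzero[OF q elim]
      by (intro tendsto_mult tendsto_divide tendsto_const tendsto_qpoch_inf_1) simp_all
    then have "((\<lambda>\<epsilon>. g \<epsilon> x) \<longlongrightarrow> qpoch_inf (- s * a') q / qpoch_inf (a' * x) q) (at_right 0)"
      by simp
    \<comment> \<open>The column limit at fixed \<epsilon> needs a nonzero denominator product at z,
      which is guaranteed once \<epsilon> is small.\<close>
    moreover have "\<forall>\<^sub>F \<epsilon> in at_right 0. - \<epsilon> * a' * s < 1"
      using l(1) by (rule order_tendstoD) simp
    then have "\<forall>\<^sub>F \<epsilon> in at_right 0. g \<epsilon> x
       = spec_lim s (sqW x) (\<lambda>v P. Pi_fused q (- \<epsilon> * a' * v) P (1 / \<epsilon>))"
      using eventually_pos_at_right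
    proof eventually_elim
      case (elim \<epsilon>)
      have e: "Pi_fused q (- \<epsilon> * a' * s) (- x' / s) (1 / \<epsilon>) = g \<epsilon> x'" for x'
      proof -
        have "- \<epsilon> * a' * s * (- x' / s) = \<epsilon> * a' * x'" "- \<epsilon> * a' * s * (1 / \<epsilon>) = - s * a'"
             "\<epsilon> * a' * x' * (1 / \<epsilon>) = a' * x'"
          using s0 elim by simp_all
        then show ?thesis by (simp only: Pi_fused_def g_def)
      qed
      have "((\<lambda>x'. g \<epsilon> x') \<longlongrightarrow> g \<epsilon> x) (at x)"
        unfolding g_def using qpoch_inf_nonzero[OF q \<open>a' * x < 1\<close>] qpoch_inf_nonzero[OF q elim(1)]
        by (intro tendsto_mult tendsto_divide tendsto_const tendsto_qpoch_inf[OF q] tendsto_ident_at) simp_all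
      then have "spec_lim s (sqW x) (\<lambda>v P. Pi_fused q (- \<epsilon> * a' * v) P (1 / \<epsilon>)) = g \<epsilon> x"
        by (intro spec_lim_sqW) (simp only: e)
      then show ?case by simp
    qed
    ultimately show ?case by (rule Lim_transform_eventually)
  qed
qed

text \<open>Naming c = u Q lets one computation serve both kinds of rows: c = -x' for sqW, and c =
  -a' for sg, where u and Q separately depend on \<epsilon>.\<close>

lemma spec_lim_Pi_sg:
  assumes Q: "u * Q = c" and c: "- c * b < 1"
  shows "spec_lim s (sg b) (\<lambda>v P. Pi_fused q (u * v) P Q) = qpoch_inf (- u * b) q / qpoch_inf (- c * b) q"
proof (rule spec_lim_sg)
  show "((\<lambda>b. qpoch_inf (- u * b) q / qpoch_inf (- c * b) q)
      \<longlongrightarrow> qpoch_inf (- u * b) q / qpoch_inf (- c * b) q) (at b)"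
    using qpoch_inf_nonzero[OF q c]
    by (intro tendsto_mult tendsto_divide tendsto_const tendsto_qpoch_inf[OF q] tendsto_ident_at)
  have "\<forall>\<^sub>F b' in at b. b' * - c < 1"
    by (rule mult_less_1_eventually) (use c in \<open>simp add: mult.commute\<close>)
  then show "\<forall>\<^sub>F b' in at b. ((\<lambda>\<epsilon>. Pi_fused q (u * (- \<epsilon> * b')) (1 / \<epsilon>) Q)
      \<longlongrightarrow> qpoch_inf (- u * b') q / qpoch_inf (- c * b') q) (at_right 0)"
  proof eventually_elim
    case (elim b')
    then have c': "- c * b' < 1" by (simp add: mult.commute)
    have l: "((\<lambda>\<epsilon>. \<epsilon> * (- c * b')) \<longlongrightarrow> 0 * (- c * b')) (at_right 0)"
            "((\<lambda>\<epsilon>. u * (- \<epsilon> * b')) \<longlongrightarrow> u * (- 0 * b')) (at_right 0)"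
      by (intro tendsto_mult tendsto_minus tendsto_const tendsto_ident_at)+
    have "((\<lambda>\<epsilon>. qpoch_inf (- u * b') q * qpoch_inf (\<epsilon> * (- c * b')) q
        / (qpoch_inf (u * (- \<epsilon> * b')) q * qpoch_inf (- c * b') q))
        \<longlongrightarrow> qpoch_inf (- u * b') q * 1 / (1 * qpoch_inf (- c * b') q)) (at_right 0)"
      using l qpoch_inf_nonzero[OF q c']
      by (intro tendsto_mult tendsto_divide tendsto_const tendsto_qpoch_inf_1) simp_all
    then have "((\<lambda>\<epsilon>. qpoch_inf (- u * b') q * qpoch_inf (\<epsilon> * (- c * b')) q
        / (qpoch_inf (u * (- \<epsilon> * b')) q * qpoch_inf (- c * b') q))
        \<longlongrightarrow> qpoch_inf (- u * b') q / qpoch_inf (- c * b') q) (at_right 0)" by simp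
    moreover have "\<forall>\<^sub>F \<epsilon> in at_right 0. qpoch_inf (- u * b') q * qpoch_inf (\<epsilon> * (- c * b')) q
        / (qpoch_inf (u * (- \<epsilon> * b')) q * qpoch_inf (- c * b') q) = Pi_fused q (u * (- \<epsilon> * b')) (1 / \<epsilon>) Q"
      using eventually_pos_at_right
    proof eventually_elim
      case (elim \<epsilon>)
      have "u * (- \<epsilon> * b') * (1 / \<epsilon>) = - u * b'" "u * (- \<epsilon> * b') * Q = \<epsilon> * (- c * b')"
           "- u * b' * Q = - c * b'"
        using elim by (simp_all flip: Q)
      then show ?case by (simp only: Pi_fused_def)
    qed
    ultimately show ?case by (rule Lim_transform_eventually)
  qed
qed

lemma Pi_spec_sqW_sg:
  assumes "b * x < 1"
  shows "Pi_spec q s (sqW x) (sg b) = qpoch_inf (- s * b) q / qpoch_inf (b * x) q"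
  unfolding Pi_spec_def
proof (rule spec_lim_sqW, rule Lim_transform_eventually)
  show "((\<lambda>x. qpoch_inf (- s * b) q / qpoch_inf (b * x) q)
      \<longlongrightarrow> qpoch_inf (- s * b) q / qpoch_inf (b * x) q) (at x)"
    using qpoch_inf_nonzero[OF q assms]
    by (intro tendsto_mult tendsto_divide tendsto_const tendsto_qpoch_inf[OF q] tendsto_ident_at)
  have "\<forall>\<^sub>F x' in at x. x' * b < 1"
    using assms by (intro mult_less_1_eventually) (simp add: mult.commute)
  then show "\<forall>\<^sub>F x' in at x. qpoch_inf (- s * b) q / qpoch_inf (b * x') q
     = spec_lim s (sg b) (\<lambda>v P. Pi_fused q (s * v) P (- x' / s))"
  proof eventually_elim
    case (elim x')
    have "s * (- x' / s) = - x'" using s by simp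
    then show ?case
      using spec_lim_Pi_sg[of s "- x' / s" "- x'" b] elim by (simp add: mult.commute)
  qed
qed

lemma Pi_spec_sg_sg:
  assumes "a * b < 1"
  shows "Pi_spec q s (sg a) (sg b) = 1 / qpoch_inf (a * b) q"
  unfolding Pi_spec_def
proof (rule spec_lim_sg)
  show "((\<lambda>a. 1 / qpoch_inf (a * b) q) \<longlongrightarrow> 1 / qpoch_inf (a * b) q) (at a)"
    using qpoch_inf_nonzero[OF q assms]
    by (intro tendsto_mult tendsto_divide tendsto_const tendsto_qpoch_inf[OF q] tendsto_ident_at)
  show "\<forall>\<^sub>F a' in at a. ((\<lambda>\<epsilon>. spec_lim s (sg b) (\<lambda>v P. Pi_fused q (- \<epsilon> * a' * v) P (1 / \<epsilon>)))
      \<longlongrightarrow> 1 / qpoch_inf (a' * b) q) (at_right 0)"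
    using mult_less_1_eventually[OF assms]
  proof eventually_elim
    case (elim a')
    have "((\<lambda>\<epsilon>. - (- \<epsilon> * a') * b) \<longlongrightarrow> - (- 0 * a') * b) (at_right 0)"
      by (intro tendsto_mult tendsto_minus tendsto_const tendsto_ident_at)
    then have "((\<lambda>\<epsilon>. qpoch_inf (- (- \<epsilon> * a') * b) q / qpoch_inf (a' * b) q)
        \<longlongrightarrow> 1 / qpoch_inf (a' * b) q) (at_right 0)"
      using qpoch_inf_nonzero[OF q elim]
      by (intro tendsto_divide tendsto_const tendsto_qpoch_inf_1) simp_all
    moreover have "\<forall>\<^sub>F \<epsilon> in at_right 0. qpoch_inf (- (- \<epsilon> * a') * b) q / qpoch_inf (a' * b) q
       = spec_lim s (sg b) (\<lambda>v P. Pi_fused q (- \<epsilon> * a' * v) P (1 / \<epsilon>))"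
      using eventually_pos_at_right
    proof eventually_elim
      case (elim \<epsilon>)
      have "- \<epsilon> * a' * (1 / \<epsilon>) = - a'" using elim by simp
      from spec_lim_Pi_sg[OF this] \<open>a' * b < 1\<close> show ?case by simp
    qed
    ultimately show ?case by (rule Lim_transform_eventually)
  qed
qed

section \<open>The initial transition probabilities as explicit functions\<close>

lemma init_prob_sg_sg:
  assumes "a * b < 1"
  shows "init_prob q s (sg a) (sg b) 0 0 k k = q_Poisson_prob q (a * b) k"
  using qpoch_q_pos[OF q, of k]
  by (simp add: init_prob_def b_spec_sg R_spec_sg_sg[OF q] Pi_spec_sg_sg[OF assms] q_Poisson_prob_def
      power_mult_distrib)

text \<open>R contributes (q;q)_(i+k) / (q;q)_i, which cancels the denominators of the two sg
  weights, and their powers leave a^k. For a = 0 < i the incoming weight, by which one divides, is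
  0; \<open>nz\<close> excludes this.\<close>

lemma init_prob_sg_sqW:
  assumes x: "0 < x" and ax: "a * x < 1" and nz: "b_spec q s (sg a) i \<noteq> 0"
  shows "init_prob q s (sg a) (sqW x) 0 i (i + k) k = boundary_prob q s a x k"
proof -
  have *: "s \<noteq> 0" "x \<noteq> 0" using s x by auto
  show ?thesis
    using qpoch_q_pos[OF q, of k] qpoch_q_pos[OF q, of i] qpoch_q_pos[OF q, of "i + k"] nz
    by (auto simp: init_prob_def b_spec_sg b_spec_sqW[OF *] R_spec_sg_sqW[OF q *(1)] Pi_spec_sg_sqW[OF ax]
        boundary_prob_def power_mult_distrib power_add)
qed

lemma init_prob_sqW_sg:
  assumes x: "0 < x" and bx: "b * x < 1" and nz: "b_spec q s (sg b) i \<noteq> 0"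
  shows "init_prob q s (sqW x) (sg b) i 0 k (k + i) = boundary_prob q s b x k"
proof -
  have *: "s \<noteq> 0" "x \<noteq> 0" using s x by auto
  show ?thesis
    using qpoch_q_pos[OF q, of k] qpoch_q_pos[OF q, of i] qpoch_q_pos[OF q, of "k + i"] nz
    by (auto simp: init_prob_def b_spec_sg b_spec_sqW[OF *] R_spec_sqW_sg[OF q *] Pi_spec_sqW_sg[OF bx]
        boundary_prob_def power_mult_distrib power_add)
qed

text \<open>This holds before any limit: at u = v = s the two regularized series have the same
  arguments. Path conservation and a splitting of (s^2;q)_inf match the prefactors.\<close>

lemma L_weight_eq:
  assumes x: "x \<noteq> 0" and y: "y \<noteq> 0"
  shows "L_weight q s y x i1 j1 i2 j2
    = b_spec q s (sqW x) i2 * b_spec q s (sqW y) j2 * R_fused q (s * s) (- x / s) (- y / s) j2 i2 j1 i1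
      / (Pi_fused q (s * s) (- x / s) (- y / s) * b_spec q s (sqW x) i1 * b_spec q s (sqW y) j1)"
proof (cases "i1 + j2 = i2 + j1")
  case True
  define \<Phi> where "\<Phi> = phi43 j1 (q powi (- int j2)) (- s * x) (- q / (s * y))
            (- s / y) (q powi (1 + int i1 - int j1)) (- x * q powi (1 - int j2 - int i1) / s) q q"
  define qe where "qe = q ^ (j1 * j2 + i1 * (i1 - 1) div 2)"
  define D where "D = qpoch (- q / (s * y)) q (int j2 - int i2)"
  define S where "S = qpoch (s\<^sup>2) q (int (i1 + j2))"
  define Si where "Si = qpoch_inf (s\<^sup>2 * q ^ (i1 + j2)) q"
  have args: "s * s * (- x / s) = - s * x" "q / (- y / s) / (s * s) = - q / (s * y)" "inverse (- y / s) = - s / y"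
    "q powi (1 - int j2 - int i1) * (- x / s) = - x * q powi (1 - int j2 - int i1) / s"
    using s by simp_all
  have pow: "q ^ (j2 * j1 + i1 * (i1 - 1) div 2) * (- y / s) ^ i1 * (- (s * s)) ^ i1 = qe * (s ^ i1 * y ^ i1)"
  proof -
    have "(- y / s) ^ i1 * (- (s * s)) ^ i1 = (s * y) ^ i1"
      using s by (simp add: mult.commute flip: power_mult_distrib)
    then show ?thesis by (simp add: qe_def power_mult_distrib mult.commute mult.assoc)
  qed
  have R: "R_fused q (s * s) (- x / s) (- y / s) j2 i2 j1 i1
     = qe * (s ^ i1 * y ^ i1) * qpoch q q (int i2) / (S * qpoch q q (int i1) * qpoch q q (int j1) * D) * \<Phi>"
    unfolding R_fused_def args pow \<Phi>_def[symmetric] D_def[symmetric] S_def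
    using True by (simp add: add.commute power2_eq_square)
  have L: "L_weight q s y x i1 j1 i2 j2 = y ^ i2 * s ^ i1 * (x ^ i2 / x ^ i1) * qe
     * qpoch (- s / x) q (int i2) * qpoch (- s / y) q (int j2)
     / (qpoch (- s / x) q (int i1) * qpoch (- s / y) q (int j1) * qpoch q q (int j2) * D)
     * (Si * qpoch_inf (x * y) q / (qpoch_inf (- s * y) q * qpoch_inf (- s * x) q)) * \<Phi>"
    unfolding L_weight_def \<Phi>_def D_def Si_def qe_def
    using True x by (simp add: power_int_diff)
  \<comment> \<open>S is the denominator symbol (z;q)_(i2+j1) of R, because i2 + j1 = i1 + j2;
    splitting it off (s^2;q)_inf in Pi leaves the infinite product that occurs in L.\<close>
  have P: "Pi_fused q (s * s) (- x / s) (- y / s)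
      = (qpoch_inf (- s * y) q * qpoch_inf (- s * x) q) / ((S * Si) * qpoch_inf (x * y) q)"
    unfolding Pi_fused_special[OF s_nonzero] S_def Si_def
    by (subst qpoch_inf_split[OF q, of "s\<^sup>2" "i1 + j2"]) (simp only: mult.commute)
  have S0: "S \<noteq> 0" using qpoch_pos[OF q square_less_1[OF s], of "i1 + j2"] by (simp add: S_def)
  have y_pow: "y ^ i2 = y ^ j2 * y ^ i1 / y ^ j1"
    using y True by (simp add: field_simps flip: power_add)
  \<comment> \<open>X1, Y1, D, N and other denominators may be 0: with x / 0 = 0 both sides still
    agree, and only the cancelled quantities S, q1, q2, qj1 have to be nonzero.\<close>
  have alg: "(yj2 * yi1 / yj1) * si1 * (xi2 / xi1) * qe * X2 * Y2 / (X1 * Y1 * qj2 * D) * (Si * T / N) * F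
     = (xi2 * (X2 / q2)) * (yj2 * (Y2 / qj2)) * (qe * (si1 * yi1) * q2 / (S * q1 * qj1 * D) * F)
       / (N / ((S * Si) * T) * (xi1 * (X1 / q1)) * (yj1 * (Y1 / qj1)))"
    if "S \<noteq> 0" "q1 \<noteq> 0" "q2 \<noteq> 0" "qj1 \<noteq> 0"
    for yj2 yi1 yj1 si1 xi2 xi1 qe X2 Y2 X1 Y1 qj2 D Si T N F q2 q1 qj1 S :: real
    using that by (simp add: divide_inverse mult_ac) (simp add: divide_simps)
  have q0: "qpoch q q (int n) \<noteq> 0" for n using qpoch_q_pos[OF q, of n] by simp
  show ?thesis
    unfolding L y_pow R P b_spec_sqW[OF s_nonzero x] b_spec_sqW[OF s_nonzero y]
    by (rule alg[OF S0 q0 q0 q0])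
qed (simp add: L_weight_def R_fused_def)

text \<open>Both sides are iterated limits. In x they are evaluations, R being a polynomial in x; in
  y only the existence of a limit r of R is known. As r enters both sides through the same
  expression, no formula for it is required.\<close>

lemma init_prob_sqW_sqW:
  assumes x: "0 < x" "- s * x < 1" and y: "0 < y" "- s * y < 1" and xy: "y * x < 1"
    and nz: "b_spec q s (sqW x) i1 \<noteq> 0" "b_spec q s (sqW y) j1 \<noteq> 0"
  shows "init_prob q s (sqW y) (sqW x) i1 j1 j2 i2 = L_cont q s y x i1 j1 i2 j2"
proof -
  define R where "R x y = R_fused q (s * s) (- x / s) (- y / s) j2 i2 j1 i1" for x y
  define Pi where "Pi x y = Pi_fused q (s * s) (- x / s) (- y / s)" for x y
  define b where "b x k = b_spec q s (sqW x) k" for x k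
  \<comment> \<open>R is a separate argument of \<open>G\<close>: in the limit at y it becomes r,
    which may differ from the formal value \<open>R x y\<close>.\<close>
  define G where "G x y r = b x i2 * b y j2 * r / (Pi x y * b x i1 * b y j1)" for x y r
  have b_tendsto: "((\<lambda>x. b x k) \<longlongrightarrow> b x k) (at x)" if "0 < x" for x k
  proof (rule Lim_transform_eventually)
    have "x \<noteq> 0" using that by simp
    then show "((\<lambda>x. x ^ k * (qpoch (- s / x) q (int k) / qpoch q q (int k))) \<longlongrightarrow> b x k) (at x)"
      unfolding b_def b_spec_sqW[OF s_nonzero \<open>x \<noteq> 0\<close>] using qpoch_q_pos[OF q, of k]
      by (intro tendsto_mult tendsto_divide tendsto_power tendsto_qpoch tendsto_const tendsto_ident_at) simp_all
    show "\<forall>\<^sub>F x in at x. x ^ k * (qpoch (- s / x) q (int k) / qpoch q q (int k)) = b x k"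
      using eventually_neq_at_within[of 0 x UNIV]
      by eventually_elim (simp add: b_def b_spec_sqW[OF s_nonzero])
  qed
  have R_tendsto: "((\<lambda>x. R x y) \<longlongrightarrow> R x y) (at x)" for x y
    unfolding R_def by (rule isCont_tendsto_compose[OF isCont_R_fused_P]) (intro tendsto_intros s_nonzero)
  have Pi_nz: "Pi x y \<noteq> 0" if "- s * y < 1" "y * x < 1" for y
    unfolding Pi_def Pi_fused_special[OF s_nonzero]
    using qpoch_inf_nonzero[OF q x(2)] qpoch_inf_nonzero[OF q that(1)] qpoch_inf_nonzero[OF q that(2)]
      qpoch_inf_nonzero[OF q square_less_1[OF s]] by (simp add: mult.commute)
  have Pi_sym: "Pi x y = Pi y x" for x y
    unfolding Pi_def Pi_fused_special[OF s_nonzero] by (simp add: mult.commute)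
  have xy': "x * y < 1" using xy by (simp add: mult.commute)
  have "\<exists>r. ((\<lambda>y. R x y) \<longlongrightarrow> r) (at y)"
    unfolding R_def using y s_nonzero by (intro ex_tendsto_R_fused[OF q _ s_nonzero]) simp_all
  then obtain r where r: "((\<lambda>y. R x y) \<longlongrightarrow> r) (at y)" ..
  have R_spec: "R_spec q s (sqW y) (sqW x) j2 i2 j1 i1 = r"
    unfolding R_spec_def spec_lim_R_fused_sqW[OF s_nonzero]
    using r by (intro spec_lim_sqW) (simp add: R_def)
  have inner: "((\<lambda>x'. L_weight q s y' x' i1 j1 i2 j2) \<longlongrightarrow> G x y' (R x y')) (at x)"
    if "y' \<noteq> 0" "- s * y' < 1" "y' * x < 1" "b y' j1 \<noteq> 0" for y'
  proof (rule Lim_transform_eventually)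
    \<comment> \<open>\<open>tendsto_Pi_fused\<close> moves the second argument; symmetry of Pi
      gives the first.\<close>
    have "((\<lambda>x. Pi x y') \<longlongrightarrow> Pi x y') (at x)"
      unfolding Pi_sym[of _ y'] unfolding Pi_def using that by (intro tendsto_Pi_fused)
    then show "((\<lambda>x. G x y' (R x y')) \<longlongrightarrow> G x y' (R x y')) (at x)"
      unfolding G_def using nz that Pi_nz[OF that(2,3)] x
      by (intro tendsto_mult tendsto_divide tendsto_const b_tendsto R_tendsto) (simp_all add: b_def)
    show "\<forall>\<^sub>F x' in at x. G x' y' (R x' y') = L_weight q s y' x' i1 j1 i2 j2"
      using eventually_neq_at_within[of 0 x UNIV]
      by eventually_elim (simp add: L_weight_eq that G_def R_def Pi_def b_def)
  qed
  have "((\<lambda>y'. G x y' (R x y')) \<longlongrightarrow> G x y r) (at y)"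
  proof -
    have "((\<lambda>y. Pi x y) \<longlongrightarrow> Pi x y) (at y)"
      unfolding Pi_def using xy' by (rule tendsto_Pi_fused)
    then show ?thesis
      unfolding G_def using nz Pi_nz[OF y(2) xy] y
      by (intro tendsto_mult tendsto_divide tendsto_const b_tendsto r) (simp_all add: b_def)
  qed
  moreover have "\<forall>\<^sub>F y' in at y. G x y' (R x y') = Lim (at x) (\<lambda>x'. L_weight q s y' x' i1 j1 i2 j2)"
  proof -
    have "\<forall>\<^sub>F y' in at y. y' * - s < 1"
      using y by (intro mult_less_1_eventually) (simp add: mult.commute)
    moreover have "\<forall>\<^sub>F y' in at y. b y' j1 \<noteq> 0"
      using b_tendsto[OF y(1)] nz(2) by (intro tendsto_imp_eventually_ne) (auto simp: b_def)
    ultimately show ?thesis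
      using eventually_neq_at_within[of 0 y UNIV] mult_less_1_eventually[OF xy]
    proof eventually_elim
      case (elim y')
      then have "((\<lambda>x'. L_weight q s y' x' i1 j1 i2 j2) \<longlongrightarrow> G x y' (R x y')) (at x)"
        by (intro inner) (simp_all add: mult.commute)
      then show ?case by (simp add: tendsto_Lim)
    qed
  qed
  ultimately have "((\<lambda>y'. Lim (at x) (\<lambda>x'. L_weight q s y' x' i1 j1 i2 j2)) \<longlongrightarrow> G x y r) (at y)"
    by (rule Lim_transform_eventually)
  then have "L_cont q s y x i1 j1 i2 j2 = G x y r"
    unfolding L_cont_def by (simp add: tendsto_Lim)
  then show ?thesis
    by (simp add: init_prob_def R_spec Pi_spec_sqW_sqW[OF xy] G_def b_def Pi_def)
qed

end

section \<open>Laws determined by finite triangles\<close>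

text \<open>Events about lengths are to be decomposed over arrays of diagrams, for which there must
  be only countably many diagrams.\<close>

instance multiset :: (countable) countable
proof
  have "inj (\<lambda>M :: 'a multiset. to_nat (SOME xs. mset xs = M))"
  proof (rule injI)
    fix M M' :: "'a multiset"
    assume "to_nat (SOME xs. mset xs = M) = to_nat (SOME xs. mset xs = M')"
    then have "(SOME xs. mset xs = M) = (SOME xs. mset xs = M')" by simp
    moreover have "mset (SOME xs. mset xs = M) = M" for M :: "'a multiset"
      using ex_mset by (rule someI_ex)
    ultimately show "M = M'" by metis
  qed
  then show "\<exists>to_nat :: 'a multiset \<Rightarrow> nat. inj to_nat" by blast
qed

lemma finite_antidiagonal: "finite {(x, y). x + y = (d :: nat)}"
  by (rule finite_subset[of _ "{..d} \<times> {..d}"]) auto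

lemma finite_triangle: "finite {(x, y). x + y < (d :: nat)}"
  by (rule finite_subset[of _ "{..d} \<times> {..d}"]) auto

text \<open>An array that is constant off a finite triangle is recovered from the list of its values
  in the order of \<open>prod_encode\<close>, and there are countably many lists. The fixed value c
  off the triangle gives partial data unique representatives.\<close>

lemma countable_triangle_arrays:
  "countable {f :: nat \<Rightarrow> nat \<Rightarrow> 'a :: countable. \<forall>x y. d \<le> x + y \<longrightarrow> f x y = c}" (is "countable ?C")
proof -
  have "finite (prod_encode ` {(x, y). x + y < d})" using finite_triangle by simp
  then obtain N where N: "\<forall>k\<in>prod_encode ` {(x, y). x + y < d}. k < N"
    using finite_nat_set_iff_bounded by blast
  have "?C \<subseteq> range (\<lambda>xs x y. if x + y < d then xs ! prod_encode (x, y) else c)"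
  proof
    fix f assume f: "f \<in> ?C"
    define xs where "xs = map (\<lambda>k. case_prod f (prod_decode k)) [0..<N]"
    have "f x y = (if x + y < d then xs ! prod_encode (x, y) else c)" for x y
      using f N by (auto simp: xs_def)
    then show "f \<in> range (\<lambda>xs x y. if x + y < d then xs ! prod_encode (x, y) else c)"
      by (intro image_eqI[of _ _ xs] ext) auto
  qed
  then show ?thesis by (rule countable_subset) simp
qed

text \<open>The lumping principle for Markov chains. Here c will be a product of transition weights
  whose sign has not been established; if it is negative, the hypothesis forces every A i to be
  null.\<close>

lemma (in finite_measure) measure_UN_Int_scale:
  assumes I: "countable I" and A: "\<And>i. i \<in> I \<Longrightarrow> A i \<in> sets M" "disjoint_family_on A I"
    and B: "B \<in> sets M" and c: "\<And>i. i \<in> I \<Longrightarrow> measure M (A i \<inter> B) = measure M (A i) * c"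
  shows "measure M ((\<Union>i\<in>I. A i) \<inter> B) = measure M (\<Union>i\<in>I. A i) * c"
proof -
  define c' where "c' = max c 0"
  have zero: "measure M (A i) = 0" if "c < 0" "i \<in> I" for i
    using c[OF that(2)] that(1) measure_nonneg[of M "A i"] measure_nonneg[of M "A i \<inter> B"]
    by (smt (verit) mult_pos_neg)
  have c': "measure M (A i \<inter> B) = measure M (A i) * c'" if "i \<in> I" for i
    using c[OF that] zero[OF _ that] by (cases "c < 0") (auto simp: c'_def max_def)
  have UN: "emeasure M (\<Union>i\<in>I. A i) = (\<integral>\<^sup>+i. emeasure M (A i) \<partial>count_space I)"
    by (rule emeasure_UN_countable) (use I A in auto)
  have "emeasure M ((\<Union>i\<in>I. A i) \<inter> B) = emeasure M (\<Union>i\<in>I. A i \<inter> B)"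
    by (intro arg_cong[of _ _ "emeasure M"]) auto
  also have "\<dots> = (\<integral>\<^sup>+i. emeasure M (A i \<inter> B) \<partial>count_space I)"
    using I A B by (intro emeasure_UN_countable) (auto simp: disjoint_family_on_def)
  also have "\<dots> = (\<integral>\<^sup>+i. emeasure M (A i) * ennreal c' \<partial>count_space I)"
    by (intro nn_integral_cong) (simp add: emeasure_eq_measure c' ennreal_mult c'_def)
  also have "\<dots> = emeasure M (\<Union>i\<in>I. A i) * ennreal c'"
    by (simp add: UN nn_integral_multc)
  finally have eq: "measure M ((\<Union>i\<in>I. A i) \<inter> B) = measure M (\<Union>i\<in>I. A i) * c'"
    using measure_nonneg[of M] unfolding emeasure_eq_measure
    by (subst (asm) ennreal_mult[symmetric]) (simp_all add: c'_def)
  show ?thesis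
  proof (cases "c < 0")
    case True
    then have "emeasure M (\<Union>i\<in>I. A i) = (\<integral>\<^sup>+i. 0 \<partial>count_space I)"
      unfolding UN by (intro nn_integral_cong) (simp add: emeasure_eq_measure zero)
    then have "measure M (\<Union>i\<in>I. A i) = 0" by (simp add: measure_def)
    then show ?thesis using eq by simp
  qed (use eq in \<open>simp add: c'_def max_def\<close>)
qed

text \<open>Finite-dimensional cylinders determine a finite measure on the product space. Finitely
  many sites lie in one triangle, and a cylinder is a countable disjoint union of events that fix
  all values on that triangle.\<close>

lemma distr_eqI_triangles:
  fixes Z :: "nat \<Rightarrow> nat \<Rightarrow> 'a \<Rightarrow> nat" and W :: "nat \<Rightarrow> nat \<Rightarrow> 'b \<Rightarrow> nat"
  assumes M: "prob_space M" and N: "prob_space N"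
    and Z: "\<And>x y. Z x y \<in> measurable M (count_space UNIV)"
    and W: "\<And>x y. W x y \<in> measurable N (count_space UNIV)"
    and eq: "\<And>n \<sigma>. measure M {\<omega> \<in> space M. \<forall>x y. x + y < n \<longrightarrow> Z x y \<omega> = \<sigma> x y}
                = measure N {\<omega> \<in> space N. \<forall>x y. x + y < n \<longrightarrow> W x y \<omega> = \<sigma> x y}"
  shows "distr M (PiM UNIV (\<lambda>_. count_space UNIV)) (\<lambda>\<omega> (x, y). Z x y \<omega>)
       = distr N (PiM UNIV (\<lambda>_. count_space UNIV)) (\<lambda>\<omega> (x, y). W x y \<omega>)"
proof (rule measure_eqI_PiM_infinite)
  interpret M: prob_space M by fact
  interpret N: prob_space N by fact
  note [measurable] = Z W
  have Z'[measurable]: "(\<lambda>\<omega> (x, y). Z x y \<omega>) \<in> measurable M (PiM UNIV (\<lambda>_. count_space UNIV))"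
    by (rule measurable_PiM_single') (auto simp: split_beta)
  have W'[measurable]: "(\<lambda>\<omega> (x, y). W x y \<omega>) \<in> measurable N (PiM UNIV (\<lambda>_. count_space UNIV))"
    by (rule measurable_PiM_single') (auto simp: split_beta)
  show "finite_measure (distr M (PiM UNIV (\<lambda>_. count_space UNIV)) (\<lambda>\<omega> (x, y). Z x y \<omega>))"
    by (intro prob_space.finite_measure M.prob_space_distr Z')
  fix A :: "nat \<times> nat \<Rightarrow> nat set" and J :: "(nat \<times> nat) set"
  assume J: "finite J"
  then have "finite ((\<lambda>(x, y). x + y) ` J)" by simp
  then obtain n where "\<forall>k\<in>(\<lambda>(x, y). x + y) ` J. k < n"
    using finite_nat_set_iff_bounded by blast
  then have n: "x + y < n" if "(x, y) \<in> J" for x y using that by auto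
  \<comment> \<open>Setting f to 0 off the triangle gives each atom exactly one index, so that the
    union is disjoint.\<close>
  define I where "I = {f :: nat \<Rightarrow> nat \<Rightarrow> nat. (\<forall>x y. n \<le> x + y \<longrightarrow> f x y = 0) \<and> (\<forall>(x, y)\<in>J. f x y \<in> A (x, y))}"
  have I: "countable I"
    by (rule countable_subset[OF _ countable_triangle_arrays[of n 0]]) (auto simp: I_def)
  have UN: "{\<omega> \<in> space L. \<forall>(x, y)\<in>J. Y x y \<omega> \<in> A (x, y)}
      = (\<Union>\<sigma>\<in>I. {\<omega> \<in> space L. \<forall>x y. x + y < n \<longrightarrow> Y x y \<omega> = \<sigma> x y})"
    for L :: "'c measure" and Y
  proof safe
    fix \<omega> assume "\<omega> \<in> space L" and \<omega>: "\<forall>(x, y)\<in>J. Y x y \<omega> \<in> A (x, y)"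
    then show "\<omega> \<in> (\<Union>\<sigma>\<in>I. {\<omega> \<in> space L. \<forall>x y. x + y < n \<longrightarrow> Y x y \<omega> = \<sigma> x y})"
      using n by (intro UN_I[of "\<lambda>x y. if x + y < n then Y x y \<omega> else 0"]) (auto simp: I_def)
  next
    fix \<sigma> \<omega> x y assume "\<sigma> \<in> I" "\<forall>x y. x + y < n \<longrightarrow> Y x y \<omega> = \<sigma> x y" "(x, y) \<in> J"
    then show "Y x y \<omega> \<in> A (x, y)" using n by (auto simp: I_def)
  qed
  have disj: "disjoint_family_on (\<lambda>\<sigma>. {\<omega> \<in> space L. \<forall>x y. x + y < n \<longrightarrow> Y x y \<omega> = \<sigma> x y}) I"
    for L :: "'c measure" and Y
    unfolding disjoint_family_on_def
  proof (intro ballI impI equals0I)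
    fix \<sigma> \<tau> \<omega> assume \<sigma>: "\<sigma> \<in> I" "\<tau> \<in> I" "\<sigma> \<noteq> \<tau>"
      "\<omega> \<in> {\<omega> \<in> space L. \<forall>x y. x + y < n \<longrightarrow> Y x y \<omega> = \<sigma> x y} \<inter>
           {\<omega> \<in> space L. \<forall>x y. x + y < n \<longrightarrow> Y x y \<omega> = \<tau> x y}"
    have "\<sigma> x y = \<tau> x y" for x y
      using \<sigma> by (cases "x + y < n") (auto simp: I_def)
    with \<sigma>(3) show False by blast
  qed
  have "emeasure M {\<omega> \<in> space M. \<forall>(x, y)\<in>J. Z x y \<omega> \<in> A (x, y)}
      = (\<integral>\<^sup>+\<sigma>. emeasure M {\<omega> \<in> space M. \<forall>x y. x + y < n \<longrightarrow> Z x y \<omega> = \<sigma> x y} \<partial>count_space I)"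
    unfolding UN using I disj by (intro emeasure_UN_countable) auto
  also have "\<dots> = (\<integral>\<^sup>+\<sigma>. emeasure N {\<omega> \<in> space N. \<forall>x y. x + y < n \<longrightarrow> W x y \<omega> = \<sigma> x y} \<partial>count_space I)"
    by (intro nn_integral_cong) (simp add: M.emeasure_eq_measure N.emeasure_eq_measure eq)
  also have "\<dots> = emeasure N {\<omega> \<in> space N. \<forall>(x, y)\<in>J. W x y \<omega> \<in> A (x, y)}"
    unfolding UN using I disj by (intro emeasure_UN_countable[symmetric]) auto
  finally have *: "emeasure M {\<omega> \<in> space M. \<forall>(x, y)\<in>J. Z x y \<omega> \<in> A (x, y)}
      = emeasure N {\<omega> \<in> space N. \<forall>(x, y)\<in>J. W x y \<omega> \<in> A (x, y)}" .
  have emb: "prod_emb UNIV (\<lambda>_. count_space UNIV) J (Pi\<^sub>E J A) \<in> sets (PiM UNIV (\<lambda>_. count_space UNIV))"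
    using J by (intro sets_PiM_I) auto
  show "emeasure (distr M (PiM UNIV (\<lambda>_. count_space UNIV)) (\<lambda>\<omega> (x, y). Z x y \<omega>))
          (prod_emb UNIV (\<lambda>_. count_space UNIV) J (Pi\<^sub>E J A))
      = emeasure (distr N (PiM UNIV (\<lambda>_. count_space UNIV)) (\<lambda>\<omega> (x, y). W x y \<omega>))
          (prod_emb UNIV (\<lambda>_. count_space UNIV) J (Pi\<^sub>E J A))"
  proof -
    have vimage: "(\<lambda>\<omega> (x, y). Y x y \<omega>) -` prod_emb UNIV (\<lambda>_. count_space UNIV) J (Pi\<^sub>E J A) \<inter> space L
        = {\<omega> \<in> space L. \<forall>(x, y)\<in>J. Y x y \<omega> \<in> A (x, y)}" for L :: "'c measure" and Y
      by (auto simp: prod_emb_def PiE_iff)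
    show ?thesis
      unfolding emeasure_distr[OF Z' emb] emeasure_distr[OF W' emb] vimage by (rule *)
  qed
qed auto

section \<open>Increments of arrays, and conservation of parts in one transition\<close>

definition left_of :: "(nat \<Rightarrow> nat \<Rightarrow> nat) \<Rightarrow> nat \<Rightarrow> nat \<Rightarrow> nat" where
  "left_of \<sigma> x y = (if x = 0 then 0 else \<sigma> (x - 1) y)"

text \<open>As in \<open>left_of\<close>, the value 0 off the quadrant is the length of the empty
  diagrams at coordinate -1.\<close>

definition below :: "(nat \<Rightarrow> nat \<Rightarrow> nat) \<Rightarrow> nat \<Rightarrow> nat \<Rightarrow> nat" where
  "below \<sigma> x y = (if y = 0 then 0 else \<sigma> x (y - 1))"

text \<open>On such arrays truncated subtraction returns the true increments; all others turn out to
  have probability 0.\<close>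

definition increasing_at :: "(nat \<Rightarrow> nat \<Rightarrow> nat) \<Rightarrow> nat \<Rightarrow> nat \<Rightarrow> bool" where
  "increasing_at \<sigma> x y \<longleftrightarrow> left_of \<sigma> x y \<le> \<sigma> x y \<and> below \<sigma> x y \<le> \<sigma> x y"

text \<open>The second marginal of any coupling is the normalized right side of the Yang-Baxter
  equation. A triple reached with positive probability thus has a nonzero right-hand term, hence
  nonzero w and w*, and each of these weights forces its own conservation law.\<close>

lemma step_prob_nonzero:
  assumes bij: "bijectivization q s \<rho> \<rho>' K"
    and nz: "step_prob q s \<rho> \<rho>' K (a, a', m, b, b', l) \<tau> (n, t, t') \<noteq> 0"
  shows "n + t = m + a" "n + t' = l + a'"
proof -
  let ?c = "(a, a', m, b, b', l)"
  have pos: "YB_positive q s \<rho> \<rho>' ?c" using nz by (auto simp: step_prob_def split: if_splits)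
  have "measure (measure_pmf (K ?c)) {\<pi>. snd \<pi> = (n, t, t') \<and> fst \<pi> = \<tau>} \<noteq> 0"
    using nz pos by (auto simp: step_prob_def cond_prob_def)
  moreover have "measure (measure_pmf (K ?c)) {\<pi>. snd \<pi> = (n, t, t') \<and> fst \<pi> = \<tau>}
      \<le> measure (measure_pmf (K ?c)) (snd -` {(n, t, t')})"
    by (intro measure_pmf.finite_measure_mono) auto
  ultimately have "pmf (map_pmf snd (K ?c)) (n, t, t') \<noteq> 0"
    unfolding pmf_map by (smt (verit) measure_nonneg)
  then have "YB_rhs q s \<rho> \<rho>' ?c (n, t, t') \<noteq> 0"
    using bij pos unfolding bijectivization_def by (metis div_0)
  then have "wstar_spec q s \<rho>' n a' l t' \<noteq> 0" "w_spec q s \<rho> m a n t \<noteq> 0" by auto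
  then show "n + t = m + a" "n + t' = l + a'"
    using wstar_spec_eq_0 w_spec_eq_0 by (metis add.commute)+
qed

lemma size_eq_sum_count:
  assumes "set_mset A \<subseteq> {1..N :: nat}"
  shows "size A = (\<Sum>h=1..N. count A h)"
  unfolding size_multiset_overloaded_eq
  using assms by (intro sum.mono_neutral_left) (auto simp: not_in_iff)

text \<open>The sum of the counts over columns 1, ..., N telescopes. That j vanishes eventually
  means that nothing escapes to infinity.\<close>

lemma size_eq_of_conservation:
  assumes A: "0 \<notin># A" and B: "0 \<notin># B"
    and cons: "\<And>h. 1 \<le> h \<Longrightarrow> count A h + j h = count B h + j (h - 1)"
    and ev: "eventually (\<lambda>h. j h = (0 :: nat)) sequentially"
  shows "size A = size B + j 0"
proof -
  have sum: "(\<Sum>h=1..N. count A h) + j N = (\<Sum>h=1..N. count B h) + j 0" for N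
  proof (induction N)
    case (Suc N)
    then show ?case using cons[of "Suc N"] by simp
  qed simp
  obtain N0 where N0: "\<And>h. N0 \<le> h \<Longrightarrow> j h = 0"
    using ev by (auto simp: eventually_sequentially)
  \<comment> \<open>N is at least every part of A and B, and j N = 0.\<close>
  define N where "N = Max (insert N0 (set_mset A \<union> set_mset B))"
  have le: "x \<le> N" if "x \<in> insert N0 (set_mset A \<union> set_mset B)" for x
    unfolding N_def using that by (intro Max_ge) auto
  have "set_mset A \<subseteq> {1..N}" "set_mset B \<subseteq> {1..N}"
    using le A B by (auto simp: Suc_le_eq intro: gr0I)
  then show ?thesis
    using sum[of N] N0[OF le] by (simp add: size_eq_sum_count)
qed

text \<open>Also true for size \<mu> < size \<kappa>, since \<open>nat\<close> and subtraction of
  naturals truncate alike.\<close>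

lemma occ_0:
  assumes "0 \<notin># \<mu>" "0 \<notin># \<kappa>"
  shows "occ \<mu> \<kappa> 0 = size \<mu> - size \<kappa>"
proof -
  define S where "S = set_mset \<mu> \<union> set_mset \<kappa>"
  have "{r \<in> S. 0 < r} = S" using assms by (auto simp: S_def intro: gr0I)
  moreover have "size \<mu> = (\<Sum>r\<in>S. count \<mu> r)" "size \<kappa> = (\<Sum>r\<in>S. count \<kappa> r)"
    unfolding size_multiset_overloaded_eq S_def
    by (intro sum.mono_neutral_left; auto simp: not_in_iff)+
  ultimately show ?thesis
    unfolding occ_def S_def[symmetric] by (simp add: sum_subtractf flip: of_nat_sum)
qed

section \<open>The number of parts in the Yang-Baxter field\<close>

text \<open>\<open>below\<close>, \<open>left_of\<close> and \<open>below (left_of \<sigma>)\<close>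
  are the lengths of \<mu>, \<lambda> and \<kappa> in the forward transition, and \<sigma> x y is
  the length of its output.\<close>

definition field_prob ::
  "real \<Rightarrow> real \<Rightarrow> (nat \<Rightarrow> real) \<Rightarrow> (nat \<Rightarrow> real) \<Rightarrow> real \<Rightarrow> real \<Rightarrow> (nat \<Rightarrow> nat \<Rightarrow> nat) \<Rightarrow> nat \<Rightarrow> nat \<Rightarrow> real" where
  "field_prob q s \<xi> \<theta> \<alpha> \<beta> \<sigma> x y =
     init_prob q s (row_spec \<xi> \<alpha> y) (col_spec \<theta> \<beta> x)
       (below \<sigma> x y - below (left_of \<sigma>) x y) (left_of \<sigma> x y - below (left_of \<sigma>) x y)
       (\<sigma> x y - below \<sigma> x y) (\<sigma> x y - left_of \<sigma> x y)"

text \<open>The auxiliary variables that \<open>YB_field\<close> quantifies existentially are fixed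
  here as parameters.\<close>

locale YB_increments = prob_space M for M :: "'a measure" +
  fixes q s \<alpha> \<beta> :: real and \<xi> \<theta> :: "nat \<Rightarrow> real"
    and K :: "spec \<Rightarrow> spec \<Rightarrow> bdata \<Rightarrow> (triple \<times> triple) pmf"
    and F :: "nat \<Rightarrow> nat \<Rightarrow> 'a \<Rightarrow> diagram"
    and j j' :: "nat \<Rightarrow> nat \<Rightarrow> nat \<Rightarrow> 'a \<Rightarrow> nat"
  assumes bij: "bijectivization q s (row_spec \<xi> \<alpha> y) (col_spec \<theta> \<beta> x)
              (K (row_spec \<xi> \<alpha> y) (col_spec \<theta> \<beta> x))"
    and F_meas [measurable]: "F x y \<in> measurable M (count_space UNIV)"
    and F_pos: "\<omega> \<in> space M \<Longrightarrow> 0 \<notin># F x y \<omega>"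
    and j_meas [measurable]: "j x y h \<in> measurable M (count_space UNIV)"
    and j'_meas [measurable]: "j' x y h \<in> measurable M (count_space UNIV)"
    and j_zero: "AE \<omega> in M. \<forall>x y. \<forall>\<^sub>F h in sequentially. j x y h \<omega> = 0 \<and> j' x y h \<omega> = 0"
    and law: "\<And>d H \<zeta> n a a'.
           measure M {\<omega> \<in> space M. (\<forall>x y. x + y < d \<longrightarrow> F x y \<omega> = \<zeta> x y) \<and>
              (\<forall>x y. x + y = d \<longrightarrow>
                 j x y 0 \<omega> = a x y 0 \<and> j' x y 0 \<omega> = a' x y 0 \<and>
                 (\<forall>h\<in>{1..H}. count (F x y \<omega>) h = n x y h \<and>
                    j x y h \<omega> = a x y h \<and> j' x y h \<omega> = a' x y h))}
           = measure M {\<omega> \<in> space M. \<forall>x y. x + y < d \<longrightarrow> F x y \<omega> = \<zeta> x y} *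
             (\<Prod>(x, y)\<in>{(x, y). x + y = d}.
                forward_prob q s (row_spec \<xi> \<alpha> y) (col_spec \<theta> \<beta> x)
                  (K (row_spec \<xi> \<alpha> y) (col_spec \<theta> \<beta> x))
                  (with_empty_boundary \<zeta> (int x - 1) (int y - 1)) (with_empty_boundary \<zeta> (int x - 1) (int y))
                  (with_empty_boundary \<zeta> (int x) (int y - 1))
                  H (n x y) (a x y) (a' x y))"
begin

text \<open>An outcome that violates conservation at column h has probability 0, because the factor
  of site (x, y) contains a vanishing step. To reach almost every point, the violating outcomes have
  to be countable in number.\<close>

lemma AE_conservation:
  assumes h: "1 \<le> h"
  shows "AE \<omega> in M. count (F x y \<omega>) h + j x y h \<omega>
             = count (with_empty_boundary (\<lambda>x y. F x y \<omega>) (int x) (int y - 1)) h + j x y (h - 1) \<omega> \<and>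
           count (F x y \<omega>) h + j' x y h \<omega>
             = count (with_empty_boundary (\<lambda>x y. F x y \<omega>) (int x - 1) (int y)) h + j' x y (h - 1) \<omega>"
proof -
  define d where "d = x + y"
  \<comment> \<open>An outcome records at each site a diagram and the values of n, j, j' up to
    column h. Storing these as lists instead of functions of the column makes the set
    countable.\<close>
  define C :: "(nat \<Rightarrow> nat \<Rightarrow> diagram \<times> nat list \<times> nat list \<times> nat list) set"
    where "C = {f. \<forall>x y. Suc d \<le> x + y \<longrightarrow> f x y = ({#}, [], [], [])}"
  define \<zeta> where "\<zeta> f x y = fst (f x y)"
    for f :: "nat \<Rightarrow> nat \<Rightarrow> diagram \<times> nat list \<times> nat list \<times> nat list" and x y
  define n where "n f x y h = fst (snd (f x y)) ! h"
    for f :: "nat \<Rightarrow> nat \<Rightarrow> diagram \<times> nat list \<times> nat list \<times> nat list" and x y h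
  define a where "a f x y h = fst (snd (snd (f x y))) ! h"
    for f :: "nat \<Rightarrow> nat \<Rightarrow> diagram \<times> nat list \<times> nat list \<times> nat list" and x y h
  define a' where "a' f x y h = snd (snd (snd (f x y))) ! h"
    for f :: "nat \<Rightarrow> nat \<Rightarrow> diagram \<times> nat list \<times> nat list \<times> nat list" and x y h
  define Ev where "Ev f \<omega> \<longleftrightarrow> (\<forall>x y. x + y < d \<longrightarrow> F x y \<omega> = \<zeta> f x y) \<and>
              (\<forall>x y. x + y = d \<longrightarrow>
                 j x y 0 \<omega> = a f x y 0 \<and> j' x y 0 \<omega> = a' f x y 0 \<and>
                 (\<forall>h'\<in>{1..h}. count (F x y \<omega>) h' = n f x y h' \<and>
                    j x y h' \<omega> = a f x y h' \<and> j' x y h' \<omega> = a' f x y h'))" for f \<omega>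
  define cons where "cons f \<longleftrightarrow>
     n f x y h + a f x y h = count (with_empty_boundary (\<zeta> f) (int x) (int y - 1)) h + a f x y (h - 1) \<and>
     n f x y h + a' f x y h = count (with_empty_boundary (\<zeta> f) (int x - 1) (int y)) h + a' f x y (h - 1)" for f
  have "AE \<omega> in M. Ev f \<omega> \<longrightarrow> cons f" for f
  proof (cases "cons f")
    case False
    have ev: "{\<omega> \<in> space M. Ev f \<omega>} \<in> sets M"
      unfolding Ev_def by measurable
    have "measure M {\<omega> \<in> space M. Ev f \<omega>} = 0"
    proof -
      let ?p = "\<lambda>(x, y). forward_prob q s (row_spec \<xi> \<alpha> y) (col_spec \<theta> \<beta> x)
                  (K (row_spec \<xi> \<alpha> y) (col_spec \<theta> \<beta> x))
                  (with_empty_boundary (\<zeta> f) (int x - 1) (int y - 1)) (with_empty_boundary (\<zeta> f) (int x - 1) (int y))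
                  (with_empty_boundary (\<zeta> f) (int x) (int y - 1)) h (n f x y) (a f x y) (a' f x y)"
      let ?mu = "with_empty_boundary (\<zeta> f) (int x) (int y - 1)"
        and ?lam = "with_empty_boundary (\<zeta> f) (int x - 1) (int y)"
        and ?kap = "with_empty_boundary (\<zeta> f) (int x - 1) (int y - 1)"
      have "?p (x, y) = 0"
      proof (rule ccontr)
        assume "?p (x, y) \<noteq> 0"
        then have "step_prob q s (row_spec \<xi> \<alpha> y) (col_spec \<theta> \<beta> x)
            (K (row_spec \<xi> \<alpha> y) (col_spec \<theta> \<beta> x))
            (a f x y (h - 1), a' f x y (h - 1), count ?mu h, occ ?mu ?kap h, occ ?lam ?kap h, count ?lam h)
            (count ?kap h, occ ?mu ?kap (h - 1), occ ?lam ?kap (h - 1))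
            (n f x y h, a f x y h, a' f x y h) \<noteq> 0"
          using h by (simp add: forward_prob_def)
        from step_prob_nonzero[OF bij this] False show False
          by (simp add: cons_def)
      qed
      then have "(\<Prod>p\<in>{(x, y). x + y = d}. ?p p) = 0"
        by (intro prod_zero finite_antidiagonal bexI[of _ "(x, y)"]) (auto simp: d_def)
      then show ?thesis
        unfolding Ev_def law by simp
    qed
    then have "emeasure M {\<omega> \<in> space M. Ev f \<omega>} = 0" by (simp add: emeasure_eq_measure)
    then show ?thesis
      using ev by (intro AE_I[of _ _ "{\<omega> \<in> space M. Ev f \<omega>}"]) auto
  qed simp
  moreover have "countable C" unfolding C_def by (rule countable_triangle_arrays)
  ultimately have "AE \<omega> in M. \<forall>f\<in>C. Ev f \<omega> \<longrightarrow> cons f"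
    by (simp add: AE_ball_countable)
  then show ?thesis
  proof eventually_elim
    case (elim \<omega>)
    \<comment> \<open>The outcome realized at \<omega>. The bound \<open>Suc h\<close> records
      columns 0, ..., h; column 0 is needed for j and j'.\<close>
    define f where "f x y = (if x + y < Suc d then (F x y \<omega>, map (\<lambda>h. count (F x y \<omega>) h) [0..<Suc h],
      map (\<lambda>h. j x y h \<omega>) [0..<Suc h], map (\<lambda>h. j' x y h \<omega>) [0..<Suc h]) else ({#}, [], [], []))" for x y
    have f: "\<zeta> f x y = F x y \<omega>" "h' \<le> h \<Longrightarrow> n f x y h' = count (F x y \<omega>) h'"
      "h' \<le> h \<Longrightarrow> a f x y h' = j x y h' \<omega>" "h' \<le> h \<Longrightarrow> a' f x y h' = j' x y h' \<omega>"
      if "x + y \<le> d" for x y h'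
      using that by (simp_all add: \<zeta>_def n_def a_def a'_def f_def less_Suc_eq_le del: upt_Suc)
    have "f \<in> C" by (simp add: C_def f_def)
    moreover have "Ev f \<omega>" by (simp add: Ev_def f)
    ultimately have "cons f" using elim by blast
    moreover have "with_empty_boundary (\<zeta> f) (int x) (int y - 1) = with_empty_boundary (\<lambda>x y. F x y \<omega>) (int x) (int y - 1)"
      "with_empty_boundary (\<zeta> f) (int x - 1) (int y) = with_empty_boundary (\<lambda>x y. F x y \<omega>) (int x - 1) (int y)"
      by (auto simp: with_empty_boundary_def f d_def)
    ultimately show ?case
      by (simp add: cons_def f d_def)
  qed
qed

lemma size_boundary:
  "size (with_empty_boundary \<zeta> (int x) (int y - 1)) = below (\<lambda>x y. size (\<zeta> x y)) x y"
  "size (with_empty_boundary \<zeta> (int x - 1) (int y)) = left_of (\<lambda>x y. size (\<zeta> x y)) x y"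
  "size (with_empty_boundary \<zeta> (int x - 1) (int y - 1)) = below (left_of (\<lambda>x y. size (\<zeta> x y))) x y"
  by (auto simp: with_empty_boundary_def below_def left_of_def nat_diff_distrib)

lemma boundary_pos: "\<forall>x y. 0 \<notin># \<zeta> x y \<Longrightarrow> 0 \<notin># with_empty_boundary \<zeta> u v"
  by (simp add: with_empty_boundary_def)

text \<open>For H = 0 the product over columns is empty, and what remains sees the diagrams only
  through their lengths.\<close>

lemma forward_prob_0:
  assumes pos: "\<forall>x y. 0 \<notin># \<zeta> x y" and size: "\<And>x' y'. x' + y' < x + y \<Longrightarrow> size (\<zeta> x' y') = \<sigma> x' y'"
  shows "forward_prob q s \<rho> \<rho>' k
           (with_empty_boundary \<zeta> (int x - 1) (int y - 1)) (with_empty_boundary \<zeta> (int x - 1) (int y))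
           (with_empty_boundary \<zeta> (int x) (int y - 1)) 0 n a a'
     = init_prob q s \<rho> \<rho>' (below \<sigma> x y - below (left_of \<sigma>) x y)
         (left_of \<sigma> x y - below (left_of \<sigma>) x y) (a 0) (a' 0)"
proof -
  have "below (\<lambda>x y. size (\<zeta> x y)) x y = below \<sigma> x y" "left_of (\<lambda>x y. size (\<zeta> x y)) x y = left_of \<sigma> x y"
    "below (left_of (\<lambda>x y. size (\<zeta> x y))) x y = below (left_of \<sigma>) x y"
    using size by (simp_all add: below_def left_of_def)
  then show ?thesis
    unfolding forward_prob_def
    by (simp add: occ_0 boundary_pos[OF pos] size_boundary)
qed

lemma AE_size:
  "AE \<omega> in M. \<forall>x y. size (F x y \<omega>) = below (\<lambda>x y. size (F x y \<omega>)) x y + j x y 0 \<omega> \<and>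
                    size (F x y \<omega>) = left_of (\<lambda>x y. size (F x y \<omega>)) x y + j' x y 0 \<omega>"
proof -
  have "AE \<omega> in M. \<forall>x y h. 1 \<le> h \<longrightarrow> count (F x y \<omega>) h + j x y h \<omega>
             = count (with_empty_boundary (\<lambda>x y. F x y \<omega>) (int x) (int y - 1)) h + j x y (h - 1) \<omega> \<and>
           count (F x y \<omega>) h + j' x y h \<omega>
             = count (with_empty_boundary (\<lambda>x y. F x y \<omega>) (int x - 1) (int y)) h + j' x y (h - 1) \<omega>"
    unfolding AE_all_countable
  proof (intro allI)
    fix x y h
    show "AE \<omega> in M. 1 \<le> h \<longrightarrow> count (F x y \<omega>) h + j x y h \<omega>
             = count (with_empty_boundary (\<lambda>x y. F x y \<omega>) (int x) (int y - 1)) h + j x y (h - 1) \<omega> \<and>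
           count (F x y \<omega>) h + j' x y h \<omega>
             = count (with_empty_boundary (\<lambda>x y. F x y \<omega>) (int x - 1) (int y)) h + j' x y (h - 1) \<omega>"
    proof (cases "1 \<le> h")
      case True
      from AE_conservation[OF this, of x y] show ?thesis by eventually_elim simp
    qed simp
  qed
  with j_zero AE_space show ?thesis
  proof eventually_elim
    case (elim \<omega>)
    have pos: "\<forall>x y. 0 \<notin># F x y \<omega>" using F_pos elim by blast
    show ?case
    proof (intro allI conjI)
      fix x y
      have ev: "\<forall>\<^sub>F h in sequentially. j x y h \<omega> = 0" "\<forall>\<^sub>F h in sequentially. j' x y h \<omega> = 0"
        using elim(1) by (auto simp: eventually_conj_iff)
      show "size (F x y \<omega>) = below (\<lambda>x y. size (F x y \<omega>)) x y + j x y 0 \<omega>"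
        unfolding size_boundary[symmetric]
        using pos boundary_pos[OF pos] elim(3) ev
        by (intro size_eq_of_conservation[where j = "\<lambda>h. j x y h \<omega>"]) auto
      show "size (F x y \<omega>) = left_of (\<lambda>x y. size (F x y \<omega>)) x y + j' x y 0 \<omega>"
        unfolding size_boundary[symmetric]
        using pos boundary_pos[OF pos] elim(3) ev
        by (intro size_eq_of_conservation[where j = "\<lambda>h. j' x y h \<omega>"]) auto
    qed
  qed
qed

text \<open>Given the diagrams below the antidiagonal, the law of the outgoing pairs depends only on
  their lengths, so summing over all arrays of diagrams with prescribed lengths keeps the factor. If
  \<sigma> is not increasing on the antidiagonal, \<open>AE_size\<close> makes the event
  null.\<close>

lemma size_law_Suc:
  "measure M {\<omega> \<in> space M. \<forall>x y. x + y < Suc d \<longrightarrow> size (F x y \<omega>) = \<sigma> x y}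
    = (if \<forall>x y. x + y = d \<longrightarrow> increasing_at \<sigma> x y
       then measure M {\<omega> \<in> space M. \<forall>x y. x + y < d \<longrightarrow> size (F x y \<omega>) = \<sigma> x y}
         * (\<Prod>(x, y)\<in>{(x, y). x + y = d}. field_prob q s \<xi> \<theta> \<alpha> \<beta> \<sigma> x y)
       else 0)"
proof -
  define S where "S \<omega> \<longleftrightarrow> (\<forall>x y. x + y < d \<longrightarrow> size (F x y \<omega>) = \<sigma> x y)" for \<omega>
  define B where "B = {\<omega> \<in> space M. \<forall>x y. x + y = d \<longrightarrow> j x y 0 \<omega> = \<sigma> x y - below \<sigma> x y \<and> j' x y 0 \<omega> = \<sigma> x y - left_of \<sigma> x y}"
  have prev: "below (\<lambda>x y. size (F x y \<omega>)) x y = below \<sigma> x y" "left_of (\<lambda>x y. size (F x y \<omega>)) x y = left_of \<sigma> x y"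
    if "S \<omega>" "x + y = d" for \<omega> x y
    using that by (auto simp: S_def below_def left_of_def)
  have split: "(\<forall>x y. x + y < Suc d \<longrightarrow> size (F x y \<omega>) = \<sigma> x y) \<longleftrightarrow> S \<omega> \<and> (\<forall>x y. x + y = d \<longrightarrow> size (F x y \<omega>) = \<sigma> x y)" for \<omega>
    unfolding S_def less_Suc_eq by blast
  have B: "B \<in> sets M" unfolding B_def by measurable
  show ?thesis
  proof (cases "\<forall>x y. x + y = d \<longrightarrow> increasing_at \<sigma> x y")
    case True
    define I where "I = {\<zeta> :: nat \<Rightarrow> nat \<Rightarrow> diagram. (\<forall>x y. d \<le> x + y \<longrightarrow> \<zeta> x y = {#}) \<and>
      (\<forall>x y. 0 \<notin># \<zeta> x y) \<and> (\<forall>x y. x + y < d \<longrightarrow> size (\<zeta> x y) = \<sigma> x y)}"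
    define A where "A \<zeta> = {\<omega> \<in> space M. \<forall>x y. x + y < d \<longrightarrow> F x y \<omega> = \<zeta> x y}" for \<zeta>
    have A: "A \<zeta> \<in> sets M" for \<zeta> unfolding A_def by measurable
    have I: "countable I"
      by (rule countable_subset[OF _ countable_triangle_arrays[of d "{#}"]]) (auto simp: I_def)
    have UN: "(\<Union>\<zeta>\<in>I. A \<zeta>) = {\<omega> \<in> space M. S \<omega>}"
    proof safe
      fix \<omega> assume "\<omega> \<in> space M" "S \<omega>"
      then show "\<omega> \<in> (\<Union>\<zeta>\<in>I. A \<zeta>)"
        using F_pos by (intro UN_I[of "\<lambda>x y. if x + y < d then F x y \<omega> else {#}"]) (auto simp: I_def A_def S_def)
    qed (auto simp: A_def I_def S_def)
    have disj: "disjoint_family_on A I"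
      unfolding disjoint_family_on_def
    proof (intro ballI impI equals0I)
      fix \<zeta> \<eta> \<omega> assume \<zeta>: "\<zeta> \<in> I" "\<eta> \<in> I" "\<zeta> \<noteq> \<eta>" "\<omega> \<in> A \<zeta> \<inter> A \<eta>"
      have "\<zeta> x y = \<eta> x y" for x y
        using \<zeta> by (cases "x + y < d") (auto simp: I_def A_def)
      with \<zeta>(3) show False by blast
    qed
    have scale: "measure M (A \<zeta> \<inter> B) = measure M (A \<zeta>) * (\<Prod>(x, y)\<in>{(x, y). x + y = d}. field_prob q s \<xi> \<theta> \<alpha> \<beta> \<sigma> x y)"
      if \<zeta>: "\<zeta> \<in> I" for \<zeta>
    proof -
      have pos: "\<forall>x y. 0 \<notin># \<zeta> x y" using \<zeta> by (simp add: I_def)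
      \<comment> \<open>The conditions over \<open>{1..0}\<close> are empty; they bring the event
        into the shape of \<open>law\<close> with H = 0.\<close>
      have eq: "A \<zeta> \<inter> B = {\<omega> \<in> space M. (\<forall>x y. x + y < d \<longrightarrow> F x y \<omega> = \<zeta> x y) \<and>
              (\<forall>x y. x + y = d \<longrightarrow>
                 j x y 0 \<omega> = \<sigma> x y - below \<sigma> x y \<and> j' x y 0 \<omega> = \<sigma> x y - left_of \<sigma> x y \<and>
                 (\<forall>h\<in>{1..0}. count (F x y \<omega>) h = 0 \<and> j x y h \<omega> = \<sigma> x y - below \<sigma> x y \<and> j' x y h \<omega> = \<sigma> x y - left_of \<sigma> x y))}"
        by (auto simp: A_def B_def)
      have "measure M (A \<zeta> \<inter> B) = measure M (A \<zeta>) * (\<Prod>(x, y)\<in>{(x, y). x + y = d}.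
          forward_prob q s (row_spec \<xi> \<alpha> y) (col_spec \<theta> \<beta> x)
                  (K (row_spec \<xi> \<alpha> y) (col_spec \<theta> \<beta> x))
                  (with_empty_boundary \<zeta> (int x - 1) (int y - 1)) (with_empty_boundary \<zeta> (int x - 1) (int y))
                  (with_empty_boundary \<zeta> (int x) (int y - 1))
                  0 (\<lambda>_. 0) (\<lambda>_. \<sigma> x y - below \<sigma> x y) (\<lambda>_. \<sigma> x y - left_of \<sigma> x y))"
        unfolding eq unfolding A_def
        by (rule law[of d \<zeta> "\<lambda>x y _. \<sigma> x y - below \<sigma> x y" "\<lambda>x y _. \<sigma> x y - left_of \<sigma> x y" 0 "\<lambda>_ _ _. 0"])
      also have "\<dots> = measure M (A \<zeta>) * (\<Prod>(x, y)\<in>{(x, y). x + y = d}. field_prob q s \<xi> \<theta> \<alpha> \<beta> \<sigma> x y)"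
        using forward_prob_0[OF pos, where \<sigma> = \<sigma>] \<zeta>
        by (intro arg_cong2[where f = times] prod.cong refl) (auto simp: I_def field_prob_def)
      finally show ?thesis .
    qed
    have "measure M {\<omega> \<in> space M. \<forall>x y. x + y < Suc d \<longrightarrow> size (F x y \<omega>) = \<sigma> x y} = measure M ((\<Union>\<zeta>\<in>I. A \<zeta>) \<inter> B)"
    proof (rule measure_eq_AE)
      show "AE \<omega> in M. \<omega> \<in> {\<omega> \<in> space M. \<forall>x y. x + y < Suc d \<longrightarrow> size (F x y \<omega>) = \<sigma> x y} \<longleftrightarrow> \<omega> \<in> (\<Union>\<zeta>\<in>I. A \<zeta>) \<inter> B"
        using AE_size
      proof eventually_elim
        case (elim \<omega>)
        \<comment> \<open>As \<sigma> is increasing here, the truncated differences are exact, and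
          prescribing the length amounts to prescribing the outgoing pair.\<close>
        have "size (F x y \<omega>) = \<sigma> x y \<longleftrightarrow> j x y 0 \<omega> = \<sigma> x y - below \<sigma> x y \<and> j' x y 0 \<omega> = \<sigma> x y - left_of \<sigma> x y"
          if "S \<omega>" "x + y = d" for x y
        proof -
          have "size (F x y \<omega>) = below \<sigma> x y + j x y 0 \<omega>" "size (F x y \<omega>) = left_of \<sigma> x y + j' x y 0 \<omega>"
            using elim prev[OF that] by metis+
          moreover have "below \<sigma> x y \<le> \<sigma> x y" "left_of \<sigma> x y \<le> \<sigma> x y"
            using True that by (auto simp: increasing_at_def)
          ultimately show ?thesis by linarith
        qed
        then show ?case unfolding split UN B_def by blast
      qed
      show "(\<Union>\<zeta>\<in>I. A \<zeta>) \<inter> B \<in> sets M"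
        using A B by (intro sets.Int sets.countable_UN''[OF I])
    qed measurable
    also have "\<dots> = measure M (\<Union>\<zeta>\<in>I. A \<zeta>) * (\<Prod>(x, y)\<in>{(x, y). x + y = d}. field_prob q s \<xi> \<theta> \<alpha> \<beta> \<sigma> x y)"
      by (rule measure_UN_Int_scale[OF I A disj B scale])
    finally show ?thesis using True by (simp add: UN S_def)
  next
    case False
    have "measure M {\<omega> \<in> space M. \<forall>x y. x + y < Suc d \<longrightarrow> size (F x y \<omega>) = \<sigma> x y} = measure M {}"
    proof (rule measure_eq_AE)
      show "AE \<omega> in M. \<omega> \<in> {\<omega> \<in> space M. \<forall>x y. x + y < Suc d \<longrightarrow> size (F x y \<omega>) = \<sigma> x y} \<longleftrightarrow> \<omega> \<in> {}"
        using AE_size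
      proof eventually_elim
        case (elim \<omega>)
        have "\<not> (S \<omega> \<and> (\<forall>x y. x + y = d \<longrightarrow> size (F x y \<omega>) = \<sigma> x y))"
        proof
          assume *: "S \<omega> \<and> (\<forall>x y. x + y = d \<longrightarrow> size (F x y \<omega>) = \<sigma> x y)"
          have "increasing_at \<sigma> x y" if "x + y = d" for x y
            unfolding increasing_at_def using elim prev[of \<omega> x y] * that by (metis le_add1)
          with False show False by blast
        qed
        then show ?case unfolding split by blast
      qed
    qed measurable
    then show ?thesis unfolding if_not_P[OF False] by simp
  qed
qed

lemma size_law:
  "measure M {\<omega> \<in> space M. \<forall>x y. x + y < d \<longrightarrow> size (F x y \<omega>) = \<sigma> x y}
    = (if \<forall>x y. x + y < d \<longrightarrow> increasing_at \<sigma> x y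
       then \<Prod>(x, y)\<in>{(x, y). x + y < d}. field_prob q s \<xi> \<theta> \<alpha> \<beta> \<sigma> x y else 0)"
proof (induction d)
  case 0
  then show ?case by (simp add: prob_space)
next
  case (Suc d)
  have "{(x, y). x + y < Suc d} = {(x, y). x + y < d} \<union> {(x, y). x + y = d}" by auto
  then have "(\<Prod>(x, y)\<in>{(x, y). x + y < Suc d}. field_prob q s \<xi> \<theta> \<alpha> \<beta> \<sigma> x y)
    = (\<Prod>(x, y)\<in>{(x, y). x + y < d}. field_prob q s \<xi> \<theta> \<alpha> \<beta> \<sigma> x y)
      * (\<Prod>(x, y)\<in>{(x, y). x + y = d}. field_prob q s \<xi> \<theta> \<alpha> \<beta> \<sigma> x y)"
    by (simp add: prod.union_disjoint[OF finite_triangle finite_antidiagonal] disjoint_iff)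
  moreover have "(\<forall>x y. x + y < Suc d \<longrightarrow> increasing_at \<sigma> x y)
     \<longleftrightarrow> (\<forall>x y. x + y < d \<longrightarrow> increasing_at \<sigma> x y) \<and> (\<forall>x y. x + y = d \<longrightarrow> increasing_at \<sigma> x y)"
    unfolding less_Suc_eq by blast
  ultimately show ?case
    unfolding size_law_Suc Suc.IH by auto
qed

end

section \<open>Comparison of the transition probabilities\<close>

lemma L_cont_eq_0: "i1 + j2 \<noteq> i2 + j1 \<Longrightarrow> L_cont q s \<xi> \<theta> i1 j1 i2 j2 = 0"
  by (simp add: L_cont_def L_weight_def tendsto_Lim[OF _ tendsto_const])

text \<open>Reads \<sigma> as a shifted height: its value at the origin is the q-Poisson variable,
  its increments along edges are numbers of paths.\<close>

definition vertex_prob ::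
  "real \<Rightarrow> real \<Rightarrow> (nat \<Rightarrow> real) \<Rightarrow> (nat \<Rightarrow> real) \<Rightarrow> real \<Rightarrow> real \<Rightarrow> (nat \<Rightarrow> nat \<Rightarrow> nat) \<Rightarrow> nat \<Rightarrow> nat \<Rightarrow> real" where
  "vertex_prob q s \<xi> \<theta> \<alpha> \<beta> \<sigma> x y =
     (if x = 0 \<and> y = 0 then q_Poisson_prob q (\<alpha> * \<beta>) (\<sigma> 0 0)
      else if y = 0 then boundary_prob q s \<alpha> (\<theta> x) (\<sigma> x 0 - left_of \<sigma> x 0)
      else if x = 0 then boundary_prob q s \<beta> (\<xi> y) (\<sigma> 0 y - below \<sigma> 0 y)
      else L_cont q s (\<xi> y) (\<theta> x) (below \<sigma> x y - below (left_of \<sigma>) x y) (left_of \<sigma> x y - below (left_of \<sigma>) x y)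
             (\<sigma> x y - left_of \<sigma> x y) (\<sigma> x y - below \<sigma> x y))"

text \<open>The outgoing weights in this numerator are the incoming weights by which the next sites
  divide, so a transition of nonzero probability never makes a later one divide by a vanishing
  b-weight.\<close>

lemma init_prob_nonzero:
  assumes "init_prob q s \<rho> \<rho>' i i' j j' \<noteq> 0"
  shows "b_spec q s \<rho> j \<noteq> 0" "b_spec q s \<rho>' j' \<noteq> 0"
  using assms by (auto simp: init_prob_def)

context
  fixes q s \<alpha> \<beta> :: real and \<xi> \<theta> :: "nat \<Rightarrow> real"
  assumes q: "0 < q" "q < 1" and s: "-1 < s" "s < 0"
    and \<xi>: "\<And>y. 1 \<le> y \<Longrightarrow> - s \<le> \<xi> y" and \<theta>: "\<And>x. 1 \<le> x \<Longrightarrow> - s \<le> \<theta> x"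
    and \<xi>\<theta>: "\<And>x y. 1 \<le> x \<Longrightarrow> 1 \<le> y \<Longrightarrow> \<xi> y * \<theta> x < 1"
    and \<alpha>\<theta>: "\<And>x. 1 \<le> x \<Longrightarrow> \<alpha> * \<theta> x < 1" and \<beta>\<xi>: "\<And>y. 1 \<le> y \<Longrightarrow> \<beta> * \<xi> y < 1"
    and \<alpha>\<beta>: "\<alpha> * \<beta> < 1"
begin

text \<open>Where this fails, the transition probabilities out of the configuration divide by zero.\<close>
definition admissible_at :: "(nat \<Rightarrow> nat \<Rightarrow> nat) \<Rightarrow> nat \<Rightarrow> nat \<Rightarrow> bool" where
  "admissible_at \<sigma> x y \<longleftrightarrow> b_spec q s (row_spec \<xi> \<alpha> y) (\<sigma> x y - below \<sigma> x y) \<noteq> 0 \<and>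
     b_spec q s (col_spec \<theta> \<beta> x) (\<sigma> x y - left_of \<sigma> x y) \<noteq> 0"

text \<open>The incoming numbers at (x, y) are outgoing numbers at (x - 1, y) and (x, y - 1);
  admissibility there supplies the hypotheses \<open>nz\<close> of the explicit formulas.\<close>

lemma field_prob_eq_vertex_prob:
  assumes inc: "\<And>x' y'. x' + y' \<le> x + y \<Longrightarrow> increasing_at \<sigma> x' y'"
    and adm: "\<And>x' y'. x' + y' < x + y \<Longrightarrow> admissible_at \<sigma> x' y'"
  shows "field_prob q s \<xi> \<theta> \<alpha> \<beta> \<sigma> x y = vertex_prob q s \<xi> \<theta> \<alpha> \<beta> \<sigma> x y"
proof -
  consider "x = 0" "y = 0" | x' where "x = Suc x'" "y = 0" | y' where "x = 0" "y = Suc y'"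
    | x' y' where "x = Suc x'" "y = Suc y'"
    by (metis not0_implies_Suc)
  then show ?thesis
  proof cases
    case 1
    then show ?thesis
      using init_prob_sg_sg[OF q s \<alpha>\<beta>]
      by (simp add: field_prob_def vertex_prob_def row_spec_def col_spec_def below_def left_of_def)
  next
    case 2
    have "b_spec q s (sg \<alpha>) (\<sigma> x' 0) \<noteq> 0"
      using adm[of x' 0] 2 by (simp add: admissible_at_def row_spec_def below_def)
    moreover have "0 < \<theta> (Suc x')" using \<theta>[of "Suc x'"] s by simp
    moreover have "\<sigma> x' 0 + (\<sigma> x 0 - \<sigma> x' 0) = \<sigma> x 0"
      using inc[of x 0] 2 by (simp add: increasing_at_def left_of_def)
    ultimately show ?thesis
      using init_prob_sg_sqW[OF q s, of "\<theta> (Suc x')" \<alpha> "\<sigma> x' 0" "\<sigma> x 0 - \<sigma> x' 0"] \<alpha>\<theta>[of "Suc x'"] 2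
      by (simp add: field_prob_def vertex_prob_def row_spec_def col_spec_def below_def left_of_def)
  next
    case 3
    have "b_spec q s (sg \<beta>) (\<sigma> 0 y') \<noteq> 0"
      using adm[of 0 y'] 3 by (simp add: admissible_at_def col_spec_def left_of_def)
    moreover have "0 < \<xi> (Suc y')" using \<xi>[of "Suc y'"] s by simp
    moreover have "\<sigma> 0 y - \<sigma> 0 y' + \<sigma> 0 y' = \<sigma> 0 y"
      using inc[of 0 y] 3 by (simp add: increasing_at_def below_def)
    ultimately show ?thesis
      using init_prob_sqW_sg[OF q s, of "\<xi> (Suc y')" \<beta> "\<sigma> 0 y'" "\<sigma> 0 y - \<sigma> 0 y'"] \<beta>\<xi>[of "Suc y'"] 3
      by (simp add: field_prob_def vertex_prob_def row_spec_def col_spec_def below_def left_of_def)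
  next
    case 4
    have pos: "0 < \<theta> x" "0 < \<xi> y" and xy: "\<xi> y * \<theta> x < 1"
      using \<theta>[of x] \<xi>[of y] \<xi>\<theta>[of x y] s 4 by simp_all
    \<comment> \<open>The lower bounds -s on the parameters, together with \<xi> \<theta> < 1, keep
      the numerator products of Pi from vanishing.\<close>
    have "- s * \<theta> x \<le> \<xi> y * \<theta> x" "- s * \<xi> y \<le> \<theta> x * \<xi> y"
      using pos \<theta>[of x] \<xi>[of y] 4 by (intro mult_right_mono; simp)+
    then have le: "- s * \<theta> x < 1" "- s * \<xi> y < 1"
      using xy by (simp_all add: mult.commute)
    have "b_spec q s (sqW (\<theta> x)) (below \<sigma> x y - below (left_of \<sigma>) x y) \<noteq> 0"
      using adm[of x y'] 4 by (simp add: admissible_at_def col_spec_def left_of_def below_def)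
    moreover have "b_spec q s (sqW (\<xi> y)) (left_of \<sigma> x y - below (left_of \<sigma>) x y) \<noteq> 0"
      using adm[of x' y] 4 by (simp add: admissible_at_def row_spec_def left_of_def below_def)
    ultimately show ?thesis
      using init_prob_sqW_sqW[OF q s pos(1) le(1) pos(2) le(2) xy] 4
      by (simp add: field_prob_def vertex_prob_def row_spec_def col_spec_def)
  qed
qed

lemma admissible_at_if_field_prob_nonzero:
  assumes "field_prob q s \<xi> \<theta> \<alpha> \<beta> \<sigma> x y \<noteq> 0"
  shows "admissible_at \<sigma> x y"
  using init_prob_nonzero assms unfolding field_prob_def admissible_at_def by blast

lemma prod_field_prob_eq_prod_vertex_prob:
  assumes "\<And>x y. x + y < d \<Longrightarrow> increasing_at \<sigma> x y"
  shows "(\<Prod>(x, y)\<in>{(x, y). x + y < d}. field_prob q s \<xi> \<theta> \<alpha> \<beta> \<sigma> x y)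
       = (\<Prod>(x, y)\<in>{(x, y). x + y < d}. vertex_prob q s \<xi> \<theta> \<alpha> \<beta> \<sigma> x y)"
  using assms
proof (induction d)
  case (Suc d)
  have un: "{(x, y). x + y < Suc d} = {(x, y). x + y < d} \<union> {(x, y). x + y = d}" by auto
  have split: "(\<Prod>(x, y)\<in>{(x, y). x + y < Suc d}. f x y)
    = (\<Prod>(x, y)\<in>{(x, y). x + y < d}. f x y) * (\<Prod>(x, y)\<in>{(x, y). x + y = d}. f x y)" for f :: "nat \<Rightarrow> nat \<Rightarrow> real"
    unfolding un by (rule prod.union_disjoint[OF finite_triangle finite_antidiagonal]) auto
  have IH: "(\<Prod>(x, y)\<in>{(x, y). x + y < d}. field_prob q s \<xi> \<theta> \<alpha> \<beta> \<sigma> x y)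
       = (\<Prod>(x, y)\<in>{(x, y). x + y < d}. vertex_prob q s \<xi> \<theta> \<alpha> \<beta> \<sigma> x y)"
    by (rule Suc.IH) (use Suc.prems in simp)
  show ?case
  \<comment> \<open>If the product over earlier sites is 0, so is its counterpart by induction,
    whatever stands on the new antidiagonal. Otherwise every earlier site is admissible, and the new
    factors agree one by one.\<close>
  proof (cases "(\<Prod>(x, y)\<in>{(x, y). x + y < d}. field_prob q s \<xi> \<theta> \<alpha> \<beta> \<sigma> x y) = 0")
    case True
    then show ?thesis unfolding split IH[symmetric] by simp
  next
    case False
    have "admissible_at \<sigma> x y" if "x + y < d" for x y
    proof (rule admissible_at_if_field_prob_nonzero)
      have "\<forall>p\<in>{(x, y). x + y < d}. (case p of (x, y) \<Rightarrow> field_prob q s \<xi> \<theta> \<alpha> \<beta> \<sigma> x y) \<noteq> 0"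
        using False prod_zero_iff[OF finite_triangle] by blast
      then show "field_prob q s \<xi> \<theta> \<alpha> \<beta> \<sigma> x y \<noteq> 0" using that by auto
    qed
    then have "field_prob q s \<xi> \<theta> \<alpha> \<beta> \<sigma> x y = vertex_prob q s \<xi> \<theta> \<alpha> \<beta> \<sigma> x y" if "x + y = d" for x y
      using that Suc.prems by (intro field_prob_eq_vertex_prob) auto
    then show ?thesis
      unfolding split IH by (intro arg_cong2[where f = times] prod.cong refl) auto
  qed
qed simp

end

section \<open>The height function of the vertex model\<close>

locale vertex_process = prob_space N for N :: "'b measure" +
  fixes q s \<alpha> \<beta> :: real and \<xi> \<theta> :: "nat \<Rightarrow> real" and V E :: "nat \<Rightarrow> nat \<Rightarrow> 'b \<Rightarrow> nat"
  assumes V_meas: "1 \<le> x \<Longrightarrow> V x y \<in> measurable N (count_space UNIV)"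
    and E_meas: "1 \<le> y \<Longrightarrow> E x y \<in> measurable N (count_space UNIV)"
    and boundary_indep: "indep_vars (\<lambda>_. count_space UNIV)
       (case_sum (\<lambda>x. V x 0) (\<lambda>y. E 0 y)) ({1..} <+> {1..})"
    and V_law: "1 \<le> x \<Longrightarrow> measure N {\<omega> \<in> space N. V x 0 \<omega> = k} = boundary_prob q s \<alpha> (\<theta> x) k"
    and E_law: "1 \<le> y \<Longrightarrow> measure N {\<omega> \<in> space N. E 0 y \<omega> = k} = boundary_prob q s \<beta> (\<xi> y) k"
    and step: "\<And>d n v e. d \<le> n \<Longrightarrow>
       measure N {\<omega> \<in> space N. ((\<forall>x\<in>{1..n}. V x 0 \<omega> = v x 0) \<and> (\<forall>y\<in>{1..n}. E 0 y \<omega> = e 0 y) \<and>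
               (\<forall>x\<ge>1. \<forall>y\<ge>1. x + y < d \<longrightarrow> V x y \<omega> = v x y \<and> E x y \<omega> = e x y)) \<and>
              (\<forall>x\<ge>1. \<forall>y\<ge>1. x + y = d \<longrightarrow> V x y \<omega> = v x y \<and> E x y \<omega> = e x y)}
            = measure N {\<omega> \<in> space N. (\<forall>x\<in>{1..n}. V x 0 \<omega> = v x 0) \<and> (\<forall>y\<in>{1..n}. E 0 y \<omega> = e 0 y) \<and>
               (\<forall>x\<ge>1. \<forall>y\<ge>1. x + y < d \<longrightarrow> V x y \<omega> = v x y \<and> E x y \<omega> = e x y)} *
              (\<Prod>(x, y)\<in>{(x, y). 1 \<le> x \<and> 1 \<le> y \<and> x + y = d}.
                 L_cont q s (\<xi> y) (\<theta> x) (v x (y - 1)) (e (x - 1) y) (v x y) (e x y))"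
begin

definition past :: "nat \<Rightarrow> nat \<Rightarrow> (nat \<Rightarrow> nat \<Rightarrow> nat) \<Rightarrow> (nat \<Rightarrow> nat \<Rightarrow> nat) \<Rightarrow> 'b \<Rightarrow> bool" where
  "past n d v e \<omega> \<longleftrightarrow> (\<forall>x\<in>{1..n}. V x 0 \<omega> = v x 0) \<and> (\<forall>y\<in>{1..n}. E 0 y \<omega> = e 0 y) \<and>
     (\<forall>x\<ge>1. \<forall>y\<ge>1. x + y < d \<longrightarrow> V x y \<omega> = v x y \<and> E x y \<omega> = e x y)"

lemma past_Suc:
  "past n (Suc d) v e \<omega> \<longleftrightarrow> past n d v e \<omega> \<and> (\<forall>x\<ge>1. \<forall>y\<ge>1. x + y = d \<longrightarrow> V x y \<omega> = v x y \<and> E x y \<omega> = e x y)"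
  unfolding past_def less_Suc_eq by blast

lemma past_step:
  assumes "d \<le> n"
  shows "measure N {\<omega> \<in> space N. past n (Suc d) v e \<omega>} = measure N {\<omega> \<in> space N. past n d v e \<omega>} *
     (\<Prod>(x, y)\<in>{(x, y). 1 \<le> x \<and> 1 \<le> y \<and> x + y = d}.
        L_cont q s (\<xi> y) (\<theta> x) (v x (y - 1)) (e (x - 1) y) (v x y) (e x y))"
  unfolding past_Suc unfolding past_def by (rule step[OF assms])

lemma V_sets: "1 \<le> x \<Longrightarrow> {\<omega> \<in> space N. V x y \<omega> = k} \<in> sets N"
  using measurable_sets[OF V_meas, of x "{k}" y] by (simp add: vimage_def Int_def conj_commute)

lemma E_sets: "1 \<le> y \<Longrightarrow> {\<omega> \<in> space N. E x y \<omega> = k} \<in> sets N"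
  using measurable_sets[OF E_meas, of y "{k}" x] by (simp add: vimage_def Int_def conj_commute)

lemma past_sets: "{\<omega> \<in> space N. past n d v e \<omega>} \<in> sets N"
proof -
  have imp: "{\<omega> \<in> space N. P \<longrightarrow> Q \<omega>} \<in> sets N" if "P \<Longrightarrow> {\<omega> \<in> space N. Q \<omega>} \<in> sets N" for P Q
    using that by (cases P) auto
  show ?thesis
    unfolding past_def Ball_def
    by (intro sets.sets_Collect_conj sets.sets_Collect_countable_All imp V_sets E_sets) auto
qed

lemma finite_quadrant_antidiagonal: "finite {(x, y). 1 \<le> x \<and> 1 \<le> y \<and> x + y = (d :: nat)}"
  by (rule finite_subset[OF _ finite_antidiagonal[of d]]) auto

lemma finite_quadrant_triangle: "finite {(x, y). 1 \<le> x \<and> 1 \<le> y \<and> x + y < (d :: nat)}"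
  by (rule finite_subset[OF _ finite_triangle[of d]]) auto

text \<open>The countability argument of \<open>AE_conservation\<close> again: \<open>L_cont\<close>
  is 0 off conservation, and the possible edge values on a finite triangle form a countable
  set.\<close>

lemma AE_paths_conserved:
  "AE \<omega> in N. \<forall>x y. 1 \<le> x \<longrightarrow> 1 \<le> y \<longrightarrow> V x (y - 1) \<omega> + E x y \<omega> = V x y \<omega> + E (x - 1) y \<omega>"
  unfolding AE_all_countable
proof (intro allI)
  fix x y :: nat
  show "AE \<omega> in N. 1 \<le> x \<longrightarrow> 1 \<le> y \<longrightarrow> V x (y - 1) \<omega> + E x y \<omega> = V x y \<omega> + E (x - 1) y \<omega>"
  proof (cases "1 \<le> x \<and> 1 \<le> y")
    case True
    define d where "d = x + y"
    define C :: "(nat \<Rightarrow> nat \<Rightarrow> nat \<times> nat) set" where "C = {f. \<forall>x y. Suc d \<le> x + y \<longrightarrow> f x y = (0, 0)}"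
    define v where "v f x y = fst (f x y)" for f :: "nat \<Rightarrow> nat \<Rightarrow> nat \<times> nat" and x y
    define e where "e f x y = snd (f x y)" for f :: "nat \<Rightarrow> nat \<Rightarrow> nat \<times> nat" and x y
    define cons where "cons f \<longleftrightarrow> v f x (y - 1) + e f x y = v f x y + e f (x - 1) y" for f
    have "AE \<omega> in N. past d (Suc d) (v f) (e f) \<omega> \<longrightarrow> cons f" for f
    proof (cases "cons f")
      case False
      have "(\<Prod>(x, y)\<in>{(x, y). 1 \<le> x \<and> 1 \<le> y \<and> x + y = d}.
        L_cont q s (\<xi> y) (\<theta> x) (v f x (y - 1)) (e f (x - 1) y) (v f x y) (e f x y)) = 0"
      proof (intro prod_zero finite_quadrant_antidiagonal bexI[of _ "(x, y)"])
        show "(case (x, y) of (x, y) \<Rightarrow> L_cont q s (\<xi> y) (\<theta> x) (v f x (y - 1)) (e f (x - 1) y) (v f x y) (e f x y)) = 0"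
          using False by (auto simp: cons_def intro!: L_cont_eq_0)
      qed (use True in \<open>simp add: d_def\<close>)
      then have "measure N {\<omega> \<in> space N. past d (Suc d) (v f) (e f) \<omega>} = 0"
        by (simp only: past_step[OF order_refl] mult_zero_right)
      then have "emeasure N {\<omega> \<in> space N. past d (Suc d) (v f) (e f) \<omega>} = 0"
        by (simp add: emeasure_eq_measure)
      then show ?thesis
        using past_sets by (intro AE_I[of _ _ "{\<omega> \<in> space N. past d (Suc d) (v f) (e f) \<omega>}"]) auto
    qed simp
    moreover have "countable C" unfolding C_def by (rule countable_triangle_arrays)
    ultimately have "AE \<omega> in N. \<forall>f\<in>C. past d (Suc d) (v f) (e f) \<omega> \<longrightarrow> cons f"
      by (simp add: AE_ball_countable)
    then show ?thesis
    proof eventually_elim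
      case (elim \<omega>)
      define f where "f x y = (if x + y < Suc d then (V x y \<omega>, E x y \<omega>) else (0, 0))" for x y
      have f: "v f x y = V x y \<omega>" "e f x y = E x y \<omega>" if "x + y \<le> d" for x y
        using that by (simp_all add: v_def e_def f_def)
      have "f \<in> C" by (simp add: C_def f_def)
      moreover have "past d (Suc d) (v f) (e f) \<omega>" by (simp add: past_def f)
      ultimately have "cons f" using elim by blast
      then show ?case by (simp add: cons_def f d_def)
    qed
  qed auto
qed

lemma boundary_law:
  "measure N {\<omega> \<in> space N. past n 0 v e \<omega>}
    = (\<Prod>x=1..n. boundary_prob q s \<alpha> (\<theta> x) (v x 0)) * (\<Prod>y=1..n. boundary_prob q s \<beta> (\<xi> y) (e 0 y))"
\<comment> \<open>\<open>indep_varsD\<close> requires a nonempty index set.\<close>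
proof (cases "n = 0")
  case True
  then show ?thesis by (simp add: past_def prob_space)
next
  case False
  let ?J = "{1..n} <+> {1..n}"
  let ?X = "case_sum (\<lambda>x. V x 0) (\<lambda>y. E 0 y)"
  let ?k = "case_sum (\<lambda>x. v x 0) (\<lambda>y. e 0 y)"
  have "{\<omega> \<in> space N. past n 0 v e \<omega>} = (\<Inter>i\<in>?J. ?X i -` {?k i} \<inter> space N)"
    using False by (auto simp: past_def Plus_def ball_Un)
  also have "measure N \<dots> = (\<Prod>i\<in>?J. measure N (?X i -` {?k i} \<inter> space N))"
    by (rule indep_varsD[OF boundary_indep]) (use False in auto)
  also have "\<dots> = (\<Prod>x=1..n. measure N (V x 0 -` {v x 0} \<inter> space N)) * (\<Prod>y=1..n. measure N (E 0 y -` {e 0 y} \<inter> space N))"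
    by (simp add: prod.Plus)
  also have "\<dots> = (\<Prod>x=1..n. boundary_prob q s \<alpha> (\<theta> x) (v x 0)) * (\<Prod>y=1..n. boundary_prob q s \<beta> (\<xi> y) (e 0 y))"
    by (intro arg_cong2[where f = times] prod.cong refl)
       (auto simp: V_law[symmetric] E_law[symmetric] vimage_def Int_def conj_commute)
  finally show ?thesis .
qed

text \<open>The bound \<open>d \<le> Suc n\<close> is as far as \<open>past_step\<close> reaches: it
  is applied last at d = n.\<close>

lemma past_law:
  assumes "d \<le> Suc n"
  shows "measure N {\<omega> \<in> space N. past n d v e \<omega>}
    = (\<Prod>x=1..n. boundary_prob q s \<alpha> (\<theta> x) (v x 0)) * (\<Prod>y=1..n. boundary_prob q s \<beta> (\<xi> y) (e 0 y))
      * (\<Prod>(x, y)\<in>{(x, y). 1 \<le> x \<and> 1 \<le> y \<and> x + y < d}.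
           L_cont q s (\<xi> y) (\<theta> x) (v x (y - 1)) (e (x - 1) y) (v x y) (e x y))"
  using assms
proof (induction d)
  case 0
  show ?case by (simp add: boundary_law)
next
  case (Suc d)
  let ?L = "\<lambda>(x, y). L_cont q s (\<xi> y) (\<theta> x) (v x (y - 1)) (e (x - 1) y) (v x y) (e x y)"
  have "{(x, y). 1 \<le> x \<and> 1 \<le> y \<and> x + y < Suc d}
      = {(x, y). 1 \<le> x \<and> 1 \<le> y \<and> x + y < d} \<union> {(x, y). 1 \<le> x \<and> 1 \<le> y \<and> x + y = d}" by auto
  then have "prod ?L {(x, y). 1 \<le> x \<and> 1 \<le> y \<and> x + y < Suc d}
      = prod ?L {(x, y). 1 \<le> x \<and> 1 \<le> y \<and> x + y < d} * prod ?L {(x, y). 1 \<le> x \<and> 1 \<le> y \<and> x + y = d}"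
    by (simp only:) (rule prod.union_disjoint[OF finite_quadrant_triangle finite_quadrant_antidiagonal], auto)
  moreover have "d \<le> n" "d \<le> Suc n" using Suc.prems by simp_all
  ultimately show ?case
    by (simp only: past_step Suc.IH mult.assoc)
qed

text \<open>The triangle splits into the origin, the two axes and the interior; apart from the
  origin the factors are those of \<open>past_law\<close> with d = Suc n.\<close>

lemma prod_vertex_prob:
  "(\<Prod>(x, y)\<in>{(x, y). x + y < Suc n}. vertex_prob q s \<xi> \<theta> \<alpha> \<beta> \<sigma> x y)
   = q_Poisson_prob q (\<alpha> * \<beta>) (\<sigma> 0 0) *
     measure N {\<omega> \<in> space N. past n (Suc n) (\<lambda>x y. \<sigma> x y - left_of \<sigma> x y) (\<lambda>x y. \<sigma> x y - below \<sigma> x y) \<omega>}"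
proof -
  let ?f = "\<lambda>(x, y). vertex_prob q s \<xi> \<theta> \<alpha> \<beta> \<sigma> x y"
  let ?B = "(\<lambda>x. (x, 0)) ` {1..n}" and ?L = "(\<lambda>y. (0, y)) ` {1..n}"
    and ?I = "{(x, y). 1 \<le> x \<and> 1 \<le> y \<and> x + y < Suc n}"
  have eq: "{(x, y). x + y < Suc n} = insert (0, 0) (?B \<union> ?L \<union> ?I)"
  proof (rule set_eqI)
    fix p :: "nat \<times> nat"
    obtain x y where p: "p = (x, y)" by fastforce
    show "p \<in> {(x, y). x + y < Suc n} \<longleftrightarrow> p \<in> insert (0, 0) (?B \<union> ?L \<union> ?I)"
      unfolding p by (cases x; cases y) (auto simp: image_iff)
  qed
  have fin: "finite ?I" by (rule finite_quadrant_triangle)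
  have "prod ?f {(x, y). x + y < Suc n} = ?f (0, 0) * (prod ?f ?B * prod ?f ?L * prod ?f ?I)"
  proof -
    have "prod ?f (?B \<union> ?L \<union> ?I) = prod ?f (?B \<union> ?L) * prod ?f ?I"
      by (rule prod.union_disjoint[OF _ fin]) auto
    moreover have "prod ?f (?B \<union> ?L) = prod ?f ?B * prod ?f ?L"
      by (rule prod.union_disjoint) auto
    moreover have "prod ?f (insert (0, 0) (?B \<union> ?L \<union> ?I)) = ?f (0, 0) * prod ?f (?B \<union> ?L \<union> ?I)"
      using fin by (intro prod.insert) auto
    ultimately show ?thesis unfolding eq by (simp only:)
  qed
  also have "prod ?f ?B = (\<Prod>x=1..n. ?f (x, 0))"
    by (subst prod.reindex) (auto simp: inj_on_def)
  also have "prod ?f ?L = (\<Prod>y=1..n. ?f (0, y))"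
    by (subst prod.reindex) (auto simp: inj_on_def)
  finally have "prod ?f {(x, y). x + y < Suc n} = ?f (0, 0) * ((\<Prod>x=1..n. ?f (x, 0)) * (\<Prod>y=1..n. ?f (0, y)) * prod ?f ?I)" .
  moreover have "prod ?f ?I = (\<Prod>(x, y)\<in>?I. L_cont q s (\<xi> y) (\<theta> x)
      (\<sigma> x (y - 1) - left_of \<sigma> x (y - 1)) (\<sigma> (x - 1) y - below \<sigma> (x - 1) y)
      (\<sigma> x y - left_of \<sigma> x y) (\<sigma> x y - below \<sigma> x y))"
    by (intro prod.cong refl) (auto simp: vertex_prob_def below_def left_of_def)
  moreover have "(\<Prod>x=1..n. ?f (x, 0)) = (\<Prod>x=1..n. boundary_prob q s \<alpha> (\<theta> x) (\<sigma> x 0 - left_of \<sigma> x 0))"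
    "(\<Prod>y=1..n. ?f (0, y)) = (\<Prod>y=1..n. boundary_prob q s \<beta> (\<xi> y) (\<sigma> 0 y - below \<sigma> 0 y))"
    by (auto intro!: prod.cong simp: vertex_prob_def)
  moreover have "?f (0, 0) = q_Poisson_prob q (\<alpha> * \<beta>) (\<sigma> 0 0)" by (simp add: vertex_prob_def)
  ultimately show ?thesis
    by (simp only: past_law[OF order_refl])
qed

text \<open>An array on a triangle amounts to its corner value and its increments along all edges.
  Conservation makes V the horizontal increment in every row, beyond the bottom row where
  \<open>height\<close> has it by definition.\<close>

lemma height_eq_iff:
  assumes cons: "\<And>x y. 1 \<le> x \<Longrightarrow> 1 \<le> y \<Longrightarrow> V x (y - 1) \<omega> + E x y \<omega> = V x y \<omega> + E (x - 1) y \<omega>"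
  shows "(\<forall>x y. x + y < Suc n \<longrightarrow> height (\<lambda>x y. V x y \<omega>) (\<lambda>x y. E x y \<omega>) x y + k = \<sigma> x y)
    \<longleftrightarrow> (\<forall>x y. x + y < Suc n \<longrightarrow> increasing_at \<sigma> x y) \<and> k = \<sigma> 0 0 \<and>
        past n (Suc n) (\<lambda>x y. \<sigma> x y - left_of \<sigma> x y) (\<lambda>x y. \<sigma> x y - below \<sigma> x y) \<omega>"
proof -
  define h where "h x y = height (\<lambda>x y. V x y \<omega>) (\<lambda>x y. E x y \<omega>) x y + k" for x y
  have h0: "h 0 0 = k" by (simp add: h_def)
  have hr: "h (Suc x) y = h x y + V (Suc x) y \<omega>" for x y
    unfolding h_def using height_right[of "\<lambda>x y. V x y \<omega>" "\<lambda>x y. E x y \<omega>" x y] cons by simp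
  have hu: "h x (Suc y) = h x y + E x (Suc y) \<omega>" for x y
    unfolding h_def by (cases x) simp_all
  \<comment> \<open>Indexing each increment by the point where it starts merges boundary and
    interior edges into one condition.\<close>
  have past_iff: "past n (Suc n) v e \<omega> \<longleftrightarrow> (\<forall>x y. x + y < n \<longrightarrow> V (Suc x) y \<omega> = v (Suc x) y \<and> E x (Suc y) \<omega> = e x (Suc y))"
    for v e
  proof
    assume p: "past n (Suc n) v e \<omega>"
    show "\<forall>x y. x + y < n \<longrightarrow> V (Suc x) y \<omega> = v (Suc x) y \<and> E x (Suc y) \<omega> = e x (Suc y)"
    proof (intro allI impI conjI)
      fix x y assume "x + y < n"
      with p show "V (Suc x) y \<omega> = v (Suc x) y" by (cases "y = 0") (auto simp: past_def)
      from p \<open>x + y < n\<close> show "E x (Suc y) \<omega> = e x (Suc y)" by (cases "x = 0") (auto simp: past_def)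
    qed
  next
    assume p: "\<forall>x y. x + y < n \<longrightarrow> V (Suc x) y \<omega> = v (Suc x) y \<and> E x (Suc y) \<omega> = e x (Suc y)"
    have "V x y \<omega> = v x y" if "1 \<le> x" "x + y \<le> n" for x y
      using p[rule_format, of "x - 1" y] that by simp
    moreover have "E x y \<omega> = e x y" if "1 \<le> y" "x + y \<le> n" for x y
      using p[rule_format, of x "y - 1"] that by simp
    ultimately show "past n (Suc n) v e \<omega>" by (auto simp: past_def)
  qed
  show ?thesis
    unfolding h_def[symmetric]
  proof (intro iffI conjI)
    assume h: "\<forall>x y. x + y < Suc n \<longrightarrow> h x y = \<sigma> x y"
    show "k = \<sigma> 0 0" using h h0 by simp
    show "\<forall>x y. x + y < Suc n \<longrightarrow> increasing_at \<sigma> x y"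
    proof (intro allI impI)
      fix x y assume xy: "x + y < Suc n"
      show "increasing_at \<sigma> x y"
        unfolding increasing_at_def
      proof
        show "left_of \<sigma> x y \<le> \<sigma> x y"
          using h[rule_format, of x y] h[rule_format, of "x - 1" y] hr[of "x - 1" y] xy
          by (auto simp: left_of_def)
        show "below \<sigma> x y \<le> \<sigma> x y"
          using h[rule_format, of x y] h[rule_format, of x "y - 1"] hu[of x "y - 1"] xy
          by (auto simp: below_def)
      qed
    qed
    show "past n (Suc n) (\<lambda>x y. \<sigma> x y - left_of \<sigma> x y) (\<lambda>x y. \<sigma> x y - below \<sigma> x y) \<omega>"
      unfolding past_iff
    proof (intro allI impI)
      fix x y assume "x + y < n"
      then have "h x y = \<sigma> x y" "h (Suc x) y = \<sigma> (Suc x) y" "h x (Suc y) = \<sigma> x (Suc y)"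
        using h by auto
      moreover have "V (Suc x) y \<omega> = h (Suc x) y - h x y" "E x (Suc y) \<omega> = h x (Suc y) - h x y"
        by (simp_all add: hr hu)
      ultimately show "V (Suc x) y \<omega> = \<sigma> (Suc x) y - left_of \<sigma> (Suc x) y \<and> E x (Suc y) \<omega> = \<sigma> x (Suc y) - below \<sigma> x (Suc y)"
        by (simp add: left_of_def below_def)
    qed
  next
    assume *: "(\<forall>x y. x + y < Suc n \<longrightarrow> increasing_at \<sigma> x y) \<and> k = \<sigma> 0 0 \<and>
        past n (Suc n) (\<lambda>x y. \<sigma> x y - left_of \<sigma> x y) (\<lambda>x y. \<sigma> x y - below \<sigma> x y) \<omega>"
    have V: "V (Suc x) y \<omega> = \<sigma> (Suc x) y - \<sigma> x y" "\<sigma> x y \<le> \<sigma> (Suc x) y" if "x + y < n" for x y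
    proof -
      have "increasing_at \<sigma> (Suc x) y" using * that by auto
      then show "\<sigma> x y \<le> \<sigma> (Suc x) y" by (simp add: increasing_at_def left_of_def)
      show "V (Suc x) y \<omega> = \<sigma> (Suc x) y - \<sigma> x y"
        using * that unfolding past_iff by (simp add: left_of_def)
    qed
    have E: "E x (Suc y) \<omega> = \<sigma> x (Suc y) - \<sigma> x y" "\<sigma> x y \<le> \<sigma> x (Suc y)" if "x + y < n" for x y
    proof -
      have "increasing_at \<sigma> x (Suc y)" using * that by auto
      then show "\<sigma> x y \<le> \<sigma> x (Suc y)" by (simp add: increasing_at_def below_def)
      show "E x (Suc y) \<omega> = \<sigma> x (Suc y) - \<sigma> x y"
        using * that unfolding past_iff by (simp add: below_def)
    qed
    \<comment> \<open>The heights are rebuilt along the bottom row and then up each column.\<close>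
    have bottom: "h x 0 = \<sigma> x 0" if "x \<le> n" for x
      using that by (induction x) (use h0 hr V * in auto)
    have "h x y = \<sigma> x y" if "x + y \<le> n" for x y
      using that by (induction y) (use bottom hu E in auto)
    then show "\<forall>x y. x + y < Suc n \<longrightarrow> h x y = \<sigma> x y" by auto
  qed
qed

end

section \<open>Measurability and law of the shifted height function\<close>

lemma (in vertex_process) height_measurable:
  "(\<lambda>\<omega>. height (\<lambda>x y. V x y \<omega>) (\<lambda>x y. E x y \<omega>) x y) \<in> measurable N (count_space UNIV)"
proof (induction y)
  case 0
  show ?case
  proof (induction x)
    case (Suc x)
    have [measurable]: "V (Suc x) 0 \<in> measurable N (count_space UNIV)" by (rule V_meas) simp
    note [measurable] = Suc
    show ?case by simp
  qed simp
next
  case (Suc y)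
  have [measurable]: "E x (Suc y) \<in> measurable N (count_space UNIV)" by (rule E_meas) simp
  note [measurable] = Suc
  have "height v e x (Suc y) = height v e x y + e x (Suc y)" for v e by (cases x) simp_all
  then show ?case by simp
qed

text \<open>By \<open>height_eq_iff\<close> the event fixes the corner value, which is X, and the
  edge increments, which are functions of V and E; independence factors its probability
  accordingly.\<close>

lemma (in vertex_process) height_law:
  assumes indep: "indep_rvs N (count_space UNIV) X (PiM UNIV (\<lambda>_. count_space UNIV))
       (\<lambda>\<omega> (x, y). (V (Suc x) y \<omega>, E x (Suc y) \<omega>))"
    and X: "\<And>k. measure N {\<omega> \<in> space N. X \<omega> = k} = q_Poisson_prob q (\<alpha> * \<beta>) k"
  shows "measure N {\<omega> \<in> space N. \<forall>x y. x + y < d \<longrightarrow> height (\<lambda>x y. V x y \<omega>) (\<lambda>x y. E x y \<omega>) x y + X \<omega> = \<sigma> x y}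
    = (if \<forall>x y. x + y < d \<longrightarrow> increasing_at \<sigma> x y
       then \<Prod>(x, y)\<in>{(x, y). x + y < d}. vertex_prob q s \<xi> \<theta> \<alpha> \<beta> \<sigma> x y else 0)"
proof (cases d)
  case 0
  then show ?thesis by (simp add: prob_space)
next
  case (Suc n)
  let ?v = "\<lambda>x y. \<sigma> x y - left_of \<sigma> x y" and ?e = "\<lambda>x y. \<sigma> x y - below \<sigma> x y"
  let ?P = "PiM UNIV (\<lambda>_ :: nat \<times> nat. count_space UNIV) :: (nat \<times> nat \<Rightarrow> nat \<times> nat) measure"
  define Y where "Y = (\<lambda>\<omega> (x, y). (V (Suc x) y \<omega>, E x (Suc y) \<omega>))"
  have X_meas[measurable]: "X \<in> measurable N (count_space UNIV)" and Y_meas: "Y \<in> measurable N ?P"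
    and ind: "indep_set (sets (vimage_algebra (space N) X (count_space UNIV))) (sets (vimage_algebra (space N) Y ?P))"
    using indep by (auto simp: indep_rvs_def Y_def)
  define B where "B = {\<omega> \<in> space N. past n (Suc n) ?v ?e \<omega>}"
  have B: "B \<in> sets N" unfolding B_def by (rule past_sets)
  have "B \<in> sets (vimage_algebra (space N) Y ?P)"
  proof -
    \<comment> \<open>\<open>Y\<close> stores V x y at index (x - 1, y) and E x y at (x, y - 1), so
      \<open>past\<close> is transcribed with shifted indices.\<close>
    define B' where "B' = {f \<in> space ?P. (\<forall>x\<in>{1..n}. fst (f (x - 1, 0)) = ?v x 0) \<and> (\<forall>y\<in>{1..n}. snd (f (0, y - 1)) = ?e 0 y) \<and>
      (\<forall>x y. 1 \<le> x \<longrightarrow> 1 \<le> y \<longrightarrow> x + y < Suc n \<longrightarrow> fst (f (x - 1, y)) = ?v x y \<and> snd (f (x, y - 1)) = ?e x y)}"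
    have "B' \<in> sets ?P" unfolding B'_def by measurable
    moreover have "B = Y -` B' \<inter> space N"
      by (auto simp: B_def B'_def past_def Y_def space_PiM)
    ultimately show ?thesis by (auto intro: in_vimage_algebra)
  qed
  moreover have "{\<omega> \<in> space N. X \<omega> = k} \<in> sets (vimage_algebra (space N) X (count_space UNIV))" for k
    using in_vimage_algebra[of "{k}" "count_space UNIV" X "space N"] by (simp add: vimage_def Int_def conj_commute)
  ultimately have "measure N ({\<omega> \<in> space N. X \<omega> = \<sigma> 0 0} \<inter> B) = q_Poisson_prob q (\<alpha> * \<beta>) (\<sigma> 0 0) * measure N B"
    using indep_setD[OF ind] by (simp add: X)
  also have "\<dots> = (\<Prod>(x, y)\<in>{(x, y). x + y < d}. vertex_prob q s \<xi> \<theta> \<alpha> \<beta> \<sigma> x y)"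
    unfolding B_def Suc by (rule prod_vertex_prob[symmetric])
  finally have prod: "measure N ({\<omega> \<in> space N. X \<omega> = \<sigma> 0 0} \<inter> B)
      = (\<Prod>(x, y)\<in>{(x, y). x + y < d}. vertex_prob q s \<xi> \<theta> \<alpha> \<beta> \<sigma> x y)" .
  define A where "A = (if \<forall>x y. x + y < d \<longrightarrow> increasing_at \<sigma> x y then {\<omega> \<in> space N. X \<omega> = \<sigma> 0 0} \<inter> B else {})"
  have "measure N {\<omega> \<in> space N. \<forall>x y. x + y < d \<longrightarrow> height (\<lambda>x y. V x y \<omega>) (\<lambda>x y. E x y \<omega>) x y + X \<omega> = \<sigma> x y} = measure N A"
  proof (rule measure_eq_AE)
    show "AE \<omega> in N. \<omega> \<in> {\<omega> \<in> space N. \<forall>x y. x + y < d \<longrightarrow> height (\<lambda>x y. V x y \<omega>) (\<lambda>x y. E x y \<omega>) x y + X \<omega> = \<sigma> x y}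
        \<longleftrightarrow> \<omega> \<in> A"
      using AE_paths_conserved
    proof eventually_elim
      case (elim \<omega>)
      then have "\<And>x y. 1 \<le> x \<Longrightarrow> 1 \<le> y \<Longrightarrow> V x (y - 1) \<omega> + E x y \<omega> = V x y \<omega> + E (x - 1) y \<omega>" by blast
      from height_eq_iff[of \<omega>, OF this, of n "X \<omega>" \<sigma>] show ?case
        by (auto simp: A_def B_def Suc)
    qed
    note [measurable] = height_measurable
    show "{\<omega> \<in> space N. \<forall>x y. x + y < d \<longrightarrow> height (\<lambda>x y. V x y \<omega>) (\<lambda>x y. E x y \<omega>) x y + X \<omega> = \<sigma> x y} \<in> sets N"
      by measurable
    show "A \<in> sets N" unfolding A_def using B by auto
  qed
  then show ?thesis using prod by (auto simp: A_def)
qed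

theorem theorem7p25:
  fixes q s \<alpha> \<beta> :: real
    and \<xi> \<theta> :: "nat \<Rightarrow> real"
    and M :: "'a measure" and N :: "'b measure"
    and K :: "spec \<Rightarrow> spec \<Rightarrow> bdata \<Rightarrow> (triple \<times> triple) pmf"
    and lam :: "nat \<Rightarrow> nat \<Rightarrow> 'a \<Rightarrow> diagram"
    and V E :: "nat \<Rightarrow> nat \<Rightarrow> 'b \<Rightarrow> nat"
    and X :: "'b \<Rightarrow> nat"
  assumes q: "0 < q" "q < 1"
    and s: "- sqrt q \<le> s" "s < 0"
    and \<xi>: "\<And>y. 1 \<le> y \<Longrightarrow> \<xi> y \<in> {- s..- inverse s}"
    and \<theta>: "\<And>x. 1 \<le> x \<Longrightarrow> \<theta> x \<in> {- s..- inverse s}"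
    and \<alpha>: "\<alpha> \<in> {0..- inverse s}"
    and \<beta>: "\<beta> \<in> {0..- inverse s}"
    and \<xi>\<theta>: "\<And>x y. 1 \<le> x \<Longrightarrow> 1 \<le> y \<Longrightarrow> \<xi> y * \<theta> x < 1"
    and \<alpha>\<theta>: "\<And>x. 1 \<le> x \<Longrightarrow> \<alpha> * \<theta> x < 1"
    and \<beta>\<xi>: "\<And>y. 1 \<le> y \<Longrightarrow> \<beta> * \<xi> y < 1"
    and \<alpha>\<beta>: "\<alpha> * \<beta> < 1"
    and M: "prob_space M"
    and field: "YB_field M q s \<xi> \<theta> \<alpha> \<beta> K lam"
    and N: "prob_space N"
    and vertex: "vertex_model N q s \<xi> \<theta> \<alpha> \<beta> V E"
    and X: "\<And>k. measure N {\<omega> \<in> space N. X \<omega> = k} = q_Poisson_prob q (\<alpha> * \<beta>) k"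
    and indep: "indep_rvs N
       (count_space UNIV) X
       (PiM UNIV (\<lambda>_. count_space UNIV))
       (\<lambda>\<omega> (x, y). (V (Suc x) y \<omega>, E x (Suc y) \<omega>))"
  shows "distr M (PiM UNIV (\<lambda>_. count_space UNIV)) (\<lambda>\<omega> (x, y). size (lam x y \<omega>))
       = distr N (PiM UNIV (\<lambda>_. count_space UNIV))
           (\<lambda>\<omega> (x, y). height (\<lambda>x y. V x y \<omega>) (\<lambda>x y. E x y \<omega>) x y + X \<omega>)"
proof -
  have sqrt: "sqrt q < 1" using q by simp
  \<comment> \<open>The range of s enters in this form, which gives s^2 < 1 and keeps (s^2;q)_inf
    from vanishing.\<close>
  then have s': "-1 < s" using s by linarith
  have "\<exists>j j'. YB_increments M q s \<alpha> \<beta> \<xi> \<theta> K lam j j'"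
    using field M unfolding YB_field_def Let_def YB_increments_def YB_increments_axioms_def
    by (elim conjE exE) (intro exI conjI; (assumption | simp))
  then obtain j j' where "YB_increments M q s \<alpha> \<beta> \<xi> \<theta> K lam j j'" by blast
  then interpret Y: YB_increments M q s \<alpha> \<beta> \<xi> \<theta> K lam j j' .
  interpret V: vertex_process N q s \<alpha> \<beta> \<xi> \<theta> V E
    using vertex N unfolding vertex_model_def Let_def vertex_process_def vertex_process_axioms_def by blast
  have X_meas [measurable]: "X \<in> measurable N (count_space UNIV)"
    using indep by (simp add: indep_rvs_def)
  note [measurable] = V.height_measurable
  show ?thesis
  proof (rule distr_eqI_triangles[OF M N])
    show "(\<lambda>\<omega>. size (lam x y \<omega>)) \<in> measurable M (count_space UNIV)" for x y
      by measurable
    show "(\<lambda>\<omega>. height (\<lambda>x y. V x y \<omega>) (\<lambda>x y. E x y \<omega>) x y + X \<omega>) \<in> measurable N (count_space UNIV)" for x y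
      by measurable
    show "measure M {\<omega> \<in> space M. \<forall>x y. x + y < n \<longrightarrow> size (lam x y \<omega>) = \<sigma> x y}
      = measure N {\<omega> \<in> space N. \<forall>x y. x + y < n \<longrightarrow> height (\<lambda>x y. V x y \<omega>) (\<lambda>x y. E x y \<omega>) x y + X \<omega> = \<sigma> x y}" for n \<sigma>
    proof -
      \<comment> \<open>Only increasing arrays have to be compared; on the others both laws are
        0.\<close>
      have "(\<Prod>(x, y)\<in>{(x, y). x + y < n}. field_prob q s \<xi> \<theta> \<alpha> \<beta> \<sigma> x y)
          = (\<Prod>(x, y)\<in>{(x, y). x + y < n}. vertex_prob q s \<xi> \<theta> \<alpha> \<beta> \<sigma> x y)"
        if "\<forall>x y. x + y < n \<longrightarrow> increasing_at \<sigma> x y"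
        using q s' s \<xi> \<theta> \<xi>\<theta> \<alpha>\<theta> \<beta>\<xi> \<alpha>\<beta> that by (intro prod_field_prob_eq_prod_vertex_prob) auto
      then show ?thesis
        unfolding Y.size_law V.height_law[OF indep X] by auto
    qed
  qed
qed

end
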